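(* Let $\Lambda,\Lambda_G,\Lambda_M$ be the random measures described in the context, with $\lambda,a,\sigma^2,\rho,\tilde F^{\pm}$ as defined there. Let $f:S\to\mathbb{R}$ be $\sigma(\mathcal{S})$-measurable, and for $u\in\mathbb{R}$, $s\in S$ put $$U(u,s)=u\,a(s)+\int_{\mathbb{R}}\big(\tau(xu)-u\tau(x)\big)\rho(s,dx),\qquad V_0(u,s)=\int_{\mathbb{R}}(1\wedge|xu|^2)\,|\rho|(s,dx).$$ If $f$ is integrable with respect to both $\Lambda_G$ and $\Lambda_M$, then (i) $\int_S|U(f(s),s)|\,\lambda(ds)<\infty$, (ii) $\int_S|f(s)|^2\sigma^2(s)\,\lambda(ds)<\infty$, (iii) $\int_S V_0(f(s),s)\,\lambda(ds)<\infty$, and $f$ is $\Lambda$-integrable. Further, for every $\theta\in\mathbb{R}$, $$\mathbb{E}\Big[e^{i\theta\int_S f d\Lambda}\Big]=\exp\Big(i\theta a_f-\tfrac12\theta^2\sigma_f^2+\int_{\mathbb{R}}\big(e^{i\theta x}-1-i\theta\tau(x)\big)F_f(dx)\Big),$$ where $a_f=\int_S U(f(s),s)\lambda(ds)$, $\sigma_f^2=\int_S|f(s)|^2\sigma^2(s)\lambda(ds)$, and $F_f$ is the unique quasi-Lévy measure determined by the difference of the Lévy measures $\tilde F_f^{+}$ and $\tilde F_f^{-}$ (i.e. $F_f(B)=\tilde F_f^+(B)-\tilde F_f^-(B)$ for Borel $B$ with $0\notin\overline B$), where $\tilde F_f^{\pm}(B)=\tilde F^{\pm}(\{(s,x)\in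 S\times\mathbb{R}: f(s)x\in B\setminus\{0\}\})$ for $B\in\mathcal{B}(\mathbb{R})$.
   Context: $\mathcal{B}_0(\mathbb{R})$ is the class of Borel sets $B\subset\mathbb{R}$ with $0\notin\overline B$. $\tau(x)=x$ if $|x|\le1$, $\tau(x)=x/|x|$ if $|x|>1$. A quasi-Lévy type measure is a function $\nu:\mathcal{B}_0(\mathbb{R})\to\mathbb{R}$ whose restriction to $\mathcal{B}_r(\mathbb{R})=\{B\text{ Borel}: B\cap(-r,r)=\emptyset\}$ is a finite signed measure for each $r>0$ and with $\int_{\mathbb{R}}(1\wedge x^2)|\nu|(dx)<\infty$; here $\nu^+,\nu^-,|\nu|$ are the unique measures on $\mathcal{B}(\mathbb{R})$ with no mass at $0$ which coincide on each $\mathcal{B}_r(\mathbb{R})$ with the positive part, negative part and total variation of the restriction. For $g$ $|\nu|$-integrable, $\int g\,d\nu:=\int g\,d\nu^+-\int g\,d\nu^-$. A distribution on $\mathbb{R}$ is quasi-infinitely divisible (QID) with characteristic triplet $(\gamma,a,\nu)$ if its characteristic function is $\exp(i\theta\gamma-\frac{\theta^2}{2}a+\int(e^{i\theta x}-1-i\theta\tau(x))\nu(dx))$ with $\gamma,a\in\mathbb{R}$ and $\nu$ a quasi-Lévy type measure; then $\nu$ is called a quasi-Lévy measure. It is ID when $\nu$ is a Lévy measure. $S$ is a non-empty set and $\mathcal{S}$ a $\delta$-ring of subsets of $S$ containing an increasing sequence $S_1\subset S_2\subset\dots$ with $\bigcup_nS_n=S$. An independently scattered random measure is a real process $\{\Lambda(A):A\in\mathcal{S}\}$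 such that for disjoint $A_n\in\mathcal{S}$ the $\Lambda(A_n)$ are independent and, if $\bigcup_nA_n\in\mathcal{S}$, $\Lambda(\bigcup_nA_n)=\sum_n\Lambda(A_n)$ a.s. It is a QID (ID) random measure if each $\Lambda(A)$ is QID (ID). Setting. $\nu_0:\mathcal{S}\to\mathbb{R}$ is a signed measure, $\nu_1:\mathcal{S}\to[0,\infty)$ a measure; for every $A\in\mathcal{S}$, $G_A$ and $M_A$ are Lévy measures on $\mathbb{R}$, and for every $B\in\mathcal{B}_0(\mathbb{R})$, $A\mapsto G_A(B)$ and $A\mapsto M_A(B)$ are finite measures on $\mathcal{S}$. $F_A$ is the quasi-Lévy type measure $F_A(B)=G_A(B)-M_A(B)$, $B\in\mathcal{B}_0(\mathbb{R})$, and $(\nu_0(A),\nu_1(A),F_A)$ is assumed to be the characteristic triplet of a QID random variable for every $A\in\mathcal{S}$. $\Lambda$ is the (unique in finite-dimensional distributions) QID random measure such that $\Lambda(A)$ has triplet $(\nu_0(A),\nu_1(A),F_A)$. $\Lambda_G$ and $\Lambda_M$ are the ID random measures such that $\Lambda_G(A)$ has triplet $(0,\nu_1(A),G_A)$ and $\Lambda_M(A)$ has triplet $(-\nu_0(A),0,M_A)$, $A\in\mathcal{S}$. Control measures, extended to $\sigma$-finite measures on $\sigma(\mathcal{S})$: $\lambda(A)=|\nu_0|(A)+\nu_1(A)+\int(1\wedge x^2)G_A(dx)+\int(1\wedge x^2)M_A(dx)$ for $\Lambda$; $\lambda_G(A)=\nu_1(A)+\int(1\wedge x^2)G_A(dx)$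 for $\Lambda_G$; $\lambda_M(A)=|\nu_0|(A)+\int(1\wedge x^2)M_A(dx)$ for $\Lambda_M$. $a=d\nu_0/d\lambda$, $\sigma^2=d\nu_1/d\lambda$. There are $\rho_G,\rho_M:S\times\mathcal{B}(\mathbb{R})\to[0,\infty]$ with $\rho_G(s,\cdot),\rho_M(s,\cdot)$ Lévy measures for every $s$, measurable in $s$, and $G_A(B)=\int_A\rho_G(s,B)\lambda(ds)$, $M_A(B)=\int_A\rho_M(s,B)\lambda(ds)$. $\rho(s,\cdot)$ is the quasi-Lévy type measure $\rho(s,B)=\rho_G(s,B)-\rho_M(s,B)$, $B\in\mathcal{B}_0(\mathbb{R})$, with positive part $\rho^+$, negative part $\rho^-$, total variation $|\rho|$. $\tilde F^{\pm}(C)=\int_S\int_{\mathbb{R}}\mathbf{1}_C(s,x)\rho^{\pm}(s,dx)\lambda(ds)$ for $C\in\sigma(\mathcal{S})\otimes\mathcal{B}(\mathbb{R})$. Integral: for a simple function $f=\sum_{j=1}^nx_j\mathbf{1}_{A_j}$ with disjoint $A_j\in\mathcal{S}$ and $A\in\sigma(\mathcal{S})$, $\int_Af\,d\Lambda=\sum_jx_j\Lambda(A\cap A_j)$. A $\sigma(\mathcal{S})$-measurable $f$ is $\Lambda$-integrable if there are simple $f_n\to f$ $\lambda$-a.e. such that for every $A\in\sigma(\mathcal{S})$ the sequence $\int_Af_n\,d\Lambda$ converges in probability; $\int_Af\,d\Lambda$ is the limit in probability (independent of the sequence). Integrability with respect to $\Lambda_G$, $\Lambda_M$ is defined in the same way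 using $\lambda_G$, $\lambda_M$. *)

theory Defs
  imports "HOL-Probability.Probability"
begin

definition delta_ring :: "'a set \<Rightarrow> 'a set set \<Rightarrow> bool" where
  "delta_ring S R \<longleftrightarrow> ring_of_sets S R \<and> (\<forall>A::nat \<Rightarrow> 'a set. range A \<subseteq> R \<longrightarrow> (\<Inter>n. A n) \<in> R)"

definition signed_measure_on :: "'a set set \<Rightarrow> ('a set \<Rightarrow> real) \<Rightarrow> bool" where
  "signed_measure_on R \<nu> \<longleftrightarrow> \<nu> {} = 0 \<and>
     (\<forall>A::nat \<Rightarrow> 'a set. range A \<subseteq> R \<longrightarrow> disjoint_family A \<longrightarrow> (\<Union>n. A n) \<in> R \<longrightarrow>
        (\<lambda>n. \<nu> (A n)) sums \<nu> (\<Union>n. A n))"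

definition finite_measure_on :: "'a set set \<Rightarrow> ('a set \<Rightarrow> real) \<Rightarrow> bool" where
  "finite_measure_on R \<mu> \<longleftrightarrow> (\<forall>A\<in>R. 0 \<le> \<mu> A) \<and> signed_measure_on R \<mu>"

text \<open>The parts of the Jordan decomposition are given by the variation suprema rather than by
  a Hahn decomposition, which need not exist globally on a ring of sets.\<close>

definition pos_variation :: "'a set set \<Rightarrow> ('a set \<Rightarrow> real) \<Rightarrow> 'a set \<Rightarrow> ennreal" where
  "pos_variation R \<nu> A = (SUP B\<in>{B \<in> R. B \<subseteq> A}. ennreal (\<nu> B))"

definition neg_variation :: "'a set set \<Rightarrow> ('a set \<Rightarrow> real) \<Rightarrow> 'a set \<Rightarrow> ennreal" where
  "neg_variation R \<nu> A = (SUP B\<in>{B \<in> R. B \<subseteq> A}. ennreal (- \<nu> B))"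

definition total_variation :: "'a set set \<Rightarrow> ('a set \<Rightarrow> real) \<Rightarrow> 'a set \<Rightarrow> ennreal" where
  "total_variation R \<nu> A =
     (SUP \<B>\<in>{\<B>. finite \<B> \<and> \<B> \<subseteq> R \<and> disjoint \<B> \<and> \<Union>\<B> \<subseteq> A}. \<Sum>B\<in>\<B>. ennreal \<bar>\<nu> B\<bar>)"

text \<open>A \<open>\<sigma>\<close>-finite measure on \<open>\<sigma>(R)\<close> extending \<open>m\<close>; on a \<open>\<delta>\<close>-ring with an exhausting
  sequence it is unique.\<close>

definition measure_extension :: "'a set \<Rightarrow> 'a set set \<Rightarrow> ('a set \<Rightarrow> ennreal) \<Rightarrow> 'a measure \<Rightarrow> bool" where
  "measure_extension S R m \<mu> \<longleftrightarrow>
     sets \<mu> = sets (sigma S R) \<and> sigma_finite_measure \<mu> \<and> (\<forall>A\<in>R. emeasure \<mu> A = m A)"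

text \<open>\<open>h\<close> is a version of the Radon--Nikodym derivative of \<open>\<nu>\<close> (a real-valued set function
  on \<open>R\<close>) with respect to \<open>\<mu>\<close>.\<close>

definition RN_derivative_on :: "'a set set \<Rightarrow> 'a measure \<Rightarrow> ('a set \<Rightarrow> real) \<Rightarrow> ('a \<Rightarrow> real) \<Rightarrow> bool" where
  "RN_derivative_on R \<mu> \<nu> h \<longleftrightarrow> h \<in> borel_measurable \<mu> \<and>
     (\<forall>A\<in>R. set_integrable \<mu> A h \<and> \<nu> A = (LINT s:A|\<mu>. h s))"


definition \<tau> :: "real \<Rightarrow> real" where
  "\<tau> x = (if \<bar>x\<bar> \<le> 1 then x else x / \<bar>x\<bar>)"

definition levy_measure :: "real measure \<Rightarrow> bool" where
  "levy_measure M \<longleftrightarrow> sets M = sets borel \<and> emeasure M {0} = 0 \<and>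
     (\<integral>\<^sup>+x. ennreal (min 1 (x\<^sup>2)) \<partial>M) < \<infinity>"

definition Borel0 :: "real set set" where
  "Borel0 = {B \<in> sets borel. 0 \<notin> closure B}"

definition Borel_off :: "real \<Rightarrow> real set set" where
  "Borel_off r = {B \<in> sets borel. B \<inter> {-r<..<r} = {}}"

text \<open>A quasi-Levy type measure is a set function of type \<^typ>\<open>real set \<Rightarrow> real\<close>;
  only its values on \<^const>\<open>Borel0\<close>, the union of all \<^term>\<open>Borel_off r\<close> with \<open>r > 0\<close>,
  are relevant.\<close>

definition extends_off_0 :: "(real \<Rightarrow> real set \<Rightarrow> ennreal) \<Rightarrow> real measure \<Rightarrow> bool" where
  "extends_off_0 m M \<longleftrightarrow> sets M = sets borel \<and> emeasure M {0} = 0 \<and>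
     (\<forall>r>0. \<forall>B\<in>Borel_off r. emeasure M B = m r B)"

definition ql_pos :: "(real set \<Rightarrow> real) \<Rightarrow> real measure" where
  "ql_pos \<nu> = (THE M. extends_off_0 (\<lambda>r. pos_variation (Borel_off r) \<nu>) M)"

definition ql_neg :: "(real set \<Rightarrow> real) \<Rightarrow> real measure" where
  "ql_neg \<nu> = (THE M. extends_off_0 (\<lambda>r. neg_variation (Borel_off r) \<nu>) M)"

definition ql_abs :: "(real set \<Rightarrow> real) \<Rightarrow> real measure" where
  "ql_abs \<nu> = (THE M. extends_off_0 (\<lambda>r. total_variation (Borel_off r) \<nu>) M)"

definition quasi_levy_type :: "(real set \<Rightarrow> real) \<Rightarrow> bool" where
  "quasi_levy_type \<nu> \<longleftrightarrow> (\<forall>r>0. signed_measure_on (Borel_off r) \<nu>) \<and>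
     (\<integral>\<^sup>+x. ennreal (min 1 (x\<^sup>2)) \<partial>ql_abs \<nu>) < \<infinity>"

definition ql_integral ::
    "(real set \<Rightarrow> real) \<Rightarrow> (real \<Rightarrow> 'b::{banach, second_countable_topology}) \<Rightarrow> 'b" where
  "ql_integral \<nu> g = (\<integral>x. g x \<partial>ql_pos \<nu>) - (\<integral>x. g x \<partial>ql_neg \<nu>)"

definition levy_khintchine :: "real \<Rightarrow> real \<Rightarrow> (real set \<Rightarrow> real) \<Rightarrow> real \<Rightarrow> complex" where
  "levy_khintchine \<gamma> a \<nu> \<theta> =
     exp (\<i> * of_real \<theta> * of_real \<gamma> - of_real (\<theta>\<^sup>2 / 2) * of_real a +
          ql_integral \<nu> (\<lambda>x. iexp (\<theta> * x) - 1 - \<i> * of_real \<theta> * of_real (\<tau> x)))"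

definition qid_triplet :: "real measure \<Rightarrow> real \<Rightarrow> real \<Rightarrow> (real set \<Rightarrow> real) \<Rightarrow> bool" where
  "qid_triplet \<mu> \<gamma> a \<nu> \<longleftrightarrow> real_distribution \<mu> \<and> quasi_levy_type \<nu> \<and>
     (\<forall>\<theta>. char \<mu> \<theta> = levy_khintchine \<gamma> a \<nu> \<theta>)"

definition id_triplet :: "real measure \<Rightarrow> real \<Rightarrow> real \<Rightarrow> real measure \<Rightarrow> bool" where
  "id_triplet \<mu> \<gamma> a M \<longleftrightarrow> levy_measure M \<and> qid_triplet \<mu> \<gamma> a (measure M)"

definition quasi_levy_measure :: "(real set \<Rightarrow> real) \<Rightarrow> bool" where
  "quasi_levy_measure \<nu> \<longleftrightarrow> (\<exists>\<mu> \<gamma> a. qid_triplet \<mu> \<gamma> a \<nu>)"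


definition indep_scattered :: "'w measure \<Rightarrow> 's set set \<Rightarrow> ('s set \<Rightarrow> 'w \<Rightarrow> real) \<Rightarrow> bool" where
  "indep_scattered P R L \<longleftrightarrow> prob_space P \<and> (\<forall>A\<in>R. L A \<in> borel_measurable P) \<and>
     (\<forall>A::nat \<Rightarrow> 's set. range A \<subseteq> R \<longrightarrow> disjoint_family A \<longrightarrow>
        prob_space.indep_vars P (\<lambda>_. borel) (\<lambda>n. L (A n)) UNIV \<and>
        ((\<Union>n. A n) \<in> R \<longrightarrow> (AE \<omega> in P. (\<lambda>n. L (A n) \<omega>) sums L (\<Union>n. A n) \<omega>)))"

definition qid_random_measure :: "'w measure \<Rightarrow> 's set set \<Rightarrow> ('s set \<Rightarrow> 'w \<Rightarrow> real) \<Rightarrow>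
    ('s set \<Rightarrow> real) \<Rightarrow> ('s set \<Rightarrow> real) \<Rightarrow> ('s set \<Rightarrow> real set \<Rightarrow> real) \<Rightarrow> bool" where
  "qid_random_measure P R L \<gamma> v F \<longleftrightarrow> indep_scattered P R L \<and>
     (\<forall>A\<in>R. qid_triplet (distr P borel (L A)) (\<gamma> A) (v A) (F A))"

definition id_random_measure :: "'w measure \<Rightarrow> 's set set \<Rightarrow> ('s set \<Rightarrow> 'w \<Rightarrow> real) \<Rightarrow>
    ('s set \<Rightarrow> real) \<Rightarrow> ('s set \<Rightarrow> real) \<Rightarrow> ('s set \<Rightarrow> real measure) \<Rightarrow> bool" where
  "id_random_measure P R L \<gamma> v G \<longleftrightarrow> indep_scattered P R L \<and>
     (\<forall>A\<in>R. id_triplet (distr P borel (L A)) (\<gamma> A) (v A) (G A))"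

text \<open>The simple function \<open>\<Sum>\<^sub>j x\<^sub>j 1\<^bsub>A\<^sub>j\<^esub>\<close> is represented by the list of the pairs
  \<open>(x\<^sub>j, A\<^sub>j)\<close>.\<close>

type_synonym 's simple_rep = "(real \<times> 's set) list"

definition simple_rep :: "'s set set \<Rightarrow> 's simple_rep \<Rightarrow> bool" where
  "simple_rep R g \<longleftrightarrow> (\<forall>j<length g. snd (g ! j) \<in> R) \<and>
     disjoint_family_on (\<lambda>j. snd (g ! j)) {..<length g}"

definition simple_value :: "'s simple_rep \<Rightarrow> 's \<Rightarrow> real" where
  "simple_value g s = (\<Sum>j<length g. fst (g ! j) * indicator (snd (g ! j)) s)"

definition simple_integral_on ::
    "('s set \<Rightarrow> 'w \<Rightarrow> real) \<Rightarrow> 's set \<Rightarrow> 's simple_rep \<Rightarrow> 'w \<Rightarrow> real" where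
  "simple_integral_on L A g \<omega> = (\<Sum>j<length g. fst (g ! j) * L (A \<inter> snd (g ! j)) \<omega>)"

definition tendsto_in_prob :: "'w measure \<Rightarrow> (nat \<Rightarrow> 'w \<Rightarrow> real) \<Rightarrow> ('w \<Rightarrow> real) \<Rightarrow> bool" where
  "tendsto_in_prob P X Y \<longleftrightarrow> Y \<in> borel_measurable P \<and>
     (\<forall>\<epsilon>>0. (\<lambda>n. measure P {\<omega> \<in> space P. \<bar>X n \<omega> - Y \<omega>\<bar> > \<epsilon>}) \<longlonglongrightarrow> 0)"

definition approximating_sequence :: "'w measure \<Rightarrow> 's set \<Rightarrow> 's set set \<Rightarrow> 's measure \<Rightarrow>
    ('s set \<Rightarrow> 'w \<Rightarrow> real) \<Rightarrow> ('s \<Rightarrow> real) \<Rightarrow> (nat \<Rightarrow> 's simple_rep) \<Rightarrow> bool" where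
  "approximating_sequence P S R \<mu> L f g \<longleftrightarrow> (\<forall>n. simple_rep R (g n)) \<and>
     (AE s in \<mu>. (\<lambda>n. simple_value (g n) s) \<longlonglongrightarrow> f s) \<and>
     (\<forall>A\<in>sigma_sets S R. \<exists>Y. tendsto_in_prob P (\<lambda>n. simple_integral_on L A (g n)) Y)"

definition random_integrable :: "'w measure \<Rightarrow> 's set \<Rightarrow> 's set set \<Rightarrow> 's measure \<Rightarrow>
    ('s set \<Rightarrow> 'w \<Rightarrow> real) \<Rightarrow> ('s \<Rightarrow> real) \<Rightarrow> bool" where
  "random_integrable P S R \<mu> L f \<longleftrightarrow> f \<in> borel_measurable (sigma S R) \<and>
     (\<exists>g. approximating_sequence P S R \<mu> L f g)"

text \<open>\<open>Y\<close> is a version of \<open>\<integral>\<^sub>A f dL\<close>, which is determined only up to null sets.\<close>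

definition has_random_integral :: "'w measure \<Rightarrow> 's set \<Rightarrow> 's set set \<Rightarrow> 's measure \<Rightarrow>
    ('s set \<Rightarrow> 'w \<Rightarrow> real) \<Rightarrow> ('s \<Rightarrow> real) \<Rightarrow> 's set \<Rightarrow> ('w \<Rightarrow> real) \<Rightarrow> bool" where
  "has_random_integral P S R \<mu> L f A Y \<longleftrightarrow> f \<in> borel_measurable (sigma S R) \<and>
     (\<exists>g. approximating_sequence P S R \<mu> L f g \<and>
          tendsto_in_prob P (\<lambda>n. simple_integral_on L A (g n)) Y)"


definition U_fun :: "('s \<Rightarrow> real) \<Rightarrow> ('s \<Rightarrow> real set \<Rightarrow> real) \<Rightarrow> real \<Rightarrow> 's \<Rightarrow> real" where
  "U_fun a \<rho> u s = u * a s + ql_integral (\<rho> s) (\<lambda>x. \<tau> (x * u) - u * \<tau> x)"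

definition V0_fun :: "('s \<Rightarrow> real set \<Rightarrow> real) \<Rightarrow> real \<Rightarrow> 's \<Rightarrow> ennreal" where
  "V0_fun \<rho> u s = (\<integral>\<^sup>+x. ennreal (min 1 (\<bar>x * u\<bar>\<^sup>2)) \<partial>ql_abs (\<rho> s))"

definition Ftilde_pos :: "'s measure \<Rightarrow> ('s \<Rightarrow> real set \<Rightarrow> real) \<Rightarrow> ('s \<times> real) set \<Rightarrow> ennreal" where
  "Ftilde_pos \<mu> \<rho> C = (\<integral>\<^sup>+s. (\<integral>\<^sup>+x. indicator C (s, x) \<partial>ql_pos (\<rho> s)) \<partial>\<mu>)"

definition Ftilde_neg :: "'s measure \<Rightarrow> ('s \<Rightarrow> real set \<Rightarrow> real) \<Rightarrow> ('s \<times> real) set \<Rightarrow> ennreal" where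
  "Ftilde_neg \<mu> \<rho> C = (\<integral>\<^sup>+s. (\<integral>\<^sup>+x. indicator C (s, x) \<partial>ql_neg (\<rho> s)) \<partial>\<mu>)"

definition levy_kernel :: "'s set \<Rightarrow> 's set set \<Rightarrow> ('s \<Rightarrow> real measure) \<Rightarrow> bool" where
  "levy_kernel S R K \<longleftrightarrow> (\<forall>s\<in>S. levy_measure (K s)) \<and>
     (\<forall>B\<in>sets borel. (\<lambda>s. emeasure (K s) B) \<in> borel_measurable (sigma S R))"

end

theory Submission
  imports Defs
begin

text \<open>Write \<open>\<Lambda>\<close>'s exponent as the difference of the exponents of \<open>\<Lambda>\<^sub>G\<close> and \<open>\<Lambda>\<^sub>M\<close>. If \<open>f\<close> is integrable with
  respect to an infinitely divisible random measure, then the characteristic functions of the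
  approximating integrals stay away from 0 near the origin; averaging their real exponents and applying
  Fatou's lemma bounds the Gaussian part and the truncated second moment of \<open>f\<close>. Tightness then bounds
  the drifts of the approximations over every measurable set, and a gliding hump argument turns this
  setwise bound into integrability of the drift of \<open>f\<close>. The resulting bounds for \<open>\<Lambda>\<^sub>G\<close> and \<open>\<Lambda>\<^sub>M\<close> dominate
  the exponent of \<open>\<Lambda>\<close> along simple functions that are at most \<open>2 \<bar>f\<bar>\<close>, which makes their
  integrals Cauchy in probability. For an arbitrary approximating sequence no such domination is available;
  there the gliding hump identifies the limit of the characteristic functions from their convergence over
  all measurable sets.\<close>

section \<open>Levy measures\<close>

text \<open>The exponent of \<Lambda> is a difference in which large terms may cancel, so bounds on
  it do not bound the two terms. The bounds are therefore taken from \<Lambda>G and \<Lambda>M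
  separately and collected in \<open>majorant\<close>. Convergence in probability controls an
  exponent only through \<open>exp\<close>, that is, up to multiples of 2 pi i. The real part is
  recovered from the modulus; the imaginary part is recovered by following a continuous path from
  \<theta> = 0 or, in the gliding hump, circumvented by comparing values of \<open>exp\<close>
  without taking logarithms. Levy measures may be infinite near 0. Differences are therefore formed
  after weighting with \<open>min 1 (x\<^sup>2)\<close>, which makes the measures finite, and are
  stated as additive identities \<open>p + M = n + G\<close>, which never subtract infinities. The
  same identity allows integrals against \<rho> to be computed from \<rho>G and \<rho>M, although
  the theorem speaks of the Jordan parts of \<rho>.\<close>

definition lk :: "real \<Rightarrow> real \<Rightarrow> complex" where
  "lk u x = iexp (u * x) - 1 - \<i> * of_real u * of_real (\<tau> x)"

lemma borel_measurable_tau [measurable]: "\<tau> \<in> borel_measurable borel"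
  unfolding \<tau>_def by measurable

lemma tau_0 [simp]: "\<tau> 0 = 0"
  by (simp add: \<tau>_def)

lemma abs_tau_le_1: "\<bar>\<tau> x\<bar> \<le> 1"
  by (simp add: \<tau>_def)

lemma continuous_tau: "continuous_on UNIV \<tau>"
proof -
  have eq: "\<tau> x = max (-1) (min 1 x)" for x
    by (auto simp: \<tau>_def max_def min_def abs_if)
  show ?thesis
    unfolding eq[abs_def] by (intro continuous_on_max continuous_on_min continuous_on_const continuous_on_id)
qed

lemma borel_measurable_lk [measurable]: "(\<lambda>(u, x). lk u x) \<in> borel_measurable (borel \<Otimes>\<^sub>M borel)"
  unfolding lk_def by measurable

lemma lk_0 [simp]: "lk 0 x = 0" "lk u 0 = 0"
  by (simp_all add: lk_def)

lemma continuous_lk: "continuous_on UNIV (\<lambda>u. lk u x)"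
  unfolding lk_def by (auto intro!: continuous_intros)

lemma min_one_mult_le:
  fixes a b :: real
  assumes "0 \<le> a" "0 \<le> b"
  shows "min 1 (a * b) \<le> (1 + a) * min 1 b"
  using assms by (auto simp: min_def algebra_simps not_le)

lemma min_one_square: "\<bar>x\<bar> \<le> 1 \<Longrightarrow> min 1 (x\<^sup>2) = x\<^sup>2" "1 < \<bar>x\<bar> \<Longrightarrow> min 1 (x\<^sup>2) = (1::real)"
  using abs_square_le_1[of x] abs_square_less_1[of x] by (auto simp: min_def)

text \<open>For |x| \<le> 1 the compensator is the linear Taylor term of the exponential, which
  leaves a quadratic remainder; for larger x the trivial bound 2 + |u| applies. The constant covers
  both cases and is increasing in |u|, which suits dominated convergence along bounded sequences of
  u.\<close>

lemma norm_lk_le: "cmod (lk u x) \<le> (2 + \<bar>u\<bar> + u\<^sup>2) * min 1 (x\<^sup>2)"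
proof (cases "\<bar>x\<bar> \<le> 1")
  case True
  then have "lk u x = iexp (u * x) - (\<Sum>k\<le>1. (\<i> * (u * x))^k / fact k)"
    by (simp add: lk_def \<tau>_def)
  then have "cmod (lk u x) \<le> \<bar>u * x\<bar>^2 / 2"
    using iexp_approx1[of "u * x" 1] by (simp add: numeral_2_eq_2)
  also have "\<dots> = u\<^sup>2 * x\<^sup>2 / 2"
    by (simp add: power_mult_distrib)
  also have "\<dots> \<le> (2 + \<bar>u\<bar> + u\<^sup>2) * x\<^sup>2"
    using mult_nonneg_nonneg[of "u\<^sup>2" "x\<^sup>2"] mult_nonneg_nonneg[of "\<bar>u\<bar>" "x\<^sup>2"]
    by (simp add: algebra_simps)
  finally show ?thesis
    using True by (simp add: min_one_square)
next
  case False
  have "cmod (lk u x) \<le> cmod (iexp (u * x)) + cmod 1 + cmod (\<i> * of_real u * of_real (\<tau> x))"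
    unfolding lk_def by (metis norm_triangle_ineq4 norm_triangle_le_diff add_right_mono order_trans)
  also have "\<dots> \<le> 2 + \<bar>u\<bar>"
    using abs_tau_le_1[of x] by (simp add: norm_mult mult_left_le)
  also have "\<dots> \<le> (2 + \<bar>u\<bar> + u\<^sup>2)" by simp
  finally show ?thesis
    using False by (simp add: min_one_square)
qed

text \<open>The expression vanishes unless |x| > 1 or |x u| > 1. In either case
  \<open>(1 + u\<^sup>2) * min 1 (x\<^sup>2)\<close> is at least 1, so the crude bound 1 + |u| may
  be multiplied by it.\<close>

lemma tau_dilation_le: "\<bar>\<tau> (x * u) - u * \<tau> x\<bar> \<le> (1 + \<bar>u\<bar>) * (1 + u\<^sup>2) * min 1 (x\<^sup>2)"
proof -
  have 1: "\<bar>\<tau> (x * u) - u * \<tau> x\<bar> \<le> 1 + \<bar>u\<bar>"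
    using abs_tau_le_1[of x] abs_tau_le_1[of "x * u"] mult_left_le[of "\<bar>\<tau> x\<bar>" "\<bar>u\<bar>"]
    by (intro order_trans[OF abs_triangle_ineq4]) (auto simp: abs_mult)
  consider "\<bar>x\<bar> > 1" | "\<bar>x\<bar> \<le> 1" "\<bar>x * u\<bar> \<le> 1" | "\<bar>x\<bar> \<le> 1" "\<bar>x * u\<bar> > 1" by linarith
  then show ?thesis
  proof cases
    case 1
    then have "min 1 (x\<^sup>2) = 1" by (simp add: min_one_square)
    moreover have "1 + \<bar>u\<bar> \<le> (1 + \<bar>u\<bar>) * (1 + u\<^sup>2)" by (simp add: algebra_simps)
    ultimately show ?thesis using \<open>\<bar>\<tau> (x * u) - u * \<tau> x\<bar> \<le> 1 + \<bar>u\<bar>\<close> by simp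
  next
    case 2
    then show ?thesis by (simp add: \<tau>_def)
  next
    case 3
    then have "min 1 (x\<^sup>2) = x\<^sup>2" by (simp add: min_one_square)
    moreover have "1 \<le> (x * u)\<^sup>2" using 3 abs_square_le_1[of "x * u"] by linarith
    then have "1 \<le> (1 + u\<^sup>2) * x\<^sup>2" by (simp add: power_mult_distrib algebra_simps) (smt (verit) zero_le_power2)
    then have "1 + \<bar>u\<bar> \<le> (1 + \<bar>u\<bar>) * ((1 + u\<^sup>2) * x\<^sup>2)" by (intro mult_le_cancel_left1[THEN iffD2]) auto
    ultimately show ?thesis using 1 by (simp add: mult.assoc)
  qed
qed

text \<open>Scaling by u does not commute with the truncation \<tau>. The correction is linear in
  \<theta>, hence a pure drift; it is the integrand in the definition of U.\<close>

lemma lk_dilation: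
  "lk (\<theta> * u) x = lk \<theta> (x * u) + \<i> * of_real \<theta> * of_real (\<tau> (x * u) - u * \<tau> x)"
  by (simp add: lk_def algebra_simps)

section \<open>Integrability against Levy measures and finiteness away from 0\<close>

lemma levy_measureD:
  assumes "levy_measure M"
  shows sets_levy_measure: "sets M = sets borel" and space_levy_measure: "space M = UNIV"
    and levy_measure_null_0: "emeasure M {0} = 0"
    and levy_measure_msq: "(\<integral>\<^sup>+x. ennreal (min 1 (x\<^sup>2)) \<partial>M) < \<infinity>"
  using assms sets_eq_imp_space_eq[of M borel] by (auto simp: levy_measure_def)

lemma levy_measure_AE_nonzero: "levy_measure M \<Longrightarrow> AE x in M. x \<noteq> 0"
  by (rule AE_I'[of "{0}"]) (auto simp: levy_measure_def null_sets_def)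

lemma levy_measure_integrable:
  fixes g :: "real \<Rightarrow> 'b::{banach, second_countable_topology}"
  assumes M: "levy_measure M" and g[measurable]: "g \<in> borel_measurable borel"
    and le: "\<And>x. norm (g x) \<le> C * min 1 (x\<^sup>2)"
  shows "integrable M g"
proof -
  note [measurable_cong] = sets_levy_measure[OF M]
  have "integrable M (\<lambda>x. min 1 (x\<^sup>2))"
    using levy_measure_msq[OF M] by (subst integrable_iff_bounded) auto
  then have "integrable M (\<lambda>x. C * min 1 (x\<^sup>2))" by simp
  then show ?thesis
    by (rule Bochner_Integration.integrable_bound) (auto intro!: AE_I2 order_trans[OF le])
qed

text \<open>Markov's inequality for the weight \<open>min 1 (x\<^sup>2)\<close>, which is at least
  \<open>min 1 (r\<^sup>2)\<close> on B.\<close>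

lemma levy_measure_off_0:
  assumes M: "levy_measure M" and "0 < r" "B \<in> Borel_off r"
  shows "emeasure M B < \<infinity>"
proof -
  note [measurable_cong] = sets_levy_measure[OF M]
  have [measurable]: "B \<in> sets borel" and B: "\<And>x. x \<in> B \<Longrightarrow> r \<le> \<bar>x\<bar>"
    using assms by (auto simp: Borel_off_def disjoint_iff)
  have c: "0 < min 1 (r\<^sup>2)" using \<open>0 < r\<close> by simp
  have "emeasure M B = (\<integral>\<^sup>+x. indicator B x \<partial>M)" by simp
  also have "\<dots> \<le> (\<integral>\<^sup>+x. ennreal (1 / min 1 (r\<^sup>2)) * ennreal (min 1 (x\<^sup>2)) \<partial>M)"
  proof (rule nn_integral_mono)
    fix x
    show "indicator B x \<le> ennreal (1 / min 1 (r\<^sup>2)) * ennreal (min 1 (x\<^sup>2))"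
    proof (cases "x \<in> B")
      case True
      then have "r\<^sup>2 \<le> x\<^sup>2"
        using B[OF True] \<open>0 < r\<close> by (metis abs_le_square_iff abs_of_pos)
      then have "1 \<le> 1 / min 1 (r\<^sup>2) * min 1 (x\<^sup>2)"
        using c by (auto simp: field_simps min_def)
      then have "1 \<le> ennreal (1 / min 1 (r\<^sup>2) * min 1 (x\<^sup>2))"
        by (metis ennreal_1 ennreal_leI)
      then show ?thesis using c True by (simp add: ennreal_mult[symmetric])
    qed simp
  qed
  also have "\<dots> = ennreal (1 / min 1 (r\<^sup>2)) * (\<integral>\<^sup>+x. ennreal (min 1 (x\<^sup>2)) \<partial>M)"
    by (intro nn_integral_cmult) measurable
  also have "\<dots> < \<infinity>" using levy_measure_msq[OF M] by (simp add: ennreal_mult_less_top)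
  finally show ?thesis .
qed

lemma Borel0_eq: "Borel0 = (\<Union>r\<in>{0<..}. Borel_off r)"
proof safe
  fix B assume B: "B \<in> Borel0"
  then have "0 \<in> - closure B" "open (- closure B)" by (auto simp: Borel0_def)
  then obtain r where "r > 0" "ball 0 r \<subseteq> - closure B" using openE by metis
  then have "B \<inter> {-r<..<r} = {}" using closure_subset[of B] by (force simp: subset_eq dist_real_def)
  then show "B \<in> (\<Union>r\<in>{0<..}. Borel_off r)"
    using B \<open>r > 0\<close> by (auto simp: Borel_off_def Borel0_def intro!: bexI[of _ r])
next
  fix r :: real and B assume r: "0 < r" and B: "B \<in> Borel_off r"
  have "{-r<..<r} \<inter> closure B = {}"
    using B by (subst open_Int_closure_eq_empty) (auto simp: Borel_off_def)
  moreover have "0 \<in> {-r<..<r}" using r by simp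
  ultimately have "0 \<notin> closure B" by blast
  then show "B \<in> Borel0" using B by (simp add: Borel_off_def Borel0_def)
qed

lemma Borel_off_Borel0: "0 < r \<Longrightarrow> B \<in> Borel_off r \<Longrightarrow> B \<in> Borel0"
  by (auto simp: Borel0_eq)

lemma levy_measure_Borel0: "levy_measure M \<Longrightarrow> B \<in> Borel0 \<Longrightarrow> emeasure M B < \<infinity>"
  using levy_measure_off_0 by (auto simp: Borel0_eq)

text \<open>An increasing sequence of sets on which every Levy measure is finite. It assembles
  statements about \<open>Borel_off r\<close> for all radii into statements about measures on the
  line. Adding 1 keeps the radius meaningful for n = 0.\<close>

definition off_0 :: "nat \<Rightarrow> real set" where
  "off_0 n = {x. 1 / (real n + 1) \<le> \<bar>x\<bar>}"

lemma off_0_mono: "incseq off_0"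
  unfolding off_0_def
  by (rule incseq_SucI) (auto simp: frac_le intro: order_trans[rotated])

lemma off_0_borel [measurable]: "off_0 n \<in> sets borel"
  unfolding off_0_def by measurable

lemma UN_off_0: "(\<Union>n. off_0 n) = - {0}"
proof (intro set_eqI iffI)
  fix x :: real assume "x \<in> - {0}"
  then have "x \<noteq> 0" by simp
  then obtain n where "inverse (of_nat (Suc n)) < \<bar>x\<bar>" using reals_Archimedean[of "\<bar>x\<bar>"] by auto
  then show "x \<in> (\<Union>n. off_0 n)"
    by (auto simp: off_0_def inverse_eq_divide add.commute intro!: exI[of _ n])
qed (auto simp: off_0_def)

lemma off_0_Borel_off: "B \<in> sets borel \<Longrightarrow> B \<inter> off_0 n \<in> Borel_off (1 / (real n + 1))"
  by (auto simp: Borel_off_def off_0_def abs_le_iff)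

lemma levy_measure_off_0_finite: "levy_measure M \<Longrightarrow> B \<in> sets borel \<Longrightarrow> emeasure M (B \<inter> off_0 n) < \<infinity>"
  by (rule levy_measure_off_0[OF _ _ off_0_Borel_off]) auto

lemma emeasure_eq_SUP_off_0:
  assumes M[simp, measurable_cong]: "sets M = sets borel" and 0: "emeasure M {0} = 0" and B: "B \<in> sets borel"
  shows "emeasure M B = (SUP n. emeasure M (B \<inter> off_0 n))"
proof -
  have "emeasure M B = emeasure M (B - {0})"
    using 0 B by (intro emeasure_Diff_null_set[symmetric]) (auto simp: null_sets_def)
  also have "B - {0} = (\<Union>n. B \<inter> off_0 n)" using UN_off_0 by blast
  also have "emeasure M \<dots> = (SUP n. emeasure M (B \<inter> off_0 n))"
    using B off_0_mono by (intro SUP_emeasure_incseq[symmetric]) (auto simp: incseq_def)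
  finally show ?thesis .
qed

lemma levy_measure_sigma_finite:
  assumes M: "levy_measure M"
  shows "sigma_finite_measure M"
proof
  show "\<exists>A. countable A \<and> A \<subseteq> sets M \<and> \<Union> A = space M \<and> (\<forall>a\<in>A. emeasure M a \<noteq> \<infinity>)"
  proof (intro exI[of _ "insert {0} (range off_0)"] conjI ballI)
    show "\<Union> (insert {0} (range off_0)) = space M"
      using UN_off_0 by (auto simp: space_levy_measure[OF M])
    fix a assume "a \<in> insert {0} (range off_0)"
    then consider "a = {0}" | n where "a = off_0 n" by blast
    then show "emeasure M a \<noteq> \<infinity>"
    proof cases
      case (2 n)
      then show ?thesis using levy_measure_off_0_finite[OF M, of UNIV n] by auto
    qed (simp add: levy_measure_null_0[OF M])
  qed (auto simp: sets_levy_measure[OF M])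
qed

lemma levy_measure_mono:
  assumes M: "levy_measure M" and N: "sets N = sets borel" and le: "\<And>B. B \<in> sets borel \<Longrightarrow> emeasure N B \<le> emeasure M B"
  shows "levy_measure N"
proof -
  have "(\<integral>\<^sup>+x. ennreal (min 1 (x\<^sup>2)) \<partial>N) \<le> (\<integral>\<^sup>+x. ennreal (min 1 (x\<^sup>2)) \<partial>M)"
  proof (rule nn_integral_mono_measure)
    show "sets N = sets M" using N sets_levy_measure[OF M] by simp
    then show "N \<le> M"
      using le N by (subst le_measure) auto
  qed
  then show ?thesis
    using levy_measure_msq[OF M] le[of "{0}"] levy_measure_null_0[OF M] N
    by (auto simp: levy_measure_def)
qed

section \<open>Mixtures and kernels\<close>

text \<open>N is the average of the measures \<open>Ns s\<close> with respect to l. Measurability in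
  s is required set by set only, because the components may be infinite and so need not form a
  subprobability kernel.\<close>

locale mixture =
  fixes l :: "'s measure" and T N :: "'b measure" and Ns :: "'s \<Rightarrow> 'b measure"
  assumes sets_N: "sets N = sets T" and sets_Ns: "\<And>s. s \<in> space l \<Longrightarrow> sets (Ns s) = sets T"
    and measurable_Ns: "\<And>B. B \<in> sets T \<Longrightarrow> (\<lambda>s. emeasure (Ns s) B) \<in> borel_measurable l"
    and emeasure_N: "\<And>B. B \<in> sets T \<Longrightarrow> emeasure N B = (\<integral>\<^sup>+s. emeasure (Ns s) B \<partial>l)"
begin

lemma measurable_N: "h \<in> measurable T A \<Longrightarrow> h \<in> measurable N A"
  using measurable_cong_sets[OF sets_N refl] by blast

lemma measurable_component: "h \<in> measurable T A \<Longrightarrow> s \<in> space l \<Longrightarrow> h \<in> measurable (Ns s) A"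
  using measurable_cong_sets[OF sets_Ns refl] by blast

text \<open>Tonelli's theorem for a mixture, by induction on nonnegative measurable functions.
  Measurability in s is carried through the same induction because the identity for multiples, sums
  and suprema uses it.\<close>

lemma nn:
  assumes "h \<in> borel_measurable T"
  shows "(\<lambda>s. \<integral>\<^sup>+x. h x \<partial>Ns s) \<in> borel_measurable l \<and> (\<integral>\<^sup>+x. h x \<partial>N) = (\<integral>\<^sup>+s. (\<integral>\<^sup>+x. h x \<partial>Ns s) \<partial>l)"
  using assms
proof (induction rule: borel_measurable_induct)
  case (cong f g)
  have "space N = space T" "\<And>s. s \<in> space l \<Longrightarrow> space (Ns s) = space T"
    using sets_N sets_Ns sets_eq_imp_space_eq by blast+
  then have *: "\<And>s. s \<in> space l \<Longrightarrow> (\<integral>\<^sup>+x. f x \<partial>Ns s) = (\<integral>\<^sup>+x. g x \<partial>Ns s)" "(\<integral>\<^sup>+x. f x \<partial>N) = (\<integral>\<^sup>+x. g x \<partial>N)"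
    using cong(1,2,3) by (auto intro!: nn_integral_cong)
  have "(\<lambda>s. \<integral>\<^sup>+x. f x \<partial>Ns s) \<in> borel_measurable l \<longleftrightarrow> (\<lambda>s. \<integral>\<^sup>+x. g x \<partial>Ns s) \<in> borel_measurable l"
    by (rule measurable_cong) (rule *)
  moreover have "(\<integral>\<^sup>+s. (\<integral>\<^sup>+x. f x \<partial>Ns s) \<partial>l) = (\<integral>\<^sup>+s. (\<integral>\<^sup>+x. g x \<partial>Ns s) \<partial>l)"
    by (rule nn_integral_cong) (rule *)
  ultimately show ?case using cong.IH *(2) by metis
next
  case (set A)
  then show ?case
    using measurable_Ns[OF set] sets_Ns by (simp add: sets_N emeasure_N cong: measurable_cong nn_integral_cong)
next
  case (mult u c)
  have [measurable]: "u \<in> borel_measurable N" "\<And>s. s \<in> space l \<Longrightarrow> u \<in> borel_measurable (Ns s)"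
    using mult(2) by (auto intro: measurable_N measurable_component)
  have "(\<lambda>s. \<integral>\<^sup>+x. c * u x \<partial>Ns s) \<in> borel_measurable l \<longleftrightarrow> (\<lambda>s. c * (\<integral>\<^sup>+x. u x \<partial>Ns s)) \<in> borel_measurable l"
    by (intro measurable_cong) (simp add: nn_integral_cmult)
  moreover have "(\<integral>\<^sup>+s. (\<integral>\<^sup>+x. c * u x \<partial>Ns s) \<partial>l) = (\<integral>\<^sup>+s. c * (\<integral>\<^sup>+x. u x \<partial>Ns s) \<partial>l)"
    by (intro nn_integral_cong) (simp add: nn_integral_cmult)
  moreover have [measurable]: "(\<lambda>s. \<integral>\<^sup>+x. u x \<partial>Ns s) \<in> borel_measurable l" using mult by auto
  ultimately show ?case
    using mult.IH by (simp add: nn_integral_cmult)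
next
  case (add u v)
  have [measurable]: "u \<in> borel_measurable N" "\<And>s. s \<in> space l \<Longrightarrow> u \<in> borel_measurable (Ns s)"
     "v \<in> borel_measurable N" "\<And>s. s \<in> space l \<Longrightarrow> v \<in> borel_measurable (Ns s)"
    using add(1,3) by (auto intro: measurable_N measurable_component)
  have "(\<lambda>s. \<integral>\<^sup>+x. v x + u x \<partial>Ns s) \<in> borel_measurable l \<longleftrightarrow> (\<lambda>s. (\<integral>\<^sup>+x. v x \<partial>Ns s) + (\<integral>\<^sup>+x. u x \<partial>Ns s)) \<in> borel_measurable l"
    by (intro measurable_cong) (simp add: nn_integral_add)
  moreover have "(\<integral>\<^sup>+s. (\<integral>\<^sup>+x. v x + u x \<partial>Ns s) \<partial>l) = (\<integral>\<^sup>+s. (\<integral>\<^sup>+x. v x \<partial>Ns s) + (\<integral>\<^sup>+x. u x \<partial>Ns s) \<partial>l)"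
    by (intro nn_integral_cong) (simp add: nn_integral_add)
  moreover have [measurable]: "(\<lambda>s. \<integral>\<^sup>+x. u x \<partial>Ns s) \<in> borel_measurable l" "(\<lambda>s. \<integral>\<^sup>+x. v x \<partial>Ns s) \<in> borel_measurable l"
    using add by auto
  ultimately show ?case
    using add.IH by (simp add: nn_integral_add)
next
  case (seq U)
  have [measurable]: "\<And>i. U i \<in> borel_measurable N" "\<And>s i. s \<in> space l \<Longrightarrow> U i \<in> borel_measurable (Ns s)"
    using seq(1) by (auto intro: measurable_N measurable_component)
  have [measurable]: "\<And>i. (\<lambda>s. \<integral>\<^sup>+x. U i x \<partial>Ns s) \<in> borel_measurable l" using seq by auto
  have *: "(\<integral>\<^sup>+x. (SUP i. U i) x \<partial>Ns s) = (SUP i. \<integral>\<^sup>+x. U i x \<partial>Ns s)" if "s \<in> space l" for s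
    using that seq by (subst nn_integral_monotone_convergence_SUP[symmetric]) (auto simp: image_comp SUP_apply[abs_def])
  have "(\<lambda>s. \<integral>\<^sup>+x. (SUP i. U i) x \<partial>Ns s) \<in> borel_measurable l \<longleftrightarrow> (\<lambda>s. SUP i. \<integral>\<^sup>+x. U i x \<partial>Ns s) \<in> borel_measurable l"
    by (intro measurable_cong *)
  moreover have "(\<integral>\<^sup>+s. (\<integral>\<^sup>+x. (SUP i. U i) x \<partial>Ns s) \<partial>l) = (\<integral>\<^sup>+s. (SUP i. \<integral>\<^sup>+x. U i x \<partial>Ns s) \<partial>l)"
    by (intro nn_integral_cong *)
  moreover have "\<dots> = (SUP i. \<integral>\<^sup>+s. (\<integral>\<^sup>+x. U i x \<partial>Ns s) \<partial>l)"
    using seq by (intro nn_integral_monotone_convergence_SUP) (auto simp: incseq_def le_fun_def intro!: nn_integral_mono)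
  moreover have "(\<integral>\<^sup>+x. (SUP i. U i) x \<partial>N) = (SUP i. \<integral>\<^sup>+x. U i x \<partial>N)"
    using seq by (subst nn_integral_monotone_convergence_SUP[symmetric]) (auto simp: image_comp SUP_apply[abs_def])
  ultimately show ?case
    using seq by simp
qed

text \<open>Positive and negative part are reduced to the nonnegative case. Integrability under
  \<open>Ns s\<close> is assumed for every s, so both inner integrals are finite everywhere and can
  be subtracted pointwise.\<close>

lemma real:
  fixes g :: "'b \<Rightarrow> real"
  assumes g: "integrable N g" and gs: "\<And>s. s \<in> space l \<Longrightarrow> integrable (Ns s) g"
  shows "integrable l (\<lambda>s. \<integral>x. g x \<partial>Ns s)" "(\<integral>x. g x \<partial>N) = (\<integral>s. (\<integral>x. g x \<partial>Ns s) \<partial>l)"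
proof -
  have T: "g \<in> borel_measurable T" using g measurable_cong_sets[OF sets_N refl] by auto
  define p where "p s = (\<integral>\<^sup>+x. ennreal (g x) \<partial>Ns s)" for s
  define n where "n s = (\<integral>\<^sup>+x. ennreal (- g x) \<partial>Ns s)" for s
  have [measurable]: "p \<in> borel_measurable l" "n \<in> borel_measurable l"
    and P: "(\<integral>\<^sup>+x. ennreal (g x) \<partial>N) = (\<integral>\<^sup>+s. p s \<partial>l)"
    and Q: "(\<integral>\<^sup>+x. ennreal (- g x) \<partial>N) = (\<integral>\<^sup>+s. n s \<partial>l)"
    using nn[of "\<lambda>x. ennreal (g x)"] nn[of "\<lambda>x. ennreal (- g x)"] T unfolding p_def[abs_def] n_def[abs_def] by auto
  have fin: "p s < top" "n s < top" if "s \<in> space l" for s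
    using gs[OF that] unfolding p_def n_def by (auto simp: real_integrable_def top.not_eq_extremum)
  have fin': "(\<integral>\<^sup>+s. p s \<partial>l) < top" "(\<integral>\<^sup>+s. n s \<partial>l) < top"
    using g P Q by (auto simp: real_integrable_def top.not_eq_extremum)
  have e: "(\<integral>\<^sup>+s. ennreal (enn2real (p s)) \<partial>l) = (\<integral>\<^sup>+s. p s \<partial>l)" "(\<integral>\<^sup>+s. ennreal (enn2real (n s)) \<partial>l) = (\<integral>\<^sup>+s. n s \<partial>l)"
    using fin by (auto intro!: nn_integral_cong)
  have ip: "integrable l (\<lambda>s. enn2real (p s))" "integrable l (\<lambda>s. enn2real (n s))"
    using fin' e by (auto intro!: integrableI_nonneg)
  have *: "(\<integral>x. g x \<partial>Ns s) = enn2real (p s) - enn2real (n s)" if "s \<in> space l" for s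
    using real_lebesgue_integral_def[OF gs[OF that]] by (simp add: p_def n_def)
  show "integrable l (\<lambda>s. \<integral>x. g x \<partial>Ns s)"
    by (rule Bochner_Integration.integrable_cong[THEN iffD2, OF refl *]) (use ip in auto)
  have "(\<integral>s. (\<integral>x. g x \<partial>Ns s) \<partial>l) = (\<integral>s. enn2real (p s) - enn2real (n s) \<partial>l)"
    by (intro Bochner_Integration.integral_cong refl *)
  also have "\<dots> = (\<integral>s. enn2real (p s) \<partial>l) - (\<integral>s. enn2real (n s) \<partial>l)"
    using ip by simp
  also have "\<dots> = enn2real (\<integral>\<^sup>+s. p s \<partial>l) - enn2real (\<integral>\<^sup>+s. n s \<partial>l)"
    by (simp add: integral_eq_nn_integral e)
  also have "\<dots> = (\<integral>x. g x \<partial>N)"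
    using real_lebesgue_integral_def[OF g] by (simp add: P Q)
  finally show "(\<integral>x. g x \<partial>N) = (\<integral>s. (\<integral>x. g x \<partial>Ns s) \<partial>l)" by simp
qed

lemma complex:
  fixes g :: "'b \<Rightarrow> complex"
  assumes g: "integrable N g" and gs: "\<And>s. s \<in> space l \<Longrightarrow> integrable (Ns s) g"
  shows "integrable l (\<lambda>s. \<integral>x. g x \<partial>Ns s)" "(\<integral>x. g x \<partial>N) = (\<integral>s. (\<integral>x. g x \<partial>Ns s) \<partial>l)"
proof -
  have R: "integrable l (\<lambda>s. \<integral>x. Re (g x) \<partial>Ns s)" "(\<integral>x. Re (g x) \<partial>N) = (\<integral>s. (\<integral>x. Re (g x) \<partial>Ns s) \<partial>l)"
    using g gs by (intro real; simp)+
  have I: "integrable l (\<lambda>s. \<integral>x. Im (g x) \<partial>Ns s)" "(\<integral>x. Im (g x) \<partial>N) = (\<integral>s. (\<integral>x. Im (g x) \<partial>Ns s) \<partial>l)"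
    using g gs by (intro real; simp)+
  have i: "integrable l (\<lambda>s. Complex (\<integral>x. Re (g x) \<partial>Ns s) (\<integral>x. Im (g x) \<partial>Ns s))"
    unfolding Complex_eq using R I by auto
  have *: "(\<integral>x. g x \<partial>Ns s) = Complex (\<integral>x. Re (g x) \<partial>Ns s) (\<integral>x. Im (g x) \<partial>Ns s)" if "s \<in> space l" for s
    using gs[OF that] by (simp add: complex_eq_iff)
  show int: "integrable l (\<lambda>s. \<integral>x. g x \<partial>Ns s)"
    by (rule Bochner_Integration.integrable_cong[THEN iffD2, OF refl *]) (use i in auto)
  have "Re (\<integral>s. (\<integral>x. g x \<partial>Ns s) \<partial>l) = (\<integral>s. Re (\<integral>x. g x \<partial>Ns s) \<partial>l)"
       "Im (\<integral>s. (\<integral>x. g x \<partial>Ns s) \<partial>l) = (\<integral>s. Im (\<integral>x. g x \<partial>Ns s) \<partial>l)"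
    using int by (simp_all)
  moreover have "(\<integral>s. Re (\<integral>x. g x \<partial>Ns s) \<partial>l) = Re (\<integral>x. g x \<partial>N)"
       "(\<integral>s. Im (\<integral>x. g x \<partial>Ns s) \<partial>l) = Im (\<integral>x. g x \<partial>N)"
    using g gs R I by (simp_all cong: Bochner_Integration.integral_cong)
  ultimately show "(\<integral>x. g x \<partial>N) = (\<integral>s. (\<integral>x. g x \<partial>Ns s) \<partial>l)"
    by (simp add: complex_eq_iff)
qed

end

section \<open>Existence of mixtures, and sums of measures as mixtures\<close>

definition mix :: "'s measure \<Rightarrow> 'b measure \<Rightarrow> ('s \<Rightarrow> 'b measure) \<Rightarrow> 'b measure" where
  "mix l T Ns = measure_of (space T) (sets T) (\<lambda>B. \<integral>\<^sup>+s. emeasure (Ns s) B \<partial>l)"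

lemma sets_mix [simp]: "sets (mix l T Ns) = sets T"
  by (simp add: mix_def)

lemma mixture_mix:
  assumes s: "\<And>s. s \<in> space l \<Longrightarrow> sets (Ns s) = sets T"
    and m: "\<And>B. B \<in> sets T \<Longrightarrow> (\<lambda>s. emeasure (Ns s) B) \<in> borel_measurable l"
  shows "mixture l T (mix l T Ns) Ns"
proof
  fix B assume B: "B \<in> sets T"
  show "emeasure (mix l T Ns) B = (\<integral>\<^sup>+s. emeasure (Ns s) B \<partial>l)"
    unfolding mix_def
  proof (rule emeasure_measure_of_sigma[OF _ _ _ B])
    show "countably_additive (sets T) (\<lambda>B. \<integral>\<^sup>+s. emeasure (Ns s) B \<partial>l)"
    proof (rule countably_additiveI)
      fix A :: "nat \<Rightarrow> _" assume A: "range A \<subseteq> sets T" "disjoint_family A" "(\<Union>i. A i) \<in> sets T"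
      have "(\<Sum>i. \<integral>\<^sup>+s. emeasure (Ns s) (A i) \<partial>l) = (\<integral>\<^sup>+s. (\<Sum>i. emeasure (Ns s) (A i)) \<partial>l)"
        using A m by (intro nn_integral_suminf[symmetric]) auto
      also have "\<dots> = (\<integral>\<^sup>+s. emeasure (Ns s) (\<Union>i. A i) \<partial>l)"
        using A s by (intro nn_integral_cong suminf_emeasure) auto
      finally show "(\<Sum>i. \<integral>\<^sup>+s. emeasure (Ns s) (A i) \<partial>l) = (\<integral>\<^sup>+s. emeasure (Ns s) (\<Union>i. A i) \<partial>l)" .
    qed
  qed (auto simp: positive_def sets.sigma_algebra_axioms)
qed (auto simp: mix_def s m)

text \<open>Adding two measures is mixing over a two-point index set with counting measure.
  Additivity of the integral in the measure thus becomes an instance of the mixture formula.\<close>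

lemma mixture_bool:
  assumes "sets A = sets T" "sets B = sets T" "sets C = sets T"
    and "\<And>X. X \<in> sets T \<Longrightarrow> emeasure A X + emeasure B X = emeasure C X"
  shows "mixture (count_space UNIV) T C (\<lambda>b. if b then A else B)"
  using assms by unfold_locales (auto simp: nn_integral_count_space_finite UNIV_bool add.commute)

lemma nn_integral_add_measure:
  assumes "sets A = sets T" "sets B = sets T" "sets C = sets T"
    and "\<And>X. X \<in> sets T \<Longrightarrow> emeasure A X + emeasure B X = emeasure C X"
    and h: "h \<in> borel_measurable T"
  shows "(\<integral>\<^sup>+x. h x \<partial>A) + (\<integral>\<^sup>+x. h x \<partial>B) = (\<integral>\<^sup>+x. h x \<partial>C)"
  using mixture.nn[OF mixture_bool[OF assms(1-4)] h]
  by (auto simp: nn_integral_count_space_finite UNIV_bool add.commute)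

lemma integral_add_measure:
  fixes g :: "'b \<Rightarrow> complex"
  assumes "sets A = sets T" "sets B = sets T" "sets C = sets T"
    and "\<And>X. X \<in> sets T \<Longrightarrow> emeasure A X + emeasure B X = emeasure C X"
    and g: "integrable A g" "integrable B g" "integrable C g"
  shows "(\<integral>x. g x \<partial>A) + (\<integral>x. g x \<partial>B) = (\<integral>x. g x \<partial>C)"
  using mixture.complex[OF mixture_bool[OF assms(1-4)] g(3)] g
  by (auto simp: lebesgue_integral_count_space_finite UNIV_bool add.commute)

lemma ex_add_measure:
  assumes "sets A = sets T" "sets B = sets T"
  shows "\<exists>C. sets C = sets T \<and> (\<forall>X\<in>sets T. emeasure C X = emeasure A X + emeasure B X)"
proof -
  define C where "C = mix (count_space UNIV) T (\<lambda>b. if b then A else B)"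
  interpret mixture "count_space UNIV" T C "\<lambda>b. if b then A else B"
    unfolding C_def using assms by (intro mixture_mix) auto
  show ?thesis
    by (intro exI[of _ C] conjI ballI sets_N)
       (simp add: emeasure_N nn_integral_count_space_finite UNIV_bool add.commute)
qed

section \<open>Measurability of integrals against a kernel of Levy measures\<close>

locale levy_kernel_on = sigma_finite_measure l for l :: "'s measure" +
  fixes K :: "'s \<Rightarrow> real measure"
  assumes levy: "\<And>s. s \<in> space l \<Longrightarrow> levy_measure (K s)"
    and measurable_kernel: "\<And>B. B \<in> sets borel \<Longrightarrow> (\<lambda>s. emeasure (K s) B) \<in> borel_measurable l"
begin

lemma sets_kernel [simp]: "s \<in> space l \<Longrightarrow> sets (K s) = sets borel"
  by (rule sets_levy_measure[OF levy])

lemma measurable_kernelI: "s \<in> space l \<Longrightarrow> h \<in> measurable borel N \<Longrightarrow> h \<in> measurable (K s) N"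
  using measurable_cong_sets[OF sets_kernel refl] by blast

lemma nn_fixed:
  assumes "h \<in> borel_measurable borel"
  shows "(\<lambda>s. \<integral>\<^sup>+x. h x \<partial>K s) \<in> borel_measurable l"
  using mixture.nn[OF mixture_mix assms, OF _ measurable_kernel] by (simp)

text \<open>A Levy kernel can have infinite mass. It is given a density that turns it into a
  subprobability kernel, for which joint measurability is available, and the reciprocal density is
  absorbed into the integrand.\<close>

lemma nn_joint:
  assumes H: "(\<lambda>(s, x). H s x) \<in> borel_measurable (l \<Otimes>\<^sub>M borel)"
  shows "(\<lambda>s. \<integral>\<^sup>+x. H s x \<partial>K s) \<in> borel_measurable l"
proof -
  define m where "m s = enn2real (\<integral>\<^sup>+x. ennreal (min 1 (x\<^sup>2)) \<partial>K s)" for s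
  have [measurable]: "m \<in> borel_measurable l"
    unfolding m_def[abs_def] by (intro borel_measurable_enn2real nn_fixed) measurable
  have m: "ennreal (m s) = (\<integral>\<^sup>+x. ennreal (min 1 (x\<^sup>2)) \<partial>K s)" if "s \<in> space l" for s
    using levy_measure_msq[OF levy[OF that]] by (simp add: m_def)
  have m0: "0 \<le> m s" for s by (simp add: m_def)
  \<comment> \<open>The total mass becomes \<open>m s / (1 + m s)\<close>, which is at most 1 and
    needs no separate treatment of \<open>m s = 0\<close>. The density vanishes only at 0, a null
    set of \<open>K s\<close>.\<close>
  define N where "N s = density (K s) (\<lambda>x. ennreal (min 1 (x\<^sup>2)) * ennreal (1 / (1 + m s)))" for s
  have emN: "emeasure (N s) B = ennreal (1 / (1 + m s)) * (\<integral>\<^sup>+x. ennreal (min 1 (x\<^sup>2)) * indicator B x \<partial>K s)"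
    if s: "s \<in> space l" and B: "B \<in> sets borel" for s B
  proof -
    have [measurable]: "B \<in> sets (K s)" "(\<lambda>x. ennreal (min 1 (x\<^sup>2))) \<in> borel_measurable (K s)"
      using s B by (auto intro!: measurable_kernelI)
    show ?thesis
      unfolding N_def
      by (subst emeasure_density, simp_all, subst nn_integral_cmult[symmetric], simp_all)
         (auto intro!: nn_integral_cong simp: mult_ac)
  qed
  have N: "N \<in> measurable l (subprob_algebra borel)"
  proof (rule measurable_subprob_algebra)
    fix s assume s: "s \<in> space l"
    show "subprob_space (N s)"
    proof (rule subprob_spaceI)
      have "emeasure (N s) (space (N s)) = ennreal (1 / (1 + m s)) * ennreal (m s)"
        using s emN[OF s, of UNIV] by (simp add: N_def m space_levy_measure[OF levy])
      also have "\<dots> = ennreal (m s / (1 + m s))" using m0 by (simp add: ennreal_mult[symmetric])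
      also have "\<dots> \<le> 1" using m0[of s] by (simp add: ennreal_le_1)
      finally show "emeasure (N s) (space (N s)) \<le> 1" .
      show "space (N s) \<noteq> {}" using s by (simp add: N_def space_levy_measure[OF levy])
    qed
    show "sets (N s) = sets borel" using s by (simp add: N_def)
  next
    fix A :: "real set" assume [measurable]: "A \<in> sets borel"
    have [measurable]: "(\<lambda>s. \<integral>\<^sup>+x. ennreal (min 1 (x\<^sup>2)) * indicator A x \<partial>K s) \<in> borel_measurable l"
      by (intro nn_fixed) measurable
    have "(\<lambda>s. ennreal (1 / (1 + m s)) * (\<integral>\<^sup>+x. ennreal (min 1 (x\<^sup>2)) * indicator A x \<partial>K s)) \<in> borel_measurable l"
      by measurable
    then show "(\<lambda>s. emeasure (N s) A) \<in> borel_measurable l"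
      by (rule measurable_cong[THEN iffD1, rotated]) (simp add: emN)
  qed
  have [measurable]: "(\<lambda>(s, x). H s x * ennreal ((1 + m s) / min 1 (x\<^sup>2))) \<in> borel_measurable (l \<Otimes>\<^sub>M borel)"
    using H by (simp add: split_beta)
  have "(\<lambda>s. \<integral>\<^sup>+x. H s x * ennreal ((1 + m s) / min 1 (x\<^sup>2)) \<partial>N s) \<in> borel_measurable l"
    by (rule nn_integral_measurable_subprob_algebra2[OF _ N]) measurable
  moreover have "(\<integral>\<^sup>+x. H s x * ennreal ((1 + m s) / min 1 (x\<^sup>2)) \<partial>N s) = (\<integral>\<^sup>+x. H s x \<partial>K s)" if s: "s \<in> space l" for s
  proof -
    have [measurable]: "H s \<in> borel_measurable borel" using measurable_Pair2[OF H s] by simp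
    then have [measurable]: "H s \<in> borel_measurable (K s)" "(\<lambda>x. ennreal ((1 + m s) / min 1 (x\<^sup>2))) \<in> borel_measurable (K s)"
      "(\<lambda>x. ennreal (min 1 (x\<^sup>2))) \<in> borel_measurable (K s)"
      using s by (auto intro!: measurable_kernelI)
    have "(\<integral>\<^sup>+x. H s x * ennreal ((1 + m s) / min 1 (x\<^sup>2)) \<partial>N s)
       = (\<integral>\<^sup>+x. (ennreal (min 1 (x\<^sup>2)) * ennreal (1 / (1 + m s))) * (H s x * ennreal ((1 + m s) / min 1 (x\<^sup>2))) \<partial>K s)"
      unfolding N_def by (rule nn_integral_density) measurable
    also have "\<dots> = (\<integral>\<^sup>+x. H s x \<partial>K s)"
    proof (rule nn_integral_cong_AE, use levy_measure_AE_nonzero[OF levy[OF s]] in eventually_elim)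
      fix x :: real assume "x \<noteq> 0"
      then have "min 1 (x\<^sup>2) * (1 / (1 + m s)) * ((1 + m s) / min 1 (x\<^sup>2)) = 1" "0 \<le> (1 + m s) / min 1 (x\<^sup>2)" "0 \<le> min 1 (x\<^sup>2)"
        using m0[of s] by (auto simp: min_def)
      then have "ennreal (min 1 (x\<^sup>2)) * ennreal (1 / (1 + m s)) * ennreal ((1 + m s) / min 1 (x\<^sup>2)) = 1"
        using m0[of s] by (simp flip: ennreal_mult)
      then show "ennreal (min 1 (x\<^sup>2)) * ennreal (1 / (1 + m s)) * (H s x * ennreal ((1 + m s) / min 1 (x\<^sup>2))) = H s x"
        by (metis mult.assoc mult.commute mult_1)
    qed
    finally show ?thesis .
  qed
  ultimately show ?thesis
    by (rule measurable_cong[THEN iffD1, rotated])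
qed

lemma real_joint:
  fixes H :: "'s \<Rightarrow> real \<Rightarrow> real"
  assumes [measurable]: "(\<lambda>(s, x). H s x) \<in> borel_measurable (l \<Otimes>\<^sub>M borel)"
    and i: "\<And>s. s \<in> space l \<Longrightarrow> integrable (K s) (H s)"
  shows "(\<lambda>s. \<integral>x. H s x \<partial>K s) \<in> borel_measurable l"
proof -
  have [measurable]: "(\<lambda>s. \<integral>\<^sup>+x. ennreal (H s x) \<partial>K s) \<in> borel_measurable l"
     "(\<lambda>s. \<integral>\<^sup>+x. ennreal (- H s x) \<partial>K s) \<in> borel_measurable l"
    by (rule nn_joint; measurable)+
  have "(\<lambda>s. enn2real (\<integral>\<^sup>+x. ennreal (H s x) \<partial>K s) - enn2real (\<integral>\<^sup>+x. ennreal (- H s x) \<partial>K s)) \<in> borel_measurable l"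
    by measurable
  then show ?thesis
    by (rule measurable_cong[THEN iffD1, rotated]) (simp add: real_lebesgue_integral_def[OF i])
qed

lemma complex_joint:
  fixes H :: "'s \<Rightarrow> real \<Rightarrow> complex"
  assumes [measurable]: "(\<lambda>(s, x). H s x) \<in> borel_measurable (l \<Otimes>\<^sub>M borel)"
    and i: "\<And>s. s \<in> space l \<Longrightarrow> integrable (K s) (H s)"
  shows "(\<lambda>s. \<integral>x. H s x \<partial>K s) \<in> borel_measurable l"
proof -
  have [measurable]: "(\<lambda>s. \<integral>x. Re (H s x) \<partial>K s) \<in> borel_measurable l" "(\<lambda>s. \<integral>x. Im (H s x) \<partial>K s) \<in> borel_measurable l"
    using i by (auto intro!: real_joint)
  have "(\<lambda>s. complex_of_real (\<integral>x. Re (H s x) \<partial>K s) + \<i> * complex_of_real (\<integral>x. Im (H s x) \<partial>K s)) \<in> borel_measurable l"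
    by measurable
  then show ?thesis
    by (rule measurable_cong[THEN iffD1, rotated]) (simp add: i complex_eq_iff)
qed

end

section \<open>The Jordan decomposition of a difference of Levy measures\<close>

text \<open>A representation of \<nu> by two Levy measures that need not be mutually singular. It is
  restricted to \<open>Borel0\<close> because on sets near 0 both masses may be infinite, where
  \<open>measure\<close> returns the default value 0.\<close>

definition levy_diff :: "(real set \<Rightarrow> real) \<Rightarrow> real measure \<Rightarrow> real measure \<Rightarrow> bool" where
  "levy_diff \<nu> G M \<longleftrightarrow> levy_measure G \<and> levy_measure M \<and> (\<forall>B\<in>Borel0. \<nu> B = measure G B - measure M B)"

text \<open>Supplies the uniqueness behind the definite descriptions of \<open>ql_pos\<close>,
  \<open>ql_neg\<close> and \<open>ql_abs\<close>: values away from 0 determine a measure without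
  mass at 0 by exhaustion.\<close>

lemma extends_off_0_unique:
  assumes M: "extends_off_0 m M" and N: "extends_off_0 m N"
  shows "M = N"
proof (rule measure_eqI)
  show "sets M = sets N" using M N by (simp add: extends_off_0_def)
  fix B assume "B \<in> sets M"
  then have B: "B \<in> sets borel" using M by (simp add: extends_off_0_def)
  have "emeasure M (B \<inter> off_0 n) = emeasure N (B \<inter> off_0 n)" for n
    using off_0_Borel_off[OF B, of n] M N unfolding extends_off_0_def
    by (metis add_strict_increasing2 of_nat_0_le_iff zero_less_divide_1_iff zero_less_one)
  then show "emeasure M B = emeasure N B"
    using M N by (simp add: extends_off_0_def emeasure_eq_SUP_off_0[OF _ _ B])
qed

text \<open>After weighting with \<open>min 1 (x\<^sup>2)\<close> both measures are finite and have
  a Hahn decomposition. The weight is positive off 0, so the same set works for the original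
  measures.\<close>

lemma levy_hahn:
  assumes G: "levy_measure G" and M: "levy_measure M"
  shows "\<exists>Y\<in>sets borel. (\<forall>X\<in>sets borel. X \<subseteq> Y \<longrightarrow> emeasure M X \<le> emeasure G X) \<and>
           (\<forall>X\<in>sets borel. X \<inter> Y = {} \<longrightarrow> emeasure G X \<le> emeasure M X)"
proof -
  note [measurable_cong, simp] = sets_levy_measure[OF G] sets_levy_measure[OF M]
  define G' where "G' = density G (\<lambda>x. ennreal (min 1 (x\<^sup>2)))"
  define M' where "M' = density M (\<lambda>x. ennreal (min 1 (x\<^sup>2)))"
  have "finite_measure G'" "finite_measure M'"
    unfolding G'_def M'_def using levy_measure_msq[OF G] levy_measure_msq[OF M]
    by (intro finite_measureI; subst emeasure_density; auto simp: space_levy_measure[OF G] space_levy_measure[OF M])+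
  then obtain Y where Y: "Y \<in> sets G'" "\<And>X. X \<in> sets G' \<Longrightarrow> X \<subseteq> Y \<Longrightarrow> emeasure M' X \<le> emeasure G' X"
     "\<And>X. X \<in> sets G' \<Longrightarrow> X \<inter> Y = {} \<Longrightarrow> emeasure G' X \<le> emeasure M' X"
    using finite_unsigned_Hahn_decomposition[of G' M'] by (auto simp: G'_def M'_def)
  \<comment> \<open>Undoes the weight: the two densities cancel off 0, and 0 carries no
    mass.\<close>
  have rec: "emeasure N X = (\<integral>\<^sup>+x. ennreal (1 / min 1 (x\<^sup>2)) \<partial>density (density N (\<lambda>x. ennreal (min 1 (x\<^sup>2)))) (indicator X))"
    if N: "levy_measure N" and [measurable]: "X \<in> sets borel" for N X
  proof -
    note [measurable_cong, simp] = sets_levy_measure[OF N]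
    have "(\<integral>\<^sup>+x. ennreal (1 / min 1 (x\<^sup>2)) \<partial>density (density N (\<lambda>x. ennreal (min 1 (x\<^sup>2)))) (indicator X))
       = (\<integral>\<^sup>+x. ennreal (min 1 (x\<^sup>2)) * (indicator X x * ennreal (1 / min 1 (x\<^sup>2))) \<partial>N)"
      by (simp add: nn_integral_density)
    also have "\<dots> = (\<integral>\<^sup>+x. indicator X x \<partial>N)"
    proof (rule nn_integral_cong_AE, use levy_measure_AE_nonzero[OF N] in eventually_elim)
      fix x :: real assume "x \<noteq> 0"
      then have "ennreal (min 1 (x\<^sup>2)) * ennreal (1 / min 1 (x\<^sup>2)) = 1"
        by (simp flip: ennreal_mult) (auto simp: min_def)
      then show "ennreal (min 1 (x\<^sup>2)) * (indicator X x * ennreal (1 / min 1 (x\<^sup>2))) = indicator X x"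
        by (simp split: split_indicator)
    qed
    finally show ?thesis by simp
  qed
  \<comment> \<open>An inequality on all measurable subsets of X is an inequality of the measures
    restricted to X, so it survives integration of the inverse weight.\<close>
  have mono: "emeasure N X \<le> emeasure N' X"
    if N: "levy_measure N" and N': "levy_measure N'" and X[measurable]: "X \<in> sets borel"
      and le: "\<And>Z. Z \<in> sets borel \<Longrightarrow> Z \<subseteq> X \<Longrightarrow>
        emeasure (density N (\<lambda>x. ennreal (min 1 (x\<^sup>2)))) Z \<le> emeasure (density N' (\<lambda>x. ennreal (min 1 (x\<^sup>2)))) Z" for N N' X
  proof -
    note [measurable_cong, simp] = sets_levy_measure[OF N] sets_levy_measure[OF N']
    have "density (density N (\<lambda>x. ennreal (min 1 (x\<^sup>2)))) (indicator X) \<le> density (density N' (\<lambda>x. ennreal (min 1 (x\<^sup>2)))) (indicator X)"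
    proof (subst le_measure, simp, rule ballI)
      fix A assume "A \<in> sets (density (density N (\<lambda>x. ennreal (min 1 (x\<^sup>2)))) (indicator X))"
      then have [measurable]: "A \<in> sets borel" by simp
      then show "emeasure (density (density N (\<lambda>x. ennreal (min 1 (x\<^sup>2)))) (indicator X)) A
        \<le> emeasure (density (density N' (\<lambda>x. ennreal (min 1 (x\<^sup>2)))) (indicator X)) A"
        using le[of "X \<inter> A"] by (simp add: emeasure_density[of "indicator X"] indicator_inter_arith[symmetric])
    qed
    then show ?thesis
      unfolding rec[OF N X] rec[OF N' X] by (intro nn_integral_mono_measure) simp
  qed
  show ?thesis
  proof (intro bexI[of _ Y] conjI ballI impI)
    show "Y \<in> sets borel" using Y(1) by (simp add: G'_def)
    show "emeasure M X \<le> emeasure G X" if "X \<in> sets borel" "X \<subseteq> Y" for X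
      using that Y(2) by (intro mono[OF M G]) (auto simp: G'_def M'_def)
    show "emeasure G X \<le> emeasure M X" if "X \<in> sets borel" "X \<inter> Y = {}" for X
      using that Y(3) by (intro mono[OF G M]) (auto simp: G'_def M'_def)
  qed
qed

text \<open>The difference of G and M on Y is formed for the finite weighted measures and then
  unweighted. The conclusion is a sum because both masses on the right can be infinite.\<close>

lemma ex_levy_difference_on:
  assumes G: "levy_measure G" and M: "levy_measure M" and Y[measurable]: "Y \<in> sets borel"
    and le: "\<And>X. X \<in> sets borel \<Longrightarrow> X \<subseteq> Y \<Longrightarrow> emeasure M X \<le> emeasure G X"
  shows "\<exists>p. levy_measure p \<and> (\<forall>X\<in>sets borel. emeasure p X + emeasure M (X \<inter> Y) = emeasure G (X \<inter> Y))"
proof -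
  note [measurable_cong, simp] = sets_levy_measure[OF G] sets_levy_measure[OF M]
  define w where "w x = ennreal (min 1 (x\<^sup>2))" for x :: real
  have [measurable]: "w \<in> borel_measurable borel" unfolding w_def by measurable
  define G' where "G' = density (density G (indicator Y)) w"
  define M' where "M' = density (density M (indicator Y)) w"
  have le': "density M (indicator Y) \<le> density G (indicator Y)"
    using le[of "Y \<inter> _"] by (subst le_measure) (auto simp: emeasure_density indicator_inter_arith[symmetric])
  have fin: "finite_measure G'" "finite_measure M'"
  proof -
    have "(\<integral>\<^sup>+x. indicator Y x * w x \<partial>N) < \<infinity>" if "levy_measure N" for N
      using levy_measure_msq[OF that]
      by (rule le_less_trans[rotated]) (auto intro!: nn_integral_mono simp: w_def split: split_indicator)
    from this[OF G] this[OF M] show "finite_measure G'" "finite_measure M'"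
      unfolding G'_def M'_def
      by (auto intro!: finite_measureI simp: emeasure_density nn_integral_density space_levy_measure[OF G] space_levy_measure[OF M])
  qed
  have le'': "emeasure M' A \<le> emeasure G' A" if [measurable]: "A \<in> sets borel" for A
    unfolding M'_def G'_def
    by (simp add: emeasure_density) (rule nn_integral_mono_measure[OF _ le'], simp)
  define D where "D = diff_measure G' M'"
  have sD[simp, measurable_cong]: "sets D = sets borel" "sets G' = sets borel" "sets M' = sets borel" by (auto simp: D_def G'_def M'_def)
  have D: "emeasure D X + emeasure M' X = emeasure G' X" if "X \<in> sets borel" for X
  proof -
    have "emeasure D X = emeasure G' X - emeasure M' X"
      unfolding D_def using that fin le'' by (intro emeasure_diff_measure) auto
    then show ?thesis
      using le''[OF that] finite_measure.emeasure_finite[OF fin(2)] by (simp add: diff_add_cancel_ennreal)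
  qed
  define p where "p = density D (\<lambda>x. ennreal (1 / min 1 (x\<^sup>2)))"
  have [simp]: "sets p = sets borel" by (simp add: p_def)
  have p: "emeasure p X + emeasure M (X \<inter> Y) = emeasure G (X \<inter> Y)" if X[measurable]: "X \<in> sets borel" for X
  proof -
    define h where "h x = ennreal (1 / min 1 (x\<^sup>2)) * indicator X x" for x :: real
    have [measurable]: "h \<in> borel_measurable borel" unfolding h_def by measurable
    have *: "(\<integral>\<^sup>+x. h x \<partial>density (density N (indicator Y)) w) = emeasure N (X \<inter> Y)" if N: "levy_measure N" for N
    proof -
      note [measurable_cong, simp] = sets_levy_measure[OF N]
      have "(\<integral>\<^sup>+x. h x \<partial>density (density N (indicator Y)) w) = (\<integral>\<^sup>+x. indicator Y x * (w x * h x) \<partial>N)"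
        by (simp add: nn_integral_density)
      also have "\<dots> = (\<integral>\<^sup>+x. indicator (X \<inter> Y) x \<partial>N)"
      proof (rule nn_integral_cong_AE, use levy_measure_AE_nonzero[OF N] in eventually_elim)
        fix x :: real assume "x \<noteq> 0"
        then have "w x * ennreal (1 / min 1 (x\<^sup>2)) = 1"
          by (simp add: w_def flip: ennreal_mult) (auto simp: min_def)
        then show "indicator Y x * (w x * h x) = indicator (X \<inter> Y) x"
          by (simp add: h_def mult.assoc split: split_indicator)
      qed
      finally show ?thesis by simp
    qed
    have "emeasure p X = (\<integral>\<^sup>+x. h x \<partial>D)" by (simp add: p_def emeasure_density h_def)
    moreover have "(\<integral>\<^sup>+x. h x \<partial>D) + (\<integral>\<^sup>+x. h x \<partial>M') = (\<integral>\<^sup>+x. h x \<partial>G')"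
      by (rule nn_integral_add_measure[where T=borel]) (auto simp: D)
    ultimately show ?thesis using *[OF G] *[OF M] by (simp add: G'_def M'_def)
  qed
  have "levy_measure p"
  proof (rule levy_measure_mono[OF G])
    fix B :: "real set" assume B: "B \<in> sets borel"
    have "emeasure p B \<le> emeasure G (B \<inter> Y)" using p[OF B] by (metis le_iff_add)
    also have "\<dots> \<le> emeasure G B" using B by (intro emeasure_mono) auto
    finally show "emeasure p B \<le> emeasure G B" .
  qed simp
  with p show ?thesis by blast
qed

text \<open>The parts are the differences on the Hahn set and on its complement. The additive
  identity holds for every Borel set, including those near 0 where all four masses may be
  infinite.\<close>

lemma levy_jordan:
  assumes G: "levy_measure G" and M: "levy_measure M"
  obtains p n Y where "levy_measure p" "levy_measure n" "Y \<in> sets borel" "emeasure p (- Y) = 0" "emeasure n Y = 0"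
    "\<And>X. X \<in> sets borel \<Longrightarrow> emeasure p X + emeasure M X = emeasure n X + emeasure G X"
    "\<And>X. X \<in> sets borel \<Longrightarrow> emeasure p X \<le> emeasure G X"
    "\<And>X. X \<in> sets borel \<Longrightarrow> emeasure n X \<le> emeasure M X"
proof -
  note [simp] = sets_levy_measure[OF G] sets_levy_measure[OF M]
  obtain Y where Y: "Y \<in> sets borel" "\<And>X. X \<in> sets borel \<Longrightarrow> X \<subseteq> Y \<Longrightarrow> emeasure M X \<le> emeasure G X"
     "\<And>X. X \<in> sets borel \<Longrightarrow> X \<inter> Y = {} \<Longrightarrow> emeasure G X \<le> emeasure M X"
    using levy_hahn[OF G M] by blast
  obtain p where p: "levy_measure p" "\<And>X. X \<in> sets borel \<Longrightarrow> emeasure p X + emeasure M (X \<inter> Y) = emeasure G (X \<inter> Y)"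
    using ex_levy_difference_on[OF G M Y(1,2)] by blast
  obtain n where n: "levy_measure n" "\<And>X. X \<in> sets borel \<Longrightarrow> emeasure n X + emeasure G (X \<inter> - Y) = emeasure M (X \<inter> - Y)"
    using ex_levy_difference_on[OF M G, of "- Y"] Y(1,3) by (auto simp: disjoint_eq_subset_Compl)
  have split: "emeasure N X = emeasure N (X \<inter> Y) + emeasure N (X \<inter> - Y)" if "X \<in> sets borel" "sets N = sets borel" for N X
    using that Y(1) by (subst plus_emeasure) (auto intro!: arg_cong[where f="emeasure N"])
  show ?thesis
  proof (rule that[OF p(1) n(1) Y(1)])
    show "emeasure p (- Y) = 0" using p(2)[of "- Y"] Y(1) by auto
    show "emeasure n Y = 0" using n(2)[of "Y"] Y(1) by auto
    fix X :: "real set" assume X: "X \<in> sets borel"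
    show "emeasure p X + emeasure M X = emeasure n X + emeasure G X"
      using p(2)[OF X] n(2)[OF X] split[OF X, of M] split[OF X, of G] by (simp add: add_ac) (metis add.assoc add.commute)
    show "emeasure p X \<le> emeasure G X"
      using p(2)[OF X] split[OF X, of G] by (metis \<open>sets G = sets borel\<close> le_iff_add add.assoc)
    show "emeasure n X \<le> emeasure M X"
      using n(2)[OF X] split[OF X, of M] by (metis \<open>sets M = sets borel\<close> le_iff_add add.assoc add.commute)
  qed
qed

lemma Borel_off_subset: "X \<in> Borel_off r \<Longrightarrow> C \<in> sets borel \<Longrightarrow> C \<subseteq> X \<Longrightarrow> C \<in> Borel_off r"
  by (auto simp: Borel_off_def)

text \<open>Away from 0 everything is finite, and the suprema defining the variations are attained:
  by \<open>X \<inter> Y\<close> for the positive part, by \<open>X \<inter> - Y\<close> for the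
  negative part, and by the pair of both for the total variation.\<close>

lemma jordan_variations:
  assumes p: "levy_measure p" and n: "levy_measure n" and Y: "Y \<in> sets borel"
    and pY: "emeasure p (- Y) = 0" and nY: "emeasure n Y = 0"
    and \<nu>: "\<And>B. B \<in> Borel0 \<Longrightarrow> \<nu> B = measure p B - measure n B"
    and r: "0 < r" and X: "X \<in> Borel_off r"
  shows "pos_variation (Borel_off r) \<nu> X = emeasure p X"
    and "neg_variation (Borel_off r) \<nu> X = emeasure n X"
    and "total_variation (Borel_off r) \<nu> X = emeasure p X + emeasure n X"
proof -
  note [simp] = sets_levy_measure[OF p] sets_levy_measure[OF n]
  have Xb[simp]: "X \<in> sets borel" using X by (simp add: Borel_off_def)
  have C: "\<nu> C = measure p C - measure n C" "ennreal (measure p C) = emeasure p C" "ennreal (measure n C) = emeasure n C"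
    if "C \<in> Borel_off r" for C
    using \<nu>[OF Borel_off_Borel0[OF r that]] levy_measure_off_0[OF p r that] levy_measure_off_0[OF n r that]
    by (auto simp: emeasure_eq_ennreal_measure top.not_eq_extremum)
  have z: "emeasure p (C \<inter> - Y) = 0" "emeasure n (C \<inter> Y) = 0" if "C \<in> sets borel" for C
  proof -
    have "emeasure p (C \<inter> - Y) \<le> emeasure p (- Y)" "emeasure n (C \<inter> Y) \<le> emeasure n Y"
      using Y by (auto intro!: emeasure_mono)
    then show "emeasure p (C \<inter> - Y) = 0" "emeasure n (C \<inter> Y) = 0" using pY nY by auto
  qed
  have split: "emeasure N C = emeasure N (C \<inter> Y) + emeasure N (C \<inter> - Y)" if "C \<in> sets borel" "sets N = sets borel" for N C
    using that Y by (subst plus_emeasure) (auto intro!: arg_cong[where f="emeasure N"])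
  have XY: "X \<inter> Y \<in> Borel_off r" "X \<inter> - Y \<in> Borel_off r"
    using Y by (auto intro!: Borel_off_subset[OF X])
  have \<nu>XY: "\<nu> (X \<inter> Y) = measure p X" "\<nu> (X \<inter> - Y) = - measure n X"
    using C[OF XY(1)] C[OF XY(2)] split[of X p] split[of X n] z[of X] by (auto simp: measure_def)
  have pX: "ennreal (\<nu> (X \<inter> Y)) = emeasure p X" "ennreal (- \<nu> (X \<inter> - Y)) = emeasure n X"
    using \<nu>XY C[OF X] by auto
  show "pos_variation (Borel_off r) \<nu> X = emeasure p X"
    unfolding pos_variation_def
  proof (rule antisym)
    show "(SUP B\<in>{B \<in> Borel_off r. B \<subseteq> X}. ennreal (\<nu> B)) \<le> emeasure p X"
    proof (rule SUP_least, safe)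
      fix B assume B: "B \<in> Borel_off r" "B \<subseteq> X"
      have "ennreal (\<nu> B) \<le> ennreal (measure p B)" using C[OF B(1)] by (intro ennreal_leI) simp
      also have "\<dots> \<le> emeasure p X" using C[OF B(1)] B by (auto intro!: emeasure_mono)
      finally show "ennreal (\<nu> B) \<le> emeasure p X" .
    qed
    show "emeasure p X \<le> (SUP B\<in>{B \<in> Borel_off r. B \<subseteq> X}. ennreal (\<nu> B))"
      unfolding pX(1)[symmetric] using XY by (intro SUP_upper) auto
  qed
  show "neg_variation (Borel_off r) \<nu> X = emeasure n X"
    unfolding neg_variation_def
  proof (rule antisym)
    show "(SUP B\<in>{B \<in> Borel_off r. B \<subseteq> X}. ennreal (- \<nu> B)) \<le> emeasure n X"
    proof (rule SUP_least, safe)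
      fix B assume B: "B \<in> Borel_off r" "B \<subseteq> X"
      have "ennreal (- \<nu> B) \<le> ennreal (measure n B)" using C[OF B(1)] by (intro ennreal_leI) simp
      also have "\<dots> \<le> emeasure n X" using C[OF B(1)] B by (auto intro!: emeasure_mono)
      finally show "ennreal (- \<nu> B) \<le> emeasure n X" .
    qed
    show "emeasure n X \<le> (SUP B\<in>{B \<in> Borel_off r. B \<subseteq> X}. ennreal (- \<nu> B))"
      unfolding pX(2)[symmetric] using XY by (intro SUP_upper) auto
  qed
  show "total_variation (Borel_off r) \<nu> X = emeasure p X + emeasure n X"
    unfolding total_variation_def
  proof (rule antisym)
    show "(SUP \<B>\<in>{\<B>. finite \<B> \<and> \<B> \<subseteq> Borel_off r \<and> disjoint \<B> \<and> \<Union>\<B> \<subseteq> X}. \<Sum>B\<in>\<B>. ennreal \<bar>\<nu> B\<bar>) \<le> emeasure p X + emeasure n X"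
    proof (rule SUP_least, safe)
      fix \<B> assume \<B>: "finite \<B>" "\<B> \<subseteq> Borel_off r" "disjoint \<B>" "\<Union>\<B> \<subseteq> X"
      have s: "(\<Sum>B\<in>\<B>. emeasure N B) \<le> emeasure N X" if "sets N = sets borel" for N
      proof -
        have "(\<Sum>B\<in>\<B>. emeasure N B) = emeasure N (\<Union>\<B>)"
          using \<B> that sum_emeasure[of "\<lambda>B. B" \<B> N]
          by (auto simp: disjoint_family_on_def disjoint_def Borel_off_def)
        also have "\<dots> \<le> emeasure N X" using \<B>(4) that by (intro emeasure_mono) auto
        finally show ?thesis .
      qed
      have "(\<Sum>B\<in>\<B>. ennreal \<bar>\<nu> B\<bar>) \<le> (\<Sum>B\<in>\<B>. emeasure p B + emeasure n B)"
      proof (rule sum_mono)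
        fix B assume "B \<in> \<B>"
        then have B: "B \<in> Borel_off r" using \<B> by auto
        have "ennreal \<bar>\<nu> B\<bar> \<le> ennreal (measure p B + measure n B)"
          using C(1)[OF B] by (intro ennreal_leI) (smt (verit) measure_nonneg)
        then show "ennreal \<bar>\<nu> B\<bar> \<le> emeasure p B + emeasure n B"
          using C(2,3)[OF B] by simp
      qed
      also have "\<dots> = (\<Sum>B\<in>\<B>. emeasure p B) + (\<Sum>B\<in>\<B>. emeasure n B)" by (rule sum.distrib)
      also have "\<dots> \<le> emeasure p X + emeasure n X" by (intro add_mono s) auto
      finally show "(\<Sum>B\<in>\<B>. ennreal \<bar>\<nu> B\<bar>) \<le> emeasure p X + emeasure n X" .
    qed
    show "emeasure p X + emeasure n X \<le> (SUP \<B>\<in>{\<B>. finite \<B> \<and> \<B> \<subseteq> Borel_off r \<and> disjoint \<B> \<and> \<Union>\<B> \<subseteq> X}. \<Sum>B\<in>\<B>. ennreal \<bar>\<nu> B\<bar>)"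
    proof (rule SUP_upper2[of "{X \<inter> Y, X \<inter> - Y}"])
      show "{X \<inter> Y, X \<inter> - Y} \<in> {\<B>. finite \<B> \<and> \<B> \<subseteq> Borel_off r \<and> disjoint \<B> \<and> \<Union>\<B> \<subseteq> X}"
        using XY by (auto simp: disjoint_def)
      have *: "emeasure p X = ennreal \<bar>\<nu> (X \<inter> Y)\<bar>" "emeasure n X = ennreal \<bar>\<nu> (X \<inter> - Y)\<bar>"
        using \<nu>XY C[OF X] by auto
      show "emeasure p X + emeasure n X \<le> (\<Sum>B\<in>{X \<inter> Y, X \<inter> - Y}. ennreal \<bar>\<nu> B\<bar>)"
      \<comment> \<open>The two-element set display collapses to a singleton when the pieces
        coincide, which forces X to be empty.\<close>
      proof (cases "X \<inter> Y = X \<inter> - Y")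
        case True
        then have "X = {}" by blast
        then show ?thesis by simp
      next
        case False
        then show ?thesis by (simp add: *)
      qed
    qed
  qed
qed

text \<open>Evaluates the three definite descriptions. Existence comes from the Jordan decomposition
  of G and M together with \<open>jordan_variations\<close>, uniqueness from
  \<open>extends_off_0_unique\<close>.\<close>

lemma levy_diff_decomposition:
  assumes d: "levy_diff \<nu> G M"
  shows "levy_measure (ql_pos \<nu>)" "levy_measure (ql_neg \<nu>)" "sets (ql_abs \<nu>) = sets borel"
    and "\<exists>Y\<in>sets borel. emeasure (ql_pos \<nu>) (- Y) = 0 \<and> emeasure (ql_neg \<nu>) Y = 0"
    and "\<And>X. X \<in> sets borel \<Longrightarrow> emeasure (ql_pos \<nu>) X + emeasure M X = emeasure (ql_neg \<nu>) X + emeasure G X"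
    and "\<And>X. X \<in> sets borel \<Longrightarrow> emeasure (ql_pos \<nu>) X \<le> emeasure G X"
    and "\<And>X. X \<in> sets borel \<Longrightarrow> emeasure (ql_neg \<nu>) X \<le> emeasure M X"
    and "\<And>X. X \<in> sets borel \<Longrightarrow> emeasure (ql_abs \<nu>) X = emeasure (ql_pos \<nu>) X + emeasure (ql_neg \<nu>) X"
    and "\<And>B. B \<in> Borel0 \<Longrightarrow> \<nu> B = measure (ql_pos \<nu>) B - measure (ql_neg \<nu>) B"
proof -
  have G: "levy_measure G" and M: "levy_measure M" and \<nu>: "\<And>B. B \<in> Borel0 \<Longrightarrow> \<nu> B = measure G B - measure M B"
    using d by (auto simp: levy_diff_def)
  obtain p n Y where pn: "levy_measure p" "levy_measure n" "Y \<in> sets borel" "emeasure p (- Y) = 0" "emeasure n Y = 0"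
    and eq: "\<And>X. X \<in> sets borel \<Longrightarrow> emeasure p X + emeasure M X = emeasure n X + emeasure G X"
    and pG: "\<And>X. X \<in> sets borel \<Longrightarrow> emeasure p X \<le> emeasure G X"
    and nM: "\<And>X. X \<in> sets borel \<Longrightarrow> emeasure n X \<le> emeasure M X"
    using levy_jordan[OF G M] by blast
  \<comment> \<open>On sets away from 0 all four masses are finite, so the additive identity can be
    rearranged into a difference of reals.\<close>
  have \<nu>': "\<nu> B = measure p B - measure n B" if B: "B \<in> Borel0" for B
  proof -
    have fin: "emeasure N B = ennreal (measure N B)" if "levy_measure N" for N
      using levy_measure_Borel0[OF that B] by (simp add: emeasure_eq_ennreal_measure top.not_eq_extremum)
    have "ennreal (measure p B + measure M B) = ennreal (measure n B + measure G B)"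
      using eq[of B] B by (simp add: Borel0_def fin G M pn)
    then have "measure p B + measure M B = measure n B + measure G B"
      by (subst (asm) ennreal_inj) auto
    then show ?thesis using \<nu>[OF B] by simp
  qed
  note var = jordan_variations[OF pn \<nu>']
  obtain c where c: "sets c = sets borel" "\<And>X. X \<in> sets borel \<Longrightarrow> emeasure c X = emeasure p X + emeasure n X"
    using ex_add_measure[of p borel n] pn by (auto simp: levy_measure_def)
  have P: "extends_off_0 (\<lambda>r. pos_variation (Borel_off r) \<nu>) p"
    and N: "extends_off_0 (\<lambda>r. neg_variation (Borel_off r) \<nu>) n"
    and A: "extends_off_0 (\<lambda>r. total_variation (Borel_off r) \<nu>) c"
    using pn c var by (auto simp: extends_off_0_def levy_measure_def Borel_off_def)
  have "ql_pos \<nu> = p" "ql_neg \<nu> = n" "ql_abs \<nu> = c"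
    unfolding ql_pos_def ql_neg_def ql_abs_def
    by (intro the_equality P N A extends_off_0_unique[OF _ P] extends_off_0_unique[OF _ N] extends_off_0_unique[OF _ A]; assumption)+
  then show "levy_measure (ql_pos \<nu>)" "levy_measure (ql_neg \<nu>)" "sets (ql_abs \<nu>) = sets borel"
    "\<exists>Y\<in>sets borel. emeasure (ql_pos \<nu>) (- Y) = 0 \<and> emeasure (ql_neg \<nu>) Y = 0"
    "\<And>X. X \<in> sets borel \<Longrightarrow> emeasure (ql_pos \<nu>) X + emeasure M X = emeasure (ql_neg \<nu>) X + emeasure G X"
    "\<And>X. X \<in> sets borel \<Longrightarrow> emeasure (ql_pos \<nu>) X \<le> emeasure G X"
    "\<And>X. X \<in> sets borel \<Longrightarrow> emeasure (ql_neg \<nu>) X \<le> emeasure M X"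
    "\<And>X. X \<in> sets borel \<Longrightarrow> emeasure (ql_abs \<nu>) X = emeasure (ql_pos \<nu>) X + emeasure (ql_neg \<nu>) X"
    "\<And>B. B \<in> Borel0 \<Longrightarrow> \<nu> B = measure (ql_pos \<nu>) B - measure (ql_neg \<nu>) B"
    using pn eq pG nM c \<nu>' by auto
qed

lemma nn_integral_ql_abs:
  assumes d: "levy_diff \<nu> G M" and h: "h \<in> borel_measurable borel"
  shows "(\<integral>\<^sup>+x. h x \<partial>ql_abs \<nu>) = (\<integral>\<^sup>+x. h x \<partial>ql_pos \<nu>) + (\<integral>\<^sup>+x. h x \<partial>ql_neg \<nu>)"
  using levy_diff_decomposition[OF d] h
  by (intro nn_integral_add_measure[symmetric, where T=borel]) (auto simp: levy_measure_def)

lemma nn_integral_ql_le: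
  assumes d: "levy_diff \<nu> G M"
  shows "(\<integral>\<^sup>+x. h x \<partial>ql_pos \<nu>) \<le> (\<integral>\<^sup>+x. h x \<partial>G)" "(\<integral>\<^sup>+x. h x \<partial>ql_neg \<nu>) \<le> (\<integral>\<^sup>+x. h x \<partial>M)"
  using levy_diff_decomposition[OF d] d
  by (auto intro!: nn_integral_mono_measure simp: le_measure levy_measure_def levy_diff_def)

text \<open>Both \<open>ql_pos \<nu> + M\<close> and \<open>ql_neg \<nu> + G\<close> equal one Levy
  measure c, against which g is integrable. Hence any representing pair gives the same integral as
  the Jordan parts.\<close>

lemma ql_integral_levy_diff:
  fixes g :: "real \<Rightarrow> complex"
  assumes d: "levy_diff \<nu> G M" and g: "g \<in> borel_measurable borel" "\<And>x. cmod (g x) \<le> C * min 1 (x\<^sup>2)"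
  shows "ql_integral \<nu> g = (\<integral>x. g x \<partial>G) - (\<integral>x. g x \<partial>M)"
proof -
  note D = levy_diff_decomposition[OF d]
  have GM: "levy_measure G" "levy_measure M" using d by (auto simp: levy_diff_def)
  note int = levy_measure_integrable[OF _ g]
  obtain c where c: "sets c = sets borel" "\<And>X. X \<in> sets borel \<Longrightarrow> emeasure c X = emeasure (ql_pos \<nu>) X + emeasure M X"
    using ex_add_measure[of "ql_pos \<nu>" borel M] D(1) GM by (auto simp: levy_measure_def)
  have "levy_measure c"
    unfolding levy_measure_def
  proof (intro conjI)
    have "(\<integral>\<^sup>+x. ennreal (min 1 (x\<^sup>2)) \<partial>c) = (\<integral>\<^sup>+x. ennreal (min 1 (x\<^sup>2)) \<partial>ql_pos \<nu>) + (\<integral>\<^sup>+x. ennreal (min 1 (x\<^sup>2)) \<partial>M)"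
      using c D(1) GM by (intro nn_integral_add_measure[symmetric, where T=borel]) (auto simp: levy_measure_def)
    then show "(\<integral>\<^sup>+x. ennreal (min 1 (x\<^sup>2)) \<partial>c) < \<infinity>"
      using D(1) GM by (auto simp: levy_measure_def)
  qed (use c D(1) GM in \<open>auto simp: levy_measure_def\<close>)
  note i = int[OF this] int[OF D(1)] int[OF D(2)] int[OF GM(1)] int[OF GM(2)]
  have "(\<integral>x. g x \<partial>ql_pos \<nu>) + (\<integral>x. g x \<partial>M) = (\<integral>x. g x \<partial>c)"
    using c D GM i by (intro integral_add_measure[where T=borel]) (auto simp: levy_measure_def)
  moreover have "(\<integral>x. g x \<partial>ql_neg \<nu>) + (\<integral>x. g x \<partial>G) = (\<integral>x. g x \<partial>c)"
    using c D GM i by (intro integral_add_measure[where T=borel]) (auto simp: levy_measure_def)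
  ultimately show ?thesis
    unfolding ql_integral_def by (metis add_diff_eq diff_eq_eq eq_diff_eq add.commute)
qed

lemma ql_integral_levy_diff_real:
  fixes g :: "real \<Rightarrow> real"
  assumes d: "levy_diff \<nu> G M" and g[measurable]: "g \<in> borel_measurable borel" and le: "\<And>x. \<bar>g x\<bar> \<le> C * min 1 (x\<^sup>2)"
  shows "ql_integral \<nu> g = (\<integral>x. g x \<partial>G) - (\<integral>x. g x \<partial>M)"
proof -
  have "complex_of_real (ql_integral \<nu> g) = ql_integral \<nu> (\<lambda>x. complex_of_real (g x))"
    by (simp add: ql_integral_def)
  also have "\<dots> = (\<integral>x. complex_of_real (g x) \<partial>G) - (\<integral>x. complex_of_real (g x) \<partial>M)"
    using le by (intro ql_integral_levy_diff[OF d, of _ C]) auto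
  also have "\<dots> = complex_of_real ((\<integral>x. g x \<partial>G) - (\<integral>x. g x \<partial>M))" by simp
  finally show ?thesis by (simp only: of_real_eq_iff)
qed

lemma quasi_levy_type_levy_diff:
  assumes d: "levy_diff \<nu> G M"
  shows "quasi_levy_type \<nu>"
  unfolding quasi_levy_type_def
proof (intro conjI allI impI)
  note D = levy_diff_decomposition[OF d]
  have "(\<integral>\<^sup>+x. ennreal (min 1 (x\<^sup>2)) \<partial>ql_abs \<nu>) = (\<integral>\<^sup>+x. ennreal (min 1 (x\<^sup>2)) \<partial>ql_pos \<nu>) + (\<integral>\<^sup>+x. ennreal (min 1 (x\<^sup>2)) \<partial>ql_neg \<nu>)"
    by (rule nn_integral_ql_abs[OF d]) measurable
  then show "(\<integral>\<^sup>+x. ennreal (min 1 (x\<^sup>2)) \<partial>ql_abs \<nu>) < \<infinity>"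
    using D(1,2) by (auto simp: levy_measure_def)
  fix r :: real assume r: "0 < r"
  show "signed_measure_on (Borel_off r) \<nu>"
    unfolding signed_measure_on_def
  proof (intro conjI allI impI)
    show "\<nu> {} = 0" using D(9)[of "{}"] by (simp add: Borel0_def)
    fix A :: "nat \<Rightarrow> real set" assume A: "range A \<subseteq> Borel_off r" "disjoint_family A" "(\<Union>n. A n) \<in> Borel_off r"
    have s: "(\<lambda>n. measure N (A n)) sums measure N (\<Union>n. A n)" if N: "levy_measure N" for N
      using A levy_measure_off_0[OF N r A(3)]
      by (intro measure_UNION) (auto simp: sets_levy_measure[OF N] Borel_off_def)
    have "(\<lambda>n. measure (ql_pos \<nu>) (A n) - measure (ql_neg \<nu>) (A n)) sums (measure (ql_pos \<nu>) (\<Union>n. A n) - measure (ql_neg \<nu>) (\<Union>n. A n))"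
      by (intro sums_diff s D)
    then show "(\<lambda>n. \<nu> (A n)) sums \<nu> (\<Union>n. A n)"
      using D(9)[OF Borel_off_Borel0[OF r A(3)]] D(9)[OF Borel_off_Borel0[OF r]] A(1) by (auto simp: subset_eq)
  qed
qed

text \<open>Finite unions of sets from a countable base approximate every Borel set in every finite
  Borel measure, by outer regularity. The family is chosen before the measure, so a single one
  serves a whole kernel; this makes the Jordan parts measurable in the parameter.\<close>

lemma ex_countable_approximating_family:
  "\<exists>\<C>::real set set. countable \<C> \<and> \<C> \<subseteq> sets borel \<and> \<C> \<noteq> {} \<and>
     (\<forall>m Y \<epsilon>. sets m = sets borel \<longrightarrow> emeasure m UNIV < \<infinity> \<longrightarrow> Y \<in> sets borel \<longrightarrow> 0 < \<epsilon> \<longrightarrow>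
        (\<exists>C\<in>\<C>. emeasure m (Y - C) \<le> ennreal \<epsilon> \<and> emeasure m (C - Y) \<le> ennreal \<epsilon>))"
proof -
  obtain \<B> :: "real set set" where \<B>: "countable \<B>" "topological_basis \<B>"
    using ex_countable_basis by blast
  have op: "open b" if "b \<in> \<B>" for b using topological_basis_open[OF \<B>(2) that] .
  define \<C> where "\<C> = Union ` {F. finite F \<and> F \<subseteq> \<B>}"
  show ?thesis
  proof (intro exI[of _ \<C>] conjI allI impI)
    show "countable \<C>" unfolding \<C>_def by (intro countable_image countable_Collect_finite_subset \<B>)
    show "\<C> \<noteq> {}" by (auto simp: \<C>_def)
    show \<C>b: "\<C> \<subseteq> sets borel" unfolding \<C>_def using op by (auto intro!: borel_open open_Union)
    fix m :: "real measure" and Y :: "real set" and \<epsilon> :: real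
    assume m[simp, measurable_cong]: "sets m = sets borel" and fin: "emeasure m UNIV < \<infinity>"
      and Y: "Y \<in> sets borel" and \<epsilon>: "0 < \<epsilon>"
    have sp: "space m = UNIV" using sets_eq_imp_space_eq[OF m] by simp
    interpret finite_measure m using fin sp by (intro finite_measureI) auto
    have "emeasure m Y = (INF U \<in> {U. Y \<subseteq> U \<and> open U}. emeasure m U)"
      by (rule outer_regular) (use fin sp Y in auto)
    moreover have "emeasure m Y < emeasure m Y + ennreal \<epsilon>"
      using \<epsilon> emeasure_finite[of Y] by (simp add: ennreal_add_left_cancel_less top.not_eq_extremum ennreal_less_zero_iff)
    ultimately obtain U where U: "Y \<subseteq> U" "open U" "emeasure m U < emeasure m Y + ennreal \<epsilon>"
      by (auto simp: INF_less_iff)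
    have Ub: "U \<in> sets borel" using U by simp
    obtain F where F: "F \<subseteq> \<B>" "\<Union>F = U" using \<B>(2) U(2) by (auto simp: topological_basis_def)
    \<comment> \<open>The inserted empty set makes the enumerated set nonempty; since it need not
      belong to the base, it is removed again when \<open>W k\<close> is shown to lie in the
      family.\<close>
    define b where "b = from_nat_into (insert {} F)"
    have b: "range b = insert {} F"
      unfolding b_def using countable_subset[OF F(1) \<B>(1)] by (intro range_from_nat_into) auto
    define W where "W k = (\<Union>i<k. b i)" for k
    have W: "W k \<in> \<C>" for k
    proof -
      have "W k = \<Union> (b ` {..<k} - {{}})" by (auto simp: W_def)
      moreover have "b ` {..<k} - {{}} \<subseteq> \<B>" using b F(1) by blast
      ultimately show ?thesis unfolding \<C>_def by (intro image_eqI[of _ _ "b ` {..<k} - {{}}"]) auto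
    qed
    have UW: "(\<Union>k. W k) = U" 
    proof -
      have "(\<Union>k. W k) = \<Union> (range b)" by (auto simp: W_def)
      then show ?thesis using b F(2) by simp
    qed
    have "(\<lambda>k. measure m (W k)) \<longlonglongrightarrow> measure m (\<Union>k. W k)"
      using W \<C>b by (intro finite_Lim_measure_incseq) (auto simp: incseq_def W_def intro: less_le_trans)
    then have "(\<lambda>k. measure m (W k)) \<longlonglongrightarrow> measure m U" unfolding UW .
    then have "eventually (\<lambda>k. measure m U - \<epsilon> < measure m (W k)) sequentially"
      using \<epsilon> by (intro order_tendstoD) auto
    then obtain k where k: "measure m U - \<epsilon> < measure m (W k)" by (auto simp: eventually_sequentially)
    have WU: "W k \<subseteq> U" using UW by blast
    have Wb: "W k \<in> sets borel" using W \<C>b by blast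
    have "measure m (Y - W k) \<le> measure m (U - W k)" using U Wb Y by (intro finite_measure_mono) auto
    also have "\<dots> = measure m U - measure m (W k)" using WU Wb Ub by (intro finite_measure_Diff) auto
    finally have 1: "measure m (Y - W k) \<le> \<epsilon>" using k by simp
    have "measure m (W k - Y) \<le> measure m (U - Y)" using WU Ub Y by (intro finite_measure_mono) auto
    also have "\<dots> = measure m U - measure m Y" using U Ub Y by (intro finite_measure_Diff) auto
    also have "\<dots> \<le> \<epsilon>"
    proof -
      have "ennreal (measure m U) < ennreal (measure m Y + \<epsilon>)" using U(3) \<epsilon> by (simp add: emeasure_eq_measure)
      then show ?thesis by (simp add: ennreal_less_iff)
    qed
    finally have 2: "measure m (W k - Y) \<le> \<epsilon>" .
    show "\<exists>C\<in>\<C>. emeasure m (Y - C) \<le> ennreal \<epsilon> \<and> emeasure m (C - Y) \<le> ennreal \<epsilon>"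
      using W[of k] 1 2 by (auto simp: emeasure_eq_measure intro!: bexI[of _ "W k"] ennreal_leI)
  qed
qed

text \<open>The supremum over all Borel subsets of X is attained at \<open>X \<inter> Y\<close> for
  a Hahn set Y. Members of the countable family come arbitrarily close to Y, so the supremum over
  the family is the same.\<close>

lemma ql_pos_eq_countable_SUP:
  assumes d: "levy_diff \<nu> G M" and r: "0 < r" and X: "X \<in> Borel_off r"
    and \<C>: "\<C> \<subseteq> sets borel" "\<And>m Y \<epsilon>. sets m = sets borel \<Longrightarrow> emeasure m UNIV < \<infinity> \<Longrightarrow> Y \<in> sets borel \<Longrightarrow> 0 < \<epsilon> \<Longrightarrow>
        (\<exists>C\<in>\<C>. emeasure m (Y - C) \<le> ennreal \<epsilon> \<and> emeasure m (C - Y) \<le> ennreal \<epsilon>)"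
  shows "emeasure (ql_pos \<nu>) X = (SUP C\<in>\<C>. ennreal (measure G (X \<inter> C) - measure M (X \<inter> C)))"
proof -
  note D = levy_diff_decomposition[OF d]
  define p n where "p = ql_pos \<nu>" and "n = ql_neg \<nu>"
  have p: "levy_measure p" and n: "levy_measure n" using D by (auto simp: p_def n_def)
  note [simp, measurable_cong] = sets_levy_measure[OF p] sets_levy_measure[OF n]
  obtain Y where Y: "Y \<in> sets borel" "emeasure p (- Y) = 0" "emeasure n Y = 0" using D(4) by (auto simp: p_def n_def)
  have Xb[simp, measurable]: "X \<in> sets borel" using X by (simp add: Borel_off_def)
  have sub: "B \<in> Borel_off r" if "B \<in> sets borel" "B \<subseteq> X" for B using Borel_off_subset[OF X that] .
  have em: "emeasure p B = ennreal (measure p B)" "emeasure n B = ennreal (measure n B)" if "B \<in> Borel_off r" for B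
    using levy_measure_off_0[OF p r that] levy_measure_off_0[OF n r that]
    by (auto simp: emeasure_eq_ennreal_measure top.not_eq_extremum)
  have eq: "measure G B - measure M B = measure p B - measure n B" if "B \<in> Borel_off r" for B
    using D(9)[OF Borel_off_Borel0[OF r that]] d Borel_off_Borel0[OF r that] by (auto simp: levy_diff_def p_def n_def)
  show ?thesis
    unfolding p_def[symmetric]
  proof (rule antisym)
    show "(SUP C\<in>\<C>. ennreal (measure G (X \<inter> C) - measure M (X \<inter> C))) \<le> emeasure p X"
    proof (rule SUP_least)
      fix C assume "C \<in> \<C>"
      then have B: "X \<inter> C \<in> Borel_off r" using \<C>(1) by (intro sub) auto
      have "ennreal (measure G (X \<inter> C) - measure M (X \<inter> C)) \<le> ennreal (measure p (X \<inter> C))"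
        unfolding eq[OF B] by (intro ennreal_leI) simp
      also have "\<dots> \<le> emeasure p X" by (subst em(1)[OF B, symmetric]) (auto intro!: emeasure_mono)
      finally show "ennreal (measure G (X \<inter> C) - measure M (X \<inter> C)) \<le> emeasure p X" .
    qed
    show "emeasure p X \<le> (SUP C\<in>\<C>. ennreal (measure G (X \<inter> C) - measure M (X \<inter> C)))"
    proof (rule ennreal_le_epsilon)
      fix e :: real assume e: "0 < e"
      \<comment> \<open>The sum of both parts restricted to X is one finite measure, so one set C
        controls both errors: what p loses on Y - C and what n gains on C - Y. Each costs
        e/2.\<close>
      define p' n' where "p' = density p (indicator X)" and "n' = density n (indicator X)"
      have pn': "emeasure p' B = emeasure p (X \<inter> B)" "emeasure n' B = emeasure n (X \<inter> B)" if "B \<in> sets borel" for B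
        using that by (auto simp: p'_def n'_def emeasure_density indicator_inter_arith[symmetric])
      have "sets p' = sets borel" "sets n' = sets borel" by (simp_all add: p'_def n'_def)
      from ex_add_measure[OF this]
      obtain c where c0: "sets c = sets borel" "\<And>B. B \<in> sets borel \<Longrightarrow> emeasure c B = emeasure p' B + emeasure n' B"
        by blast
      have c[simp]: "sets c = sets borel" "\<And>B. B \<in> sets borel \<Longrightarrow> emeasure c B = emeasure p (X \<inter> B) + emeasure n (X \<inter> B)"
        using c0 pn' by auto
      have "emeasure c UNIV < \<infinity>" using levy_measure_off_0[OF p r X] levy_measure_off_0[OF n r X] by simp
      from \<C>(2)[OF c(1) this Y(1), of "e/2"] e
      obtain C where C: "C \<in> \<C>" "emeasure c (Y - C) \<le> ennreal (e/2)" "emeasure c (C - Y) \<le> ennreal (e/2)" by auto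
      have Cb[simp]: "C \<in> sets borel" using C \<C>(1) by auto
      have nY: "- Y \<in> sets borel" "X \<inter> C \<in> sets borel" "X \<inter> (Y - C) \<in> sets borel" "X \<inter> (C - Y) \<in> sets borel"
        "X \<inter> C \<union> X \<inter> (Y - C) \<in> sets borel" "X \<inter> C \<union> X \<inter> (Y - C) \<union> - Y \<in> sets borel" "X \<inter> (C - Y) \<union> Y \<in> sets borel"
        using Y(1) Cb Xb by (auto intro!: sets.Un sets.Int sets.Diff borel_comp)
      have 1: "emeasure p (X \<inter> (Y - C)) \<le> ennreal (e/2)" "emeasure n (X \<inter> (C - Y)) \<le> ennreal (e/2)"
      proof -
        have "emeasure p (X \<inter> (Y - C)) \<le> emeasure c (Y - C)" "emeasure n (X \<inter> (C - Y)) \<le> emeasure c (C - Y)"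
          using c(2)[of "Y - C"] c(2)[of "C - Y"] Y(1) Cb by (metis le_iff_add add.commute sets.Diff)+
        then show "emeasure p (X \<inter> (Y - C)) \<le> ennreal (e/2)" "emeasure n (X \<inter> (C - Y)) \<le> ennreal (e/2)"
          using C(2,3) by auto
      qed
      have "emeasure p X \<le> emeasure p ((X \<inter> C) \<union> (X \<inter> (Y - C)) \<union> - Y)" using Y(1) nY by (intro emeasure_mono) auto
      also have "\<dots> \<le> emeasure p ((X \<inter> C) \<union> (X \<inter> (Y - C))) + emeasure p (- Y)" using Y(1) nY by (intro emeasure_subadditive) auto
      also have "\<dots> \<le> emeasure p (X \<inter> C) + emeasure p (X \<inter> (Y - C)) + emeasure p (- Y)" using Y(1) nY by (intro add_right_mono emeasure_subadditive) auto
      also have "\<dots> \<le> emeasure p (X \<inter> C) + ennreal (e/2) + 0" using 1 Y(2) by (intro add_mono) auto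
      finally have A: "emeasure p X \<le> emeasure p (X \<inter> C) + ennreal (e/2)" by simp
      have "emeasure n (X \<inter> C) \<le> emeasure n ((X \<inter> (C - Y)) \<union> Y)" using Y(1) nY by (intro emeasure_mono) auto
      also have "\<dots> \<le> emeasure n (X \<inter> (C - Y)) + emeasure n Y" using Y(1) nY by (intro emeasure_subadditive) auto
      finally have B: "emeasure n (X \<inter> C) \<le> ennreal (e/2)" using 1 Y(3) by simp
      have off: "X \<inter> C \<in> Borel_off r" by (intro sub) auto
      have A': "measure p X \<le> measure p (X \<inter> C) + e/2"
        using A e unfolding em[OF X] em[OF off] by (simp flip: ennreal_plus)
      have B': "measure n (X \<inter> C) \<le> e/2" using B e unfolding em[OF off] by simp
      have "emeasure p X \<le> ennreal (measure G (X \<inter> C) - measure M (X \<inter> C) + e)"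
        unfolding em[OF X] eq[OF off] using A' B' by (intro ennreal_leI) simp
      also have "\<dots> \<le> ennreal (measure G (X \<inter> C) - measure M (X \<inter> C)) + ennreal e"
        using e by (cases "0 \<le> measure G (X \<inter> C) - measure M (X \<inter> C)") (auto simp: ennreal_neg intro!: ennreal_leI)
      also have "\<dots> \<le> (SUP C\<in>\<C>. ennreal (measure G (X \<inter> C) - measure M (X \<inter> C))) + ennreal e"
        using C(1) by (intro add_right_mono SUP_upper)
      finally show "emeasure p X \<le> (SUP C\<in>\<C>. ennreal (measure G (X \<inter> C) - measure M (X \<inter> C))) + ennreal e" .
    qed
  qed
qed

lemma levy_diff_uminus: "levy_diff \<nu> G M \<Longrightarrow> levy_diff (\<lambda>B. - \<nu> B) M G"
  by (auto simp: levy_diff_def)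

lemma ql_pos_uminus: "ql_pos (\<lambda>B. - \<nu> B) = ql_neg \<nu>"
  by (simp add: ql_pos_def ql_neg_def pos_variation_def[abs_def] neg_variation_def[abs_def])

text \<open>The Hahn set varies with s without any measurability. The countable supremum formula
  removes it, and only the measurable masses of \<open>G s\<close> and \<open>M s\<close> on fixed
  sets remain.\<close>

lemma measurable_ql_pos:
  assumes G: "levy_kernel_on l G" and M: "levy_kernel_on l M"
    and d: "\<And>s. s \<in> space l \<Longrightarrow> levy_diff (\<rho> s) (G s) (M s)" and B: "B \<in> sets borel"
  shows "(\<lambda>s. emeasure (ql_pos (\<rho> s)) B) \<in> borel_measurable l"
proof -
  obtain \<C> :: "real set set" where \<C>: "countable \<C>" "\<C> \<subseteq> sets borel"
    "\<And>m Y \<epsilon>. sets m = sets borel \<Longrightarrow> emeasure m UNIV < \<infinity> \<Longrightarrow> Y \<in> sets borel \<Longrightarrow> 0 < \<epsilon> \<Longrightarrow>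
        (\<exists>C\<in>\<C>. emeasure m (Y - C) \<le> ennreal \<epsilon> \<and> emeasure m (C - Y) \<le> ennreal \<epsilon>)"
    using ex_countable_approximating_family by blast
  have "emeasure (ql_pos (\<rho> s)) B = (SUP n. SUP C\<in>\<C>. ennreal (measure (G s) (B \<inter> off_0 n \<inter> C) - measure (M s) (B \<inter> off_0 n \<inter> C)))"
    if s: "s \<in> space l" for s
  proof -
    have "emeasure (ql_pos (\<rho> s)) (B \<inter> off_0 n) =
        (SUP C\<in>\<C>. ennreal (measure (G s) (B \<inter> off_0 n \<inter> C) - measure (M s) (B \<inter> off_0 n \<inter> C)))" for n
    proof (rule ql_pos_eq_countable_SUP[OF d[OF s] _ off_0_Borel_off[OF B] \<C>(2)])
      show "0 < 1 / (real n + 1)" by (simp add: add_nonneg_pos)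
      fix m :: "real measure" and Y :: "real set" and \<epsilon> :: real
      assume "sets m = sets borel" "emeasure m UNIV < \<infinity>" "Y \<in> sets borel" "0 < \<epsilon>"
      then show "\<exists>C\<in>\<C>. emeasure m (Y - C) \<le> ennreal \<epsilon> \<and> emeasure m (C - Y) \<le> ennreal \<epsilon>" by (rule \<C>(3))
    qed
    then show ?thesis
      unfolding emeasure_eq_SUP_off_0[OF sets_levy_measure levy_measure_null_0 B, OF levy_diff_decomposition(1,1)[OF d[OF s]]] by simp
  qed
  moreover have "(\<lambda>s. SUP n. SUP C\<in>\<C>. ennreal (measure (G s) (B \<inter> off_0 n \<inter> C) - measure (M s) (B \<inter> off_0 n \<inter> C))) \<in> borel_measurable l"
  proof -
    have [measurable]: "(\<lambda>s. measure (G s) (B \<inter> off_0 n \<inter> C)) \<in> borel_measurable l" "(\<lambda>s. measure (M s) (B \<inter> off_0 n \<inter> C)) \<in> borel_measurable l"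
      if "C \<in> \<C>" for C n
      using that B \<C>(2) levy_kernel_on.measurable_kernel[OF G] levy_kernel_on.measurable_kernel[OF M]
      unfolding measure_def by (auto intro!: borel_measurable_enn2real)
    show ?thesis
      using \<C>(1) by (intro borel_measurable_SUP) auto
  qed
  ultimately show ?thesis
    by (rule measurable_cong[THEN iffD2])  
qed

lemma levy_kernel_ql:
  assumes G: "levy_kernel_on l G" and M: "levy_kernel_on l M"
    and d: "\<And>s. s \<in> space l \<Longrightarrow> levy_diff (\<rho> s) (G s) (M s)"
  shows "levy_kernel_on l (\<lambda>s. ql_pos (\<rho> s))" "levy_kernel_on l (\<lambda>s. ql_neg (\<rho> s))"
proof -
  interpret G: levy_kernel_on l G by fact
  show "levy_kernel_on l (\<lambda>s. ql_pos (\<rho> s))"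
    using levy_diff_decomposition(1)[OF d] measurable_ql_pos[OF G M d]
    by (intro levy_kernel_on.intro levy_kernel_on_axioms.intro G.sigma_finite_measure_axioms) auto
  have "(\<lambda>s. emeasure (ql_neg (\<rho> s)) B) \<in> borel_measurable l" if "B \<in> sets borel" for B
    using measurable_ql_pos[OF M G levy_diff_uminus[OF d] that] by (simp add: ql_pos_uminus)
  then show "levy_kernel_on l (\<lambda>s. ql_neg (\<rho> s))"
    using levy_diff_decomposition(2)[OF d]
    by (intro levy_kernel_on.intro levy_kernel_on_axioms.intro G.sigma_finite_measure_axioms) auto
qed

section \<open>The gliding hump\<close>

lemma norm_integral_le:
  fixes f :: "'a \<Rightarrow> 'b::{banach, second_countable_topology}"
  assumes "integrable M f" "integrable M g" "\<And>s. s \<in> space M \<Longrightarrow> norm (f s) \<le> g s"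
  shows "norm (\<integral>s. f s \<partial>M) \<le> (\<integral>s. g s \<partial>M)"
  by (rule order_trans[OF integral_norm_bound]) (intro integral_mono integrable_norm assms)

text \<open>For a fixed set \<open>B j\<close> the mass of \<open>d n\<close> on it tends to 0 as n
  grows; for a fixed n the mass off \<open>B j\<close> tends to 0 as j grows. Choosing n and j
  alternately concentrates each selected term on a ring between two consecutive sets.\<close>

lemma (in sigma_finite_measure) gliding_hump:
  fixes d :: "nat \<Rightarrow> 'a \<Rightarrow> 'b::{banach, second_countable_topology}"
  assumes int: "\<And>n. integrable M (d n)" and lim: "AE s in M. (\<lambda>n. d n s) \<longlonglongrightarrow> 0"
  obtains r :: "nat \<Rightarrow> nat" and D :: "nat \<Rightarrow> 'a set"
  where "strict_mono r" "disjoint_family D" "\<And>i. D i \<in> sets M"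
    "(\<lambda>i. \<integral>s. norm (d (r i) s) * indicator (space M - D i) s \<partial>M) \<longlonglongrightarrow> 0"
proof -
  have [measurable]: "d n \<in> borel_measurable M" for n using int by auto
  obtain T where T: "range T \<subseteq> sets M" "(\<Union>i. T i) = space M" "\<And>i. emeasure M (T i) \<noteq> \<infinity>" "incseq T"
    using sigma_finite_incseq by blast
  have [measurable]: "T i \<in> sets M" for i using T(1) by auto
  \<comment> \<open>The bound is imposed for all n at once. Convergent sequences are bounded, so
    these sets exhaust the space up to a null set, and on each of them the constant j on a set of
    finite measure serves as dominating function.\<close>
  define B where "B j = {s \<in> space M. s \<in> T j \<and> (\<forall>n. norm (d n s) \<le> real j)}" for j
  have [measurable]: "B j \<in> sets M" for j unfolding B_def by measurable
  have B_mono: "B i \<subseteq> B j" if "i \<le> j" for i j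
    using incseqD[OF T(4) that] that unfolding B_def by (auto intro: order_trans)
  define a where "a n j = (\<integral>s. norm (d n s) * indicator (B j) s \<partial>M)" for n j
  define b where "b n j = (\<integral>s. norm (d n s) * indicator (space M - B j) s \<partial>M)" for n j
  have a: "(\<lambda>n. a n j) \<longlonglongrightarrow> 0" for j
  proof -
    have "(\<lambda>n. a n j) \<longlonglongrightarrow> (\<integral>s. 0 \<partial>M)"
      unfolding a_def
    proof (rule integral_dominated_convergence[where w = "\<lambda>s. real j * indicator (T j) s"])
      show "integrable M (\<lambda>s. real j * indicator (T j) s)"
        using T(3)[of j] by (intro integrable_mult_right integrable_real_indicator) (auto simp: top.not_eq_extremum)
      show "AE s in M. (\<lambda>n. norm (d n s) * indicator (B j) s) \<longlonglongrightarrow> 0"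
        using lim by eventually_elim (auto intro!: tendsto_mult_left_zero tendsto_norm_zero)
      show "AE s in M. norm (norm (d n s) * indicator (B j) s) \<le> real j * indicator (T j) s" for n
        by (auto simp: B_def split: split_indicator)
    qed auto
    then show ?thesis by simp
  qed
  have b: "(\<lambda>j. b n j) \<longlonglongrightarrow> 0" for n
  proof -
    have "(\<lambda>j. b n j) \<longlonglongrightarrow> (\<integral>s. 0 \<partial>M)"
      unfolding b_def
    proof (rule integral_dominated_convergence[where w = "\<lambda>s. norm (d n s)"])
      show "AE s in M. (\<lambda>j. norm (d n s) * indicator (space M - B j) s) \<longlonglongrightarrow> 0"
        using lim AE_space
      proof eventually_elim
        fix s assume s: "(\<lambda>n. d n s) \<longlonglongrightarrow> 0" "s \<in> space M"
        then have "Bseq (\<lambda>n. d n s)" by (intro convergent_imp_Bseq convergentI)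
        then obtain c where c: "\<And>n. norm (d n s) \<le> c" by (auto simp: Bseq_def)
        obtain k where k: "s \<in> T k" using s(2) T(2) by blast
        have "s \<in> B j" if "max k (nat \<lceil>c\<rceil>) \<le> j" for j
        proof -
          have "c \<le> real j" using that by linarith
          moreover have "s \<in> T j" using k incseqD[OF T(4), of k j] that by auto
          ultimately show ?thesis using s(2) c unfolding B_def by (auto intro: order_trans)
        qed
        then have "eventually (\<lambda>j. s \<in> B j) sequentially"
          unfolding eventually_sequentially by blast
        then have "eventually (\<lambda>j. norm (d n s) * indicator (space M - B j) s = 0) sequentially"
          by eventually_elim simp
        then show "(\<lambda>j. norm (d n s) * indicator (space M - B j) s) \<longlonglongrightarrow> 0"
          by (rule tendsto_eventually)
      qed
      show "integrable M (\<lambda>s. norm (d n s))" using int by simp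
    qed (auto split: split_indicator)
    then show ?thesis by simp
  qed
  define e where "e i = 1 / (real i + 1)" for i :: nat
  have e: "0 < e i" for i by (simp add: e_def add_nonneg_pos)
  \<comment> \<open>A state is a pair (j, n). The next j makes the mass of the current
    \<open>d n\<close> off the new set small, and the next n makes the mass of the new term on that
    set small.\<close>
  have "\<exists>q. \<forall>i. (case q i of (j, n) \<Rightarrow> a n j < e i) \<and>
     (case (q i, q (Suc i)) of ((j, n), (j', n')) \<Rightarrow> j \<le> j' \<and> n < n' \<and> b n j' < e i)"
  proof (rule dependent_nat_choice)
    have "eventually (\<lambda>n. a n 0 < e 0) sequentially" using order_tendstoD(2)[OF a e] .
    then obtain n where "a n 0 < e 0" by (auto simp: eventually_sequentially)
    then show "\<exists>x. case x of (j, n) \<Rightarrow> a n j < e 0" by (intro exI[of _ "(0, n)"]) simp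
  next
    fix x :: "nat \<times> nat" and i
    obtain j n where x: "x = (j, n)" by (cases x)
    have "eventually (\<lambda>j'. b n j' < e i \<and> j \<le> j') sequentially"
      using order_tendstoD(2)[OF b e] eventually_ge_at_top by (rule eventually_conj)
    then obtain j' where j': "b n j' < e i" "j \<le> j'" by (auto simp: eventually_sequentially)
    have "eventually (\<lambda>n'. a n' j' < e (Suc i) \<and> n < n') sequentially"
      using order_tendstoD(2)[OF a e] eventually_gt_at_top by (rule eventually_conj)
    then obtain n' where "a n' j' < e (Suc i)" "n < n'" by (auto simp: eventually_sequentially)
    then show "\<exists>y. (case y of (j, n) \<Rightarrow> a n j < e (Suc i)) \<and>
        (case (x, y) of ((j, n), (j', n')) \<Rightarrow> j \<le> j' \<and> n < n' \<and> b n j' < e i)"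
      using x j' by (intro exI[of _ "(j', n')"]) simp
  qed
  then obtain q where q: "\<And>i. a (snd (q i)) (fst (q i)) < e i" "\<And>i. fst (q i) \<le> fst (q (Suc i))"
    "\<And>i. snd (q i) < snd (q (Suc i))" "\<And>i. b (snd (q i)) (fst (q (Suc i))) < e i"
    by (auto simp: split_beta)
  define r where "r i = snd (q i)" for i
  define C where "C i = B (fst (q i))" for i
  define D where "D i = C (Suc i) - C i" for i
  have C_mono: "C i \<subseteq> C j" if "i \<le> j" for i j
    using lift_Suc_mono_le[of "\<lambda>i. fst (q i)", OF q(2) that] unfolding C_def by (rule B_mono)
  have [measurable]: "C i \<in> sets M" "D i \<in> sets M" for i by (auto simp: C_def D_def)
  show ?thesis
  proof (rule that[of r D])
    show "strict_mono r" unfolding strict_mono_Suc_iff r_def using q(3) by blast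
    show "disjoint_family D"
      unfolding disjoint_family_on_def
    proof (intro ballI impI)
      fix i j :: nat assume "i \<noteq> j"
      then consider "Suc i \<le> j" | "Suc j \<le> i" by linarith
      then show "D i \<inter> D j = {}" by cases (use C_mono in \<open>auto simp: D_def\<close>)
    qed
    have le: "norm (\<integral>s. norm (d (r i) s) * indicator (space M - D i) s \<partial>M) \<le> 2 * e i" for i
    proof -
      have "(\<integral>s. norm (d (r i) s) * indicator (space M - D i) s \<partial>M)
        \<le> (\<integral>s. norm (d (r i) s) * indicator (C i) s + norm (d (r i) s) * indicator (space M - C (Suc i)) s \<partial>M)"
        using int
        by (intro integral_mono) (auto simp: D_def intro!: Bochner_Integration.integrable_add integrable_real_mult_indicator split: split_indicator)
      also have "\<dots> = a (r i) (fst (q i)) + b (r i) (fst (q (Suc i)))"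
        unfolding a_def b_def C_def using int
        by (intro Bochner_Integration.integral_add integrable_real_mult_indicator) auto
      also have "\<dots> \<le> 2 * e i" using q(1)[of i] q(4)[of i] by (simp add: r_def)
      finally show ?thesis by simp
    qed
    have "(\<lambda>i. 2 * e i) \<longlonglongrightarrow> 2 * 0"
      unfolding e_def using LIMSEQ_inverse_real_of_nat by (intro tendsto_mult) (auto simp: inverse_eq_divide add.commute)
    then show "(\<lambda>i. \<integral>s. norm (d (r i) s) * indicator (space M - D i) s \<partial>M) \<longlonglongrightarrow> 0"
      by (intro Lim_null_comparison[OF always_eventually[OF allI[OF le]]]) simp
  qed simp
qed

text \<open>The union of the humps of the even terms tells the even and the odd terms of the subsequence apart.\<close>

lemma (in sigma_finite_measure) exp_integral_tendsto_1:
  fixes d :: "nat \<Rightarrow> 'a \<Rightarrow> complex"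
  assumes int: "\<And>n. integrable M (d n)" and lim: "AE s in M. (\<lambda>n. d n s) \<longlonglongrightarrow> 0"
    and conv: "\<And>A. A \<in> sets M \<Longrightarrow> convergent (\<lambda>n. exp (\<integral>s. indicator A s *\<^sub>R d n s \<partial>M))"
  shows "(\<lambda>n. exp (\<integral>s. d n s \<partial>M)) \<longlonglongrightarrow> 1"
proof -
  obtain r D where r: "strict_mono r" and D: "disjoint_family D" "\<And>i. D i \<in> sets M"
    and h: "(\<lambda>i. \<integral>s. norm (d (r i) s) * indicator (space M - D i) s \<partial>M) \<longlonglongrightarrow> 0"
    using gliding_hump[OF int lim] by blast
  define E where "E = (\<Union>i. D (2 * i))"
  have E[measurable]: "E \<in> sets M" using D(2) by (auto simp: E_def)
  have Dd: "D i \<inter> D j = {}" if "i \<noteq> j" for i j using D(1) that by (auto simp: disjoint_family_on_def)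
  define x where "x i = (\<integral>s. indicator E s *\<^sub>R d (r i) s \<partial>M)" for i
  define y where "y i = (\<integral>s. d (r i) s \<partial>M)" for i
  have iE: "integrable M (\<lambda>s. indicator A s *\<^sub>R d n s)" if "A \<in> sets M" for A n
    using int that by (intro integrable_mult_indicator) auto
  have iN: "integrable M (\<lambda>s. norm (d n s) * indicator A s)" if "A \<in> sets M" for A n
    using int that by (intro integrable_real_mult_indicator) auto
  have odd: "norm (x (2 * i + 1)) \<le> (\<integral>s. norm (d (r (2*i+1)) s) * indicator (space M - D (2*i+1)) s \<partial>M)" for i
  proof -
    have "D (2 * i + 1) \<inter> E = {}" unfolding E_def using Dd[of "2*i+1"] by (auto simp: ) (metis Dd IntI double_not_eq_Suc_double empty_iff)
    then show ?thesis
      unfolding x_def using D(2) sets.sets_into_space[OF E]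
      by (intro norm_integral_le[OF iE[OF E] iN]) (auto split: split_indicator)
  qed
  have even: "norm (x (2 * i) - y (2 * i)) \<le> (\<integral>s. norm (d (r (2*i)) s) * indicator (space M - D (2*i)) s \<partial>M)" for i
  proof -
    have "x (2 * i) - y (2 * i) = (\<integral>s. indicator E s *\<^sub>R d (r (2*i)) s - d (r (2*i)) s \<partial>M)"
      unfolding x_def y_def using int iE[OF E] by (intro Bochner_Integration.integral_diff[symmetric])
    also have "norm \<dots> \<le> (\<integral>s. norm (d (r (2*i)) s) * indicator (space M - D (2*i)) s \<partial>M)"
      using D(2) int by (intro norm_integral_le Bochner_Integration.integrable_diff iE iN E)
        (auto simp: E_def split: split_indicator)
    finally show ?thesis .
  qed
  have x1: "(\<lambda>i. x (2 * i + 1)) \<longlonglongrightarrow> 0"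
    using LIMSEQ_subseq_LIMSEQ[OF h, of "\<lambda>i. 2*i+1"]
    by (intro Lim_null_comparison[OF always_eventually[OF allI[OF odd]]]) (auto simp: strict_mono_def o_def)
  have x0: "(\<lambda>i. x (2 * i) - y (2 * i)) \<longlonglongrightarrow> 0"
    using LIMSEQ_subseq_LIMSEQ[OF h, of "\<lambda>i. 2*i"]
    by (intro Lim_null_comparison[OF always_eventually[OF allI[OF even]]]) (auto simp: strict_mono_def o_def)
  obtain w where w: "(\<lambda>n. exp (\<integral>s. indicator E s *\<^sub>R d n s \<partial>M)) \<longlonglongrightarrow> w"
    using conv[OF E] by (auto simp: convergent_def)
  obtain z where z: "(\<lambda>n. exp (\<integral>s. indicator (space M) s *\<^sub>R d n s \<partial>M)) \<longlonglongrightarrow> z"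
    using conv[OF sets.top] by (auto simp: convergent_def)
  have z: "(\<lambda>n. exp (\<integral>s. d n s \<partial>M)) \<longlonglongrightarrow> z"
    using z by (simp cong: Bochner_Integration.integral_cong)
  have w': "(\<lambda>i. exp (x i)) \<longlonglongrightarrow> w"
    using LIMSEQ_subseq_LIMSEQ[OF w r] by (simp add: x_def o_def)
  have z': "(\<lambda>i. exp (y i)) \<longlonglongrightarrow> z"
    using LIMSEQ_subseq_LIMSEQ[OF z r] by (simp add: y_def o_def)
  have sm: "strict_mono (\<lambda>i::nat. 2 * i + 1)" "strict_mono (\<lambda>i::nat. 2 * i)" by (auto simp: strict_mono_def)
  \<comment> \<open>Along odd indices the hump misses E, so the integrals over E tend to 0 and the
    limit over E is 1. Along even indices E contains the hump, so the integrals over E and over the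
    whole space differ by a null sequence. Only this difference is passed through the continuity of
    \<open>exp\<close>.\<close>
  have "(\<lambda>i. exp (x (2 * i + 1))) \<longlonglongrightarrow> exp 0" by (intro tendsto_intros x1)
  then have w1: "w = 1"
    using LIMSEQ_unique[OF LIMSEQ_subseq_LIMSEQ[OF w' sm(1)]] by (simp add: o_def)
  have "(\<lambda>i. exp (x (2 * i) - y (2 * i)) * exp (y (2 * i))) \<longlonglongrightarrow> exp 0 * z"
    using LIMSEQ_subseq_LIMSEQ[OF z' sm(2)] by (intro tendsto_mult tendsto_exp x0) (simp add: o_def)
  then have "(\<lambda>i. exp (x (2 * i))) \<longlonglongrightarrow> z" by (simp flip: exp_add)
  then have "w = z"
    using LIMSEQ_unique[OF LIMSEQ_subseq_LIMSEQ[OF w' sm(2)]] by (simp add: o_def)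
  with w1 z show ?thesis by simp
qed

text \<open>A uniform boundedness principle. If the norms were unbounded, a rescaled subsequence
  would have norms at least 1 while its integrals over every fixed set tend to 0. The gliding hump
  shows that the norms then tend to 0 along a further subsequence.\<close>

lemma (in sigma_finite_measure) setwise_bounded_imp_Bseq:
  fixes u :: "nat \<Rightarrow> 'a \<Rightarrow> real"
  assumes int: "\<And>n. integrable M (u n)" and lim: "AE s in M. (\<lambda>n. u n s) \<longlonglongrightarrow> v s"
    and bdd: "\<And>A. A \<in> sets M \<Longrightarrow> Bseq (\<lambda>n. \<integral>s. indicator A s * u n s \<partial>M)"
  shows "Bseq (\<lambda>n. \<integral>s. \<bar>u n s\<bar> \<partial>M)"
proof (rule ccontr)
  assume nb: "\<not> Bseq (\<lambda>n. \<integral>s. \<bar>u n s\<bar> \<partial>M)"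
  have ex: "\<exists>n\<ge>k. real k + 1 \<le> (\<integral>s. \<bar>u n s\<bar> \<partial>M)" for k
  proof (rule ccontr)
    assume "\<not> ?thesis"
    then have "(\<integral>s. \<bar>u n s\<bar> \<partial>M) \<le> real k + 1" if "k \<le> n" for n using that by (meson less_imp_le not_le)
    then have "eventually (\<lambda>n. norm (\<integral>s. \<bar>u n s\<bar> \<partial>M) \<le> real k + 1) sequentially"
      by (intro eventually_sequentiallyI[of k]) simp
    then show False using nb by (auto intro: BfunI)
  qed
  then obtain m where m: "\<And>k. k \<le> m k" "\<And>k. real k + 1 \<le> (\<integral>s. \<bar>u (m k) s\<bar> \<partial>M)" by metis
  have m_lim: "filterlim m at_top sequentially"
    using m(1) by (auto intro: filterlim_at_top_mono[OF filterlim_ident])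
  have c0: "(\<lambda>k. 1 / (real k + 1)) \<longlonglongrightarrow> 0"
    using LIMSEQ_inverse_real_of_nat by (simp add: inverse_eq_divide add.commute)
  \<comment> \<open>Dividing by k + 1 sends the pointwise values and the bounded integrals over
    fixed sets to 0, whereas the choice of m keeps the norms at least 1.\<close>
  define d where "d k s = 1 / (real k + 1) * u (m k) s" for k s
  have dint: "integrable M (d k)" for k unfolding d_def using int by simp
  have dlim: "AE s in M. (\<lambda>k. d k s) \<longlonglongrightarrow> 0"
    using lim
  proof eventually_elim
    fix s assume "(\<lambda>n. u n s) \<longlonglongrightarrow> v s"
    then have "(\<lambda>k. u (m k) s) \<longlonglongrightarrow> v s" by (rule filterlim_compose[OF _ m_lim])
    from tendsto_mult[OF c0 this] show "(\<lambda>k. d k s) \<longlonglongrightarrow> 0" by (simp add: d_def)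
  qed
  have dbig: "1 \<le> (\<integral>s. \<bar>d k s\<bar> \<partial>M)" for k
  proof -
    have "(\<integral>s. \<bar>d k s\<bar> \<partial>M) = 1 / (real k + 1) * (\<integral>s. \<bar>u (m k) s\<bar> \<partial>M)"
      unfolding d_def by (simp add: abs_mult)
    also have "\<dots> \<ge> 1 / (real k + 1) * (real k + 1)" by (intro mult_left_mono m) auto
    finally show ?thesis by simp
  qed
  have dA: "(\<lambda>k. \<integral>s. indicator A s * d k s \<partial>M) \<longlonglongrightarrow> 0" if A: "A \<in> sets M" for A
  proof -
    obtain c where "\<And>n. norm (\<integral>s. indicator A s * u n s \<partial>M) \<le> c"
      using bdd[OF A] unfolding Bseq_def by blast
    then have "(\<lambda>k. 1 / (real k + 1) * (\<integral>s. indicator A s * u (m k) s \<partial>M)) \<longlonglongrightarrow> 0"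
      by (intro lim_null_mult_right_bounded[OF c0, of _ c]) auto
    then show ?thesis by (simp add: d_def mult.left_commute[of "indicator _ _"] del: times_divide_eq_left)
  qed
  obtain r D where r: "strict_mono r" and D: "disjoint_family D" "\<And>i. D i \<in> sets M"
    and h: "(\<lambda>i. \<integral>s. norm (d (r i) s) * indicator (space M - D i) s \<partial>M) \<longlonglongrightarrow> 0"
    using gliding_hump[OF dint dlim] by blast
  have [measurable]: "d k \<in> borel_measurable M" for k using dint by auto
  have [measurable]: "D k \<in> sets M" for k using D by auto
  have iA: "integrable M (\<lambda>s. indicator A s * d n s)" if "A \<in> sets M" for A n
    using integrable_mult_indicator[OF that dint] by simp
  have iN: "integrable M (\<lambda>s. norm (d n s) * indicator A s)" if "A \<in> sets M" for A n
    using dint that by (intro integrable_real_mult_indicator) auto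
  \<comment> \<open>The sets may vary with i as long as each stays inside its own hump: their union
    E is one fixed set, and off the i-th hump \<open>d (r i)\<close> contributes asymptotically
    nothing.\<close>
  have F: "(\<lambda>i. \<integral>s. indicator (F i) s * d (r i) s \<partial>M) \<longlonglongrightarrow> 0"
    if F: "\<And>i. F i \<in> sets M" "\<And>i. F i \<subseteq> D i" for F :: "nat \<Rightarrow> 'a set"
  proof -
    define E where "E = (\<Union>i. F i)"
    have E: "E \<in> sets M" using F by (auto simp: E_def)
    have "E \<inter> D i = F i" for i
    proof -
      have "F j \<inter> D i \<subseteq> F i" for j
        using F(2)[of j] D(1) by (cases "j = i") (auto simp: disjoint_family_on_def)
      then show ?thesis using F(2)[of i] unfolding E_def by blast
    qed
    then have le: "norm ((\<integral>s. indicator (F i) s * d (r i) s \<partial>M) - (\<integral>s. indicator E s * d (r i) s \<partial>M))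
       \<le> (\<integral>s. norm (d (r i) s) * indicator (space M - D i) s \<partial>M)" for i
      unfolding Bochner_Integration.integral_diff[OF iA[OF F(1)] iA[OF E], symmetric]
      using iA F(1) E by (intro norm_integral_le Bochner_Integration.integrable_diff iN)
        (auto split: split_indicator)
    then have "(\<lambda>i. (\<integral>s. indicator (F i) s * d (r i) s \<partial>M) - (\<integral>s. indicator E s * d (r i) s \<partial>M)) \<longlonglongrightarrow> 0"
      by (intro Lim_null_comparison[OF always_eventually[OF allI[OF le]] h])
    from tendsto_add[OF this LIMSEQ_subseq_LIMSEQ[OF dA[OF E] r]] show ?thesis by (simp add: o_def)
  qed
  define Fp where "Fp i = {s \<in> D i. 0 < d (r i) s}" for i
  define Fn where "Fn i = {s \<in> D i. d (r i) s \<le> 0}" for i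
  have Fp_eq: "Fp i = D i \<inter> {s \<in> space M. 0 < d (r i) s}" and Fn_eq: "Fn i = D i \<inter> {s \<in> space M. d (r i) s \<le> 0}" for i
    using sets.sets_into_space[OF D(2)] by (auto simp: Fp_def Fn_def)
  have Fm[measurable]: "Fp i \<in> sets M" "Fn i \<in> sets M" for i
    unfolding Fp_eq Fn_eq by measurable
  \<comment> \<open>Splitting each hump by the sign of d turns its norm into two integrals over
    admissible varying sets, plus the vanishing mass off the hump.\<close>
  have "(\<lambda>i. (\<integral>s. indicator (Fp i) s * d (r i) s \<partial>M) - (\<integral>s. indicator (Fn i) s * d (r i) s \<partial>M)
      + (\<integral>s. norm (d (r i) s) * indicator (space M - D i) s \<partial>M)) \<longlonglongrightarrow> 0 - 0 + 0"
    by (intro tendsto_add tendsto_diff F h Fm) (auto simp: Fp_def Fn_def)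
  moreover have "(\<integral>s. indicator (Fp i) s * d (r i) s \<partial>M) - (\<integral>s. indicator (Fn i) s * d (r i) s \<partial>M)
      + (\<integral>s. norm (d (r i) s) * indicator (space M - D i) s \<partial>M) = (\<integral>s. \<bar>d (r i) s\<bar> \<partial>M)" for i
  proof -
    have "(\<integral>s. indicator (Fp i) s * d (r i) s \<partial>M) - (\<integral>s. indicator (Fn i) s * d (r i) s \<partial>M)
      + (\<integral>s. norm (d (r i) s) * indicator (space M - D i) s \<partial>M) = 
      (\<integral>s. indicator (Fp i) s * d (r i) s - indicator (Fn i) s * d (r i) s + norm (d (r i) s) * indicator (space M - D i) s \<partial>M)"
      using iA iN Fm by simp
    also have "\<dots> = (\<integral>s. \<bar>d (r i) s\<bar> \<partial>M)"
      by (intro Bochner_Integration.integral_cong) (auto simp: Fp_def Fn_def split: split_indicator)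
    finally show ?thesis .
  qed
  ultimately have "(\<lambda>i. \<integral>s. \<bar>d (r i) s\<bar> \<partial>M) \<longlonglongrightarrow> 0" by simp
  then have "1 \<le> (0::real)"
    by (rule LIMSEQ_le_const) (use dbig in auto)
  then show False by simp
qed

lemma integrable_of_Bseq_AE_limit:
  fixes u :: "nat \<Rightarrow> 'a \<Rightarrow> real"
  assumes int: "\<And>n. integrable M (u n)" and lim: "AE s in M. (\<lambda>n. u n s) \<longlonglongrightarrow> v s"
    and v: "v \<in> borel_measurable M" and bdd: "Bseq (\<lambda>n. \<integral>s. \<bar>u n s\<bar> \<partial>M)"
  shows "integrable M v"
proof -
  have [measurable]: "\<And>n. u n \<in> borel_measurable M" "v \<in> borel_measurable M" using int v by auto
  obtain c where c: "\<And>n. (\<integral>s. \<bar>u n s\<bar> \<partial>M) \<le> c" using bdd by (auto simp: Bseq_def)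
  have "(\<integral>\<^sup>+s. ennreal \<bar>v s\<bar> \<partial>M) = (\<integral>\<^sup>+s. liminf (\<lambda>n. ennreal \<bar>u n s\<bar>) \<partial>M)"
  proof (rule nn_integral_cong_AE, use lim in eventually_elim)
    fix s assume "(\<lambda>n. u n s) \<longlonglongrightarrow> v s"
    then have "(\<lambda>n. ennreal \<bar>u n s\<bar>) \<longlonglongrightarrow> ennreal \<bar>v s\<bar>" by (intro tendsto_ennrealI tendsto_rabs)
    then show "ennreal \<bar>v s\<bar> = liminf (\<lambda>n. ennreal \<bar>u n s\<bar>)"
      by (intro lim_imp_Liminf[symmetric]) auto
  qed
  also have "\<dots> \<le> liminf (\<lambda>n. \<integral>\<^sup>+s. ennreal \<bar>u n s\<bar> \<partial>M)"
    by (rule nn_integral_liminf) measurable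
  also have "\<dots> \<le> liminf (\<lambda>n. ennreal c)"
    using c int by (intro Liminf_mono always_eventually allI) (auto simp: nn_integral_eq_integral intro!: ennreal_leI)
  also have "\<dots> = ennreal c" by (simp add: Liminf_const)
  finally show ?thesis by (intro integrableI_bounded) (auto simp: ennreal_less_top intro: le_less_trans)
qed

section \<open>Convergence in probability\<close>

lemma cmod_iexp_diff_le: "cmod (iexp x - iexp y) \<le> \<bar>x - y\<bar>"
proof -
  have "iexp x - iexp y = iexp y * (iexp (x - y) - 1)"
    by (simp add: algebra_simps flip: exp_add)
  then show ?thesis
    using iexp_approx1[of "x - y" 0] by (simp add: norm_mult)
qed

text \<open>Uniformity in bounded \<theta> is what yields a common neighbourhood of 0 on which the
  characteristic functions stay away from 0. It comes from the Lipschitz bound |\<theta>| |x - y|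
  off a rare event and the bound 2 on it.\<close>

lemma (in prob_space) tendsto_in_prob_char_uniform:
  assumes X[measurable]: "\<And>n. X n \<in> borel_measurable M" and lim: "tendsto_in_prob M X Y" and e: "0 < e" and b: "0 \<le> b"
  shows "\<forall>\<^sub>F n in sequentially. \<forall>\<theta>. \<bar>\<theta>\<bar> \<le> b \<longrightarrow> cmod (char (distr M borel (X n)) \<theta> - char (distr M borel Y) \<theta>) \<le> e"
proof -
  have Y[measurable]: "Y \<in> borel_measurable M" using lim by (simp add: tendsto_in_prob_def)
  \<comment> \<open>The Lipschitz part then costs at most e/2, and an event of probability below e/4
    costs another e/2. Using b + 1 avoids division by 0.\<close>
  define \<delta> where "\<delta> = e / (2 * (b + 1))"
  have \<delta>: "0 < \<delta>" "b * \<delta> \<le> e / 2" using e b by (auto simp: \<delta>_def field_simps)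
  define A where "A n = {\<omega> \<in> space M. \<bar>X n \<omega> - Y \<omega>\<bar> > \<delta>}" for n
  have [measurable]: "A n \<in> sets M" for n unfolding A_def by measurable
  have ind: "integrable M (indicat_real (A n))" for n
    by (rule integrable_real_indicator) (auto simp: emeasure_eq_measure)
  have "(\<lambda>n. measure M (A n)) \<longlonglongrightarrow> 0" using lim \<delta>(1) by (simp add: tendsto_in_prob_def A_def)
  then have "\<forall>\<^sub>F n in sequentially. measure M (A n) < e / 4" by (rule order_tendstoD) (use e in simp)
  then show ?thesis
  proof eventually_elim
    fix n assume n: "measure M (A n) < e / 4"
    show "\<forall>\<theta>. \<bar>\<theta>\<bar> \<le> b \<longrightarrow> cmod (char (distr M borel (X n)) \<theta> - char (distr M borel Y) \<theta>) \<le> e"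
    proof (intro allI impI)
      fix \<theta> assume \<theta>: "\<bar>\<theta>\<bar> \<le> b"
      have "char (distr M borel (X n)) \<theta> - char (distr M borel Y) \<theta> = (CLINT \<omega>|M. iexp (\<theta> * X n \<omega>) - iexp (\<theta> * Y \<omega>))"
        by (simp add: char_def integral_distr integrable_iexp)
      also have "cmod \<dots> \<le> (\<integral>\<omega>. b * \<delta> + 2 * indicator (A n) \<omega> \<partial>M)"
      proof (rule norm_integral_le)
        fix \<omega> assume \<omega>: "\<omega> \<in> space M"
        show "cmod (iexp (\<theta> * X n \<omega>) - iexp (\<theta> * Y \<omega>)) \<le> b * \<delta> + 2 * indicator (A n) \<omega>"
        proof (cases "\<omega> \<in> A n")
          case True
          have "cmod (iexp (\<theta> * X n \<omega>) - iexp (\<theta> * Y \<omega>)) \<le> cmod (iexp (\<theta> * X n \<omega>)) + cmod (iexp (\<theta> * Y \<omega>))"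
            by (rule norm_triangle_ineq4)
          then show ?thesis using True b \<delta>(1) by (simp add: add_increasing)
        next
          case False
          have "cmod (iexp (\<theta> * X n \<omega>) - iexp (\<theta> * Y \<omega>)) \<le> \<bar>\<theta>\<bar> * \<bar>X n \<omega> - Y \<omega>\<bar>"
            using cmod_iexp_diff_le[of "\<theta> * X n \<omega>" "\<theta> * Y \<omega>"] by (simp add: right_diff_distrib[symmetric] abs_mult)
          also have "\<dots> \<le> b * \<delta>" using False \<omega> \<theta> b by (intro mult_mono) (auto simp: A_def)
          finally show ?thesis using False by simp
        qed
      qed (auto intro!: integrable_iexp Bochner_Integration.integrable_diff Bochner_Integration.integrable_add integrable_mult_right ind)
      also have "\<dots> = b * \<delta> + 2 * measure M (A n)" using ind[of n] by (simp add: prob_space)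
      also have "\<dots> \<le> e" using \<delta>(2) n by simp
      finally show "cmod (char (distr M borel (X n)) \<theta> - char (distr M borel Y) \<theta>) \<le> e" .
    qed
  qed
qed

lemma (in prob_space) tendsto_in_prob_char:
  assumes "\<And>n. X n \<in> borel_measurable M" "tendsto_in_prob M X Y"
  shows "(\<lambda>n. char (distr M borel (X n)) \<theta>) \<longlonglongrightarrow> char (distr M borel Y) \<theta>"
proof (rule tendstoI)
  fix e :: real assume "0 < e"
  then have "\<forall>\<^sub>F n in sequentially. \<forall>t. \<bar>t\<bar> \<le> \<bar>\<theta>\<bar> \<longrightarrow> cmod (char (distr M borel (X n)) t - char (distr M borel Y) t) \<le> e / 2"
    by (intro tendsto_in_prob_char_uniform assms) auto
  then show "\<forall>\<^sub>F n in sequentially. dist (char (distr M borel (X n)) \<theta>) (char (distr M borel Y) \<theta>) < e"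
    by eventually_elim (use \<open>0 < e\<close> in \<open>force simp: dist_norm\<close>)
qed

text \<open>By the continuity theorem the laws converge weakly to the point mass at 0. The bounded
  continuous function \<open>min 1 (\<bar>x\<bar> / e)\<close> dominates the indicator of |x| > e
  and vanishes at 0.\<close>

lemma (in prob_space) prob_gt_tendsto_0_of_char:
  assumes X[measurable]: "\<And>n. X n \<in> borel_measurable M"
    and lim: "\<And>\<theta>. (\<lambda>n. char (distr M borel (X n)) \<theta>) \<longlonglongrightarrow> 1" and e: "0 < e"
  shows "(\<lambda>n. measure M {\<omega> \<in> space M. \<bar>X n \<omega>\<bar> > e}) \<longlonglongrightarrow> 0"
proof -
  have R: "real_distribution (distr M borel (X n))" for n by (rule real_distribution_distr) simp
  have R0: "real_distribution (return borel 0)"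
    by (intro real_distribution.intro real_distribution_axioms.intro prob_space_return) auto
  have "weak_conv_m (\<lambda>n. distr M borel (X n)) (return borel 0)"
    using R R0 lim by (intro levy_continuity) (auto simp: char_def integral_return)
  then have "(\<lambda>n. \<integral>x. min 1 (\<bar>x\<bar> / e) \<partial>distr M borel (X n)) \<longlonglongrightarrow> (\<integral>x. min 1 (\<bar>x\<bar> / e) \<partial>return borel (0::real))"
    using e by (intro weak_conv_imp_integral_bdd_continuous_conv[OF R R0, where B=1]) (auto intro!: continuous_intros)
  then have lim': "(\<lambda>n. \<integral>\<omega>. min 1 (\<bar>X n \<omega>\<bar> / e) \<partial>M) \<longlonglongrightarrow> 0"
    by (simp add: integral_distr integral_return)
  have le: "norm (measure M {\<omega> \<in> space M. \<bar>X n \<omega>\<bar> > e}) \<le> (\<integral>\<omega>. min 1 (\<bar>X n \<omega>\<bar> / e) \<partial>M)" for n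
  proof -
    have "measure M {\<omega> \<in> space M. \<bar>X n \<omega>\<bar> > e} = (\<integral>\<omega>. indicator {\<omega> \<in> space M. \<bar>X n \<omega>\<bar> > e} \<omega> \<partial>M)" by simp
    also have "\<dots> \<le> (\<integral>\<omega>. min 1 (\<bar>X n \<omega>\<bar> / e) \<partial>M)"
    proof (rule integral_mono)
      show "integrable M (\<lambda>\<omega>. min 1 (\<bar>X n \<omega>\<bar> / e))"
        using e by (intro integrable_const_bound[of _ 1]) auto
    qed (use e in \<open>auto simp: min_def emeasure_eq_measure intro!: integrable_real_indicator split: split_indicator\<close>)
    finally show ?thesis by simp
  qed
  show ?thesis
    by (rule Lim_null_comparison[OF always_eventually[OF allI[OF le]] lim'])
qed

lemma (in prob_space) AE_tendsto_imp_prob: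
  assumes X[measurable]: "\<And>n. X n \<in> borel_measurable M" and Y[measurable]: "Y \<in> borel_measurable M"
    and lim: "AE \<omega> in M. (\<lambda>n. X n \<omega>) \<longlonglongrightarrow> (Y \<omega> :: real)" and e: "0 < e"
  shows "(\<lambda>n. measure M {\<omega> \<in> space M. \<bar>X n \<omega> - Y \<omega>\<bar> > e}) \<longlonglongrightarrow> 0"
proof -
  have "(\<lambda>n. \<integral>\<omega>. indicator {\<omega> \<in> space M. \<bar>X n \<omega> - Y \<omega>\<bar> > e} \<omega> \<partial>M) \<longlonglongrightarrow> (\<integral>\<omega>. (0::real) \<partial>M)"
  proof (rule integral_dominated_convergence[where w="\<lambda>_. 1" and f="\<lambda>_. 0"
        and s="\<lambda>n. indicator {\<omega> \<in> space M. \<bar>X n \<omega> - Y \<omega>\<bar> > e}"])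
    show "AE \<omega> in M. (\<lambda>n. indicator {\<omega> \<in> space M. \<bar>X n \<omega> - Y \<omega>\<bar> > e} \<omega>) \<longlonglongrightarrow> (0::real)"
      using lim
    proof eventually_elim
      fix \<omega> assume "(\<lambda>n. X n \<omega>) \<longlonglongrightarrow> Y \<omega>"
      then have "\<forall>\<^sub>F n in sequentially. dist (X n \<omega>) (Y \<omega>) < e" using e by (rule tendstoD)
      then have "\<forall>\<^sub>F n in sequentially. indicator {\<omega> \<in> space M. \<bar>X n \<omega> - Y \<omega>\<bar> > e} \<omega> = (0::real)"
        by eventually_elim (auto simp: dist_real_def)
      then show "(\<lambda>n. indicator {\<omega> \<in> space M. \<bar>X n \<omega> - Y \<omega>\<bar> > e} \<omega>) \<longlonglongrightarrow> (0::real)"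
        by (rule tendsto_eventually)
    qed
  qed (auto split: split_indicator)
  then show ?thesis by simp
qed

text \<open>Completeness of convergence in probability: a subsequence with geometrically small
  increments converges almost surely by Borel-Cantelli, and the Cauchy property carries its limit
  over to the full sequence.\<close>

lemma (in prob_space) Cauchy_in_prob_imp_tendsto:
  assumes X[measurable]: "\<And>n. X n \<in> borel_measurable M"
    and cauchy: "\<And>e d. 0 < e \<Longrightarrow> 0 < d \<Longrightarrow> \<exists>N. \<forall>m\<ge>N. \<forall>n\<ge>N. measure M {\<omega> \<in> space M. \<bar>X m \<omega> - X n \<omega>\<bar> > e} < d"
  shows "\<exists>Y. tendsto_in_prob M X Y"
proof -
  define P where "P m n e = measure M {\<omega> \<in> space M. \<bar>X m \<omega> - X n \<omega>\<bar> > e}" for m n and e :: real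
  have "\<exists>f. \<forall>k. (\<forall>m\<ge>f k. \<forall>n\<ge>f k. P m n ((1/2)^k) < (1/2)^k) \<and> f k < f (Suc k)"
  proof (rule dependent_nat_choice)
    show "\<exists>N. \<forall>m\<ge>N. \<forall>n\<ge>N. P m n ((1/2)^0) < (1/2)^0" unfolding P_def by (intro cauchy) auto
    fix N k
    obtain N' where N': "\<forall>m\<ge>N'. \<forall>n\<ge>N'. P m n ((1/2)^Suc k) < (1/2)^Suc k"
      using cauchy[of "(1/2)^Suc k" "(1/2)^Suc k"] unfolding P_def by auto
    then show "\<exists>y. (\<forall>m\<ge>y. \<forall>n\<ge>y. P m n ((1/2)^Suc k) < (1/2)^Suc k) \<and> (N::nat) < y"
      by (intro exI[of _ "max N' (Suc N)"]) auto
  qed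
  then obtain f where f: "\<And>k m n. f k \<le> m \<Longrightarrow> f k \<le> n \<Longrightarrow> P m n ((1/2)^k) < (1/2)^k" "\<And>k. f k < f (Suc k)" by blast
  have f_mono: "strict_mono f" using f(2) by (simp add: strict_mono_Suc_iff)
  define A where "A k = {\<omega> \<in> space M. \<bar>X (f (Suc k)) \<omega> - X (f k) \<omega>\<bar> > (1/2)^k}" for k
  have [measurable]: "A k \<in> sets M" for k unfolding A_def by measurable
  have "measure M (A k) \<le> (1/2)^k" for k
    using f(1)[of k "f (Suc k)" "f k"] f(2)[of k] by (simp add: P_def A_def less_imp_le)
  then have "summable (\<lambda>k. measure M (A k))"
    by (intro summable_comparison_test[OF _ summable_geometric[of "1/2::real"]]) auto
  then have bc: "AE \<omega> in M. \<forall>\<^sub>F k in sequentially. \<omega> \<in> space M - A k"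
    by (intro borel_cantelli_AE1) (auto simp: emeasure_eq_measure)
  have conv: "AE \<omega> in M. convergent (\<lambda>k. X (f k) \<omega>)"
    using bc AE_space
  proof eventually_elim
    fix \<omega> assume "\<forall>\<^sub>F k in sequentially. \<omega> \<in> space M - A k" "\<omega> \<in> space M"
    then have "\<forall>\<^sub>F k in sequentially. norm (X (f (Suc k)) \<omega> - X (f k) \<omega>) \<le> (1/2)^k"
      by (auto elim!: eventually_mono simp: A_def)
    then have "summable (\<lambda>k. X (f (Suc k)) \<omega> - X (f k) \<omega>)"
      by (intro summable_comparison_test_ev[OF _ summable_geometric[of "1/2::real"]]) auto
    then have "convergent (\<lambda>n. \<Sum>k<n. X (f (Suc k)) \<omega> - X (f k) \<omega>)"
      by (simp add: summable_iff_convergent)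
    then have "convergent (\<lambda>n. X (f n) \<omega> - X (f 0) \<omega>)"
      by (simp only: sum_lessThan_telescope[of "\<lambda>k. X (f k) \<omega>"])
    from convergent_add[OF this convergent_const[of "X (f 0) \<omega>"]]
    show "convergent (\<lambda>k. X (f k) \<omega>)" by simp
  qed
  define Y where "Y \<omega> = lim (\<lambda>k. X (f k) \<omega>)" for \<omega>
  have [measurable]: "Y \<in> borel_measurable M" unfolding Y_def by measurable
  have limY: "AE \<omega> in M. (\<lambda>k. X (f k) \<omega>) \<longlonglongrightarrow> Y \<omega>"
    using conv by eventually_elim (simp add: Y_def convergent_LIMSEQ_iff)
  have "tendsto_in_prob M X Y"
    unfolding tendsto_in_prob_def
  proof (intro conjI allI impI)
    fix e :: real assume e: "0 < e"
    show "(\<lambda>n. measure M {\<omega> \<in> space M. \<bar>X n \<omega> - Y \<omega>\<bar> > e}) \<longlonglongrightarrow> 0"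
    proof (rule LIMSEQ_I)
      fix d :: real assume d: "0 < d"
      obtain N where N: "\<And>m n. N \<le> m \<Longrightarrow> N \<le> n \<Longrightarrow> P m n (e/2) < d/2"
        using cauchy[of "e/2" "d/2"] e d unfolding P_def by auto
      have "(\<lambda>k. measure M {\<omega> \<in> space M. \<bar>X (f k) \<omega> - Y \<omega>\<bar> > e/2}) \<longlonglongrightarrow> 0"
        using limY e by (intro AE_tendsto_imp_prob) auto
      then have "\<forall>\<^sub>F k in sequentially. measure M {\<omega> \<in> space M. \<bar>X (f k) \<omega> - Y \<omega>\<bar> > e/2} < d/2 \<and> N \<le> k"
        using d by (intro eventually_conj order_tendstoD(2) eventually_ge_at_top) auto
      then obtain k where k: "measure M {\<omega> \<in> space M. \<bar>X (f k) \<omega> - Y \<omega>\<bar> > e/2} < d/2" "N \<le> k"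
        by (auto simp: eventually_sequentially)
      have "N \<le> f k" using k(2) strict_mono_imp_increasing[OF f_mono, of k] by simp
      have "measure M {\<omega> \<in> space M. \<bar>X n \<omega> - Y \<omega>\<bar> > e} < d" if "N \<le> n" for n
      proof -
        have "measure M {\<omega> \<in> space M. \<bar>X n \<omega> - Y \<omega>\<bar> > e}
          \<le> measure M ({\<omega> \<in> space M. \<bar>X n \<omega> - X (f k) \<omega>\<bar> > e/2} \<union> {\<omega> \<in> space M. \<bar>X (f k) \<omega> - Y \<omega>\<bar> > e/2})"
        proof (intro finite_measure_mono subsetI)
          fix \<omega> assume "\<omega> \<in> {\<omega> \<in> space M. \<bar>X n \<omega> - Y \<omega>\<bar> > e}"
          then have \<omega>: "\<omega> \<in> space M" "e < \<bar>X n \<omega> - Y \<omega>\<bar>" by auto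
          then have "e/2 < \<bar>X n \<omega> - X (f k) \<omega>\<bar> \<or> e/2 < \<bar>X (f k) \<omega> - Y \<omega>\<bar>"
            using abs_triangle_ineq[of "X n \<omega> - X (f k) \<omega>" "X (f k) \<omega> - Y \<omega>"]
            by (simp only: diff_add_eq diff_add_cancel) linarith
          with \<omega>(1) show "\<omega> \<in> {\<omega> \<in> space M. \<bar>X n \<omega> - X (f k) \<omega>\<bar> > e/2} \<union> {\<omega> \<in> space M. \<bar>X (f k) \<omega> - Y \<omega>\<bar> > e/2}"
            by blast
        qed auto
        also have "\<dots> \<le> P n (f k) (e/2) + measure M {\<omega> \<in> space M. \<bar>X (f k) \<omega> - Y \<omega>\<bar> > e/2}"
          unfolding P_def by (intro measure_Un_le) auto
        also have "\<dots> < d" using N[OF that \<open>N \<le> f k\<close>] k by simp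
        finally show ?thesis .
      qed
      then show "\<exists>N. \<forall>n\<ge>N. norm (measure M {\<omega> \<in> space M. \<bar>X n \<omega> - Y \<omega>\<bar> > e} - 0) < d" by auto
    qed
  qed simp
  then show ?thesis by blast
qed

section \<open>Independently scattered random measures\<close>

locale delta_ring_on =
  fixes S :: "'s set" and R :: "'s set set"
  assumes delta: "delta_ring S R"
begin

sublocale ring_of_sets S R
  using delta by (simp add: delta_ring_def)

lemma delta_INT: "(\<And>n::nat. A n \<in> R) \<Longrightarrow> (\<Inter>n. A n) \<in> R"
  using delta by (auto simp: delta_ring_def image_subset_iff)

text \<open>A \<delta>-ring is an ideal in the \<sigma>-algebra it generates, since inside a member
  B a countable union is a complement of a countable intersection. This makes
  \<open>L (A \<inter> A\<^sub>j)\<close> meaningful in the simple integrals.\<close>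

lemma sigma_sets_Int:
  assumes "A \<in> sigma_sets S R" "B \<in> R"
  shows "A \<inter> B \<in> R"
  using assms(1)
proof (induction rule: sigma_sets.induct)
  case (Basic a)
  then show ?case using assms(2) by auto
next
  case Empty
  then show ?case by auto
next
  case (Compl a)
  have "(S - a) \<inter> B = B - (a \<inter> B)" using sets_into_space[OF assms(2)] by auto
  then show ?case using Compl assms(2) by (simp add: Diff)
next
  case (Union a)
  have "(\<Union>i. a i) \<inter> B = B - (\<Inter>i. B - (a i \<inter> B))" by auto
  also have "\<dots> \<in> R" using Union assms(2) by (intro Diff delta_INT)
  finally show ?case .
qed

end

locale scattered = prob_space P + delta_ring_on S R for P :: "'w measure" and S :: "'s set" and R :: "'s set set" +
  fixes L :: "'s set \<Rightarrow> 'w \<Rightarrow> real"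
  assumes scattered: "indep_scattered P R L"
begin

lemma measurable_L: "A \<in> R \<Longrightarrow> L A \<in> borel_measurable P"
  using scattered by (simp add: indep_scattered_def)

text \<open>Independent scattering speaks of infinite sequences; a finite family is padded with
  empty sets to become one.\<close>

lemma ex_disjoint_enumeration:
  assumes "finite I" "disjoint_family_on C I" "\<And>i. i \<in> I \<Longrightarrow> C i \<in> R"
  obtains h :: "nat \<Rightarrow> 'i" and A :: "nat \<Rightarrow> 's set" where "bij_betw h {..<card I} I"
    "\<And>n. n < card I \<Longrightarrow> A n = C (h n)" "\<And>n. card I \<le> n \<Longrightarrow> A n = {}"
    "range A \<subseteq> R" "disjoint_family A" "(\<Union>n. A n) = (\<Union>i\<in>I. C i)"
proof -
  obtain h where "bij_betw h {0..<card I} I" using ex_bij_betw_nat_finite[OF assms(1)] by blast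
  then have h: "bij_betw h {..<card I} I" by (simp add: atLeast0LessThan)
  have hI: "h n \<in> I" if "n < card I" for n using h that by (auto simp: bij_betw_def)
  define A where "A n = (if n < card I then C (h n) else {})" for n
  show ?thesis
  proof (rule that[OF h, of A])
    show "range A \<subseteq> R" using hI assms(3) by (auto simp: A_def)
    show "disjoint_family A"
      unfolding disjoint_family_on_def
    proof (intro ballI impI)
      fix m n :: nat assume mn: "m \<noteq> n"
      show "A m \<inter> A n = {}"
      proof (cases "m < card I \<and> n < card I")
        case True
        then have "h m \<noteq> h n" using mn h by (auto simp: bij_betw_def inj_on_def)
        then have "C (h m) \<inter> C (h n) = {}"
          using True by (intro disjoint_family_onD[OF assms(2)] hI) auto
        then show ?thesis using True by (simp add: A_def)
      qed (auto simp: A_def)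
    qed
    have "(\<Union>n. A n) = (\<Union>n\<in>{..<card I}. C (h n))" by (auto simp: A_def split: if_splits)
    also have "\<dots> = (\<Union>i\<in>h ` {..<card I}. C i)" by simp
    also have "h ` {..<card I} = I" using h by (simp add: bij_betw_def)
    finally show "(\<Union>n. A n) = (\<Union>i\<in>I. C i)" .
  qed (auto simp: A_def)
qed

text \<open>The constant sequence of empty sets is disjoint, so the constant series of its values
  converges, which forces the value 0.\<close>

lemma empty_AE: "AE \<omega> in P. L {} \<omega> = 0"
proof -
  have "AE \<omega> in P. (\<lambda>n::nat. L {} \<omega>) sums L (\<Union>n::nat. {}) \<omega>"
    using scattered unfolding indep_scattered_def by (auto simp: disjoint_family_on_def)
  then show ?thesis
  proof eventually_elim
    fix \<omega> assume "(\<lambda>n::nat. L {} \<omega>) sums L (\<Union>n::nat. {}) \<omega>"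
    then have "(\<lambda>n::nat. L {} \<omega>) \<longlonglongrightarrow> 0" by (intro summable_LIMSEQ_zero sums_summable)
    then show "L {} \<omega> = 0" by (simp add: LIMSEQ_const_iff)
  qed
qed

lemma finite_additive_AE:
  assumes "finite I" "disjoint_family_on C I" "\<And>i. i \<in> I \<Longrightarrow> C i \<in> R"
  shows "AE \<omega> in P. L (\<Union>i\<in>I. C i) \<omega> = (\<Sum>i\<in>I. L (C i) \<omega>)"
proof -
  obtain h A where h: "bij_betw h {..<card I} I"
    and A: "\<And>n. n < card I \<Longrightarrow> A n = C (h n)" "\<And>n. card I \<le> n \<Longrightarrow> A n = {}"
    "range A \<subseteq> R" "disjoint_family A" "(\<Union>n. A n) = (\<Union>i\<in>I. C i)"
    using ex_disjoint_enumeration[of I C] assms by blast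
  have "(\<Union>n. A n) \<in> R" unfolding A(5) using assms by (intro finite_UN)
  then have "AE \<omega> in P. (\<lambda>n. L (A n) \<omega>) sums L (\<Union>n. A n) \<omega>"
    using scattered A(3,4) unfolding indep_scattered_def by blast
  then show ?thesis using empty_AE
  proof eventually_elim
    fix \<omega> assume *: "(\<lambda>n. L (A n) \<omega>) sums L (\<Union>n. A n) \<omega>" and 0: "L {} \<omega> = 0"
    have "(\<lambda>n. L (A n) \<omega>) sums (\<Sum>n<card I. L (A n) \<omega>)"
      by (rule sums_finite) (auto simp: A(2) 0)
    then have "L (\<Union>n. A n) \<omega> = (\<Sum>n<card I. L (A n) \<omega>)" using * sums_unique2 by blast
    also have "\<dots> = (\<Sum>n<card I. L (C (h n)) \<omega>)" by (simp add: A(1))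
    also have "\<dots> = (\<Sum>i\<in>I. L (C i) \<omega>)" by (rule sum.reindex_bij_betw[OF h])
    finally show "L (\<Union>i\<in>I. C i) \<omega> = (\<Sum>i\<in>I. L (C i) \<omega>)" by (simp add: A(5))
  qed
qed

lemma char_sum:
  assumes "finite I" "disjoint_family_on C I" "\<And>i. i \<in> I \<Longrightarrow> C i \<in> R"
  shows "char (distr P borel (\<lambda>\<omega>. \<Sum>i\<in>I. c i * L (C i) \<omega>)) \<theta> = (\<Prod>i\<in>I. char (distr P borel (L (C i))) (\<theta> * c i))"
proof -
  obtain h A where h: "bij_betw h {..<card I} I"
    and A: "\<And>n. n < card I \<Longrightarrow> A n = C (h n)" "\<And>n. card I \<le> n \<Longrightarrow> A n = {}"
    "range A \<subseteq> R" "disjoint_family A" "(\<Union>n. A n) = (\<Union>i\<in>I. C i)"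
    using ex_disjoint_enumeration[of I C] assms by blast
  have [measurable]: "\<And>n. L (A n) \<in> borel_measurable P" using A(3) measurable_L by auto
  have "indep_vars (\<lambda>_. borel) (\<lambda>n. L (A n)) UNIV"
    using scattered A(3,4) unfolding indep_scattered_def by blast
  then have "indep_vars (\<lambda>_. borel) (\<lambda>n. L (A n)) {..<card I}"
    by (rule indep_vars_subset) simp
  then have i: "indep_vars (\<lambda>_. borel) (\<lambda>n \<omega>. c (h n) * L (A n) \<omega>) {..<card I}"
    by (rule indep_vars_compose2) simp
  have "(\<Sum>i\<in>I. c i * L (C i) \<omega>) = (\<Sum>n<card I. c (h n) * L (A n) \<omega>)" for \<omega>
    by (subst sum.reindex_bij_betw[OF h, symmetric]) (simp add: A(1))
  then have "char (distr P borel (\<lambda>\<omega>. \<Sum>i\<in>I. c i * L (C i) \<omega>)) \<theta> = (\<Prod>n<card I. char (distr P borel (\<lambda>\<omega>. c (h n) * L (A n) \<omega>)) \<theta>)"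
    using char_distr_sum[OF i] by simp
  also have "\<dots> = (\<Prod>n<card I. char (distr P borel (L (A n))) (\<theta> * c (h n)))"
    by (simp add: char_def integral_distr mult.assoc)
  also have "\<dots> = (\<Prod>n<card I. char (distr P borel (L (C (h n)))) (\<theta> * c (h n)))"
    by (simp add: A(1))
  also have "\<dots> = (\<Prod>i\<in>I. char (distr P borel (L (C i))) (\<theta> * c i))"
    by (rule prod.reindex_bij_betw[OF h])
  finally show ?thesis .
qed

lemma simple_integral_measurable:
  assumes "simple_rep R g" "A \<in> sigma_sets S R"
  shows "simple_integral_on L A g \<in> borel_measurable P"
proof -
  have [measurable]: "L (A \<inter> snd (g ! j)) \<in> borel_measurable P" if "j < length g" for j
    using assms that by (auto intro!: measurable_L sigma_sets_Int simp: simple_rep_def)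
  show ?thesis unfolding simple_integral_on_def[abs_def] by measurable
qed

end

text \<open>The common ground of \<Lambda>, \<Lambda>G and \<Lambda>M: a scattered measure whose
  characteristic functions on R are exponentials of integrals of a density k. No sign condition on
  the jumps is imposed, so the infinitely divisible and the quasi-infinitely divisible case are
  treated together.\<close>

locale exponent_measure = scattered P S R L for P :: "'w measure" and S :: "'s set" and R and L +
  fixes l :: "'s measure" and k :: "real \<Rightarrow> 's \<Rightarrow> complex"
  assumes sets_l: "sets l = sets (sigma S R)" and k_0: "\<And>s. s \<in> S \<Longrightarrow> k 0 s = 0"
    and integrable_k: "\<And>A \<theta>. A \<in> R \<Longrightarrow> integrable l (\<lambda>s. indicator A s *\<^sub>R k \<theta> s)"
    and char_L: "\<And>A \<theta>. A \<in> R \<Longrightarrow> char (distr P borel (L A)) \<theta> = exp (\<integral>s. indicator A s *\<^sub>R k \<theta> s \<partial>l)"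
begin

lemma sets_l_eq: "sets l = sigma_sets S R"
  using sets_l space_closed by (simp add: sets_measure_of)

lemma space_l: "space l = S"
  using sets_eq_imp_space_eq[OF sets_l] space_closed by (simp add: space_measure_of)

text \<open>Although k is nonlinear in its first argument, it passes through the sum: at each point
  at most one summand of h is active, and \<open>k 0 s = 0\<close> covers the points where none
  is.\<close>

lemma char_step:
  assumes I: "finite I" "disjoint_family_on C I" "\<And>i. i \<in> I \<Longrightarrow> C i \<in> R"
    and h: "\<And>s. s \<in> S \<Longrightarrow> h s = (\<Sum>i\<in>I. c i * indicator (C i) s)"
  shows "integrable l (\<lambda>s. k (\<theta> * h s) s)"
    and "char (distr P borel (\<lambda>\<omega>. \<Sum>i\<in>I. c i * L (C i) \<omega>)) \<theta> = exp (\<integral>s. k (\<theta> * h s) s \<partial>l)"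
proof -
  have eq: "k (\<theta> * h s) s = (\<Sum>i\<in>I. indicator (C i) s *\<^sub>R k (\<theta> * c i) s)" if s: "s \<in> space l" for s
  proof (cases "\<exists>i\<in>I. s \<in> C i")
    case True
    then obtain i where i: "i \<in> I" "s \<in> C i" by blast
    have o: "s \<notin> C j" if "j \<in> I" "j \<noteq> i" for j
      using I(2) i that by (auto simp: disjoint_family_on_def)
    have "h s = (\<Sum>j\<in>I. if j = i then c i else 0)"
      using s i o by (subst h) (auto simp: space_l intro!: sum.cong)
    moreover have "(\<Sum>j\<in>I. indicator (C j) s *\<^sub>R k (\<theta> * c j) s) = (\<Sum>j\<in>I. if j = i then k (\<theta> * c i) s else 0)"
      using i o by (intro sum.cong) auto
    ultimately show ?thesis using i I(1) by simp
  next
    case False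
    then have "h s = 0" "(\<Sum>i\<in>I. indicator (C i) s *\<^sub>R k (\<theta> * c i) s) = 0"
      using s by (auto simp: h space_l)
    then show ?thesis using s k_0 by (simp add: space_l)
  qed
  have int: "integrable l (\<lambda>s. \<Sum>i\<in>I. indicator (C i) s *\<^sub>R k (\<theta> * c i) s)"
    by (intro Bochner_Integration.integrable_sum integrable_k I(3))
  show "integrable l (\<lambda>s. k (\<theta> * h s) s)"
    by (rule Bochner_Integration.integrable_cong[OF refl eq, THEN iffD2, OF _ int])
  have "char (distr P borel (\<lambda>\<omega>. \<Sum>i\<in>I. c i * L (C i) \<omega>)) \<theta> = (\<Prod>i\<in>I. char (distr P borel (L (C i))) (\<theta> * c i))"
    by (rule char_sum[OF I])
  also have "\<dots> = (\<Prod>i\<in>I. exp (\<integral>s. indicator (C i) s *\<^sub>R k (\<theta> * c i) s \<partial>l))"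
    using I(3) by (intro prod.cong refl char_L)
  also have "\<dots> = exp (\<Sum>i\<in>I. \<integral>s. indicator (C i) s *\<^sub>R k (\<theta> * c i) s \<partial>l)"
    using I(1) by (simp add: exp_sum)
  also have "(\<Sum>i\<in>I. \<integral>s. indicator (C i) s *\<^sub>R k (\<theta> * c i) s \<partial>l) = (\<integral>s. (\<Sum>i\<in>I. indicator (C i) s *\<^sub>R k (\<theta> * c i) s) \<partial>l)"
    by (intro Bochner_Integration.integral_sum[symmetric] integrable_k I(3))
  also have "\<dots> = (\<integral>s. k (\<theta> * h s) s \<partial>l)"
    by (intro Bochner_Integration.integral_cong refl eq[symmetric])
  finally show "char (distr P borel (\<lambda>\<omega>. \<Sum>i\<in>I. c i * L (C i) \<omega>)) \<theta> = exp (\<integral>s. k (\<theta> * h s) s \<partial>l)" .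
qed

lemma k_indicator: "s \<in> S \<Longrightarrow> k (\<theta> * (indicator A s * v)) s = indicator A s *\<^sub>R k (\<theta> * v) s"
  using k_0 by (auto split: split_indicator)

lemma char_simple_integral:
  assumes g: "simple_rep R g" and A: "A \<in> sigma_sets S R"
  shows "integrable l (\<lambda>s. indicator A s *\<^sub>R k (\<theta> * simple_value g s) s)"
    and "char (distr P borel (simple_integral_on L A g)) \<theta> = exp (\<integral>s. indicator A s *\<^sub>R k (\<theta> * simple_value g s) s \<partial>l)"
proof -
  have C: "disjoint_family_on (\<lambda>j. A \<inter> snd (g ! j)) {..<length g}"
    "\<And>j. j \<in> {..<length g} \<Longrightarrow> A \<inter> snd (g ! j) \<in> R"
    using g A sigma_sets_Int by (auto simp: simple_rep_def disjoint_family_on_def) (metis IntI empty_iff lessThan_iff)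
  have h: "indicator A s * simple_value g s = (\<Sum>j<length g. fst (g ! j) * indicator (A \<inter> snd (g ! j)) s)" for s
    unfolding simple_value_def sum_distrib_left indicator_inter_arith by (simp only: mult_ac)
  have *: "integrable l (\<lambda>s. k (\<theta> * (indicator A s * simple_value g s)) s)"
    "char (distr P borel (\<lambda>\<omega>. \<Sum>j<length g. fst (g ! j) * L (A \<inter> snd (g ! j)) \<omega>)) \<theta>
      = exp (\<integral>s. k (\<theta> * (indicator A s * simple_value g s)) s \<partial>l)"
    using C(2) by (auto intro!: char_step[OF finite_lessThan C(1) _ h])
  have eq: "k (\<theta> * (indicator A s * simple_value g s)) s = indicator A s *\<^sub>R k (\<theta> * simple_value g s) s" if "s \<in> space l" for s
    using that by (simp add: space_l k_indicator)
  show "integrable l (\<lambda>s. indicator A s *\<^sub>R k (\<theta> * simple_value g s) s)"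
    by (rule Bochner_Integration.integrable_cong[OF refl eq, THEN iffD1, OF _ *(1)])
  have "(\<integral>s. k (\<theta> * (indicator A s * simple_value g s)) s \<partial>l) = (\<integral>s. indicator A s *\<^sub>R k (\<theta> * simple_value g s) s \<partial>l)"
    by (intro Bochner_Integration.integral_cong refl eq)
  then show "char (distr P borel (simple_integral_on L A g)) \<theta> = exp (\<integral>s. indicator A s *\<^sub>R k (\<theta> * simple_value g s) s \<partial>l)"
    using *(2) by (simp add: simple_integral_on_def[abs_def])
qed

text \<open>Both functions are written over the common partition that arises when each
  representation is padded by the part of the other support it misses.\<close>

lemma char_simple_integral_diff:
  assumes g: "simple_rep R g" and g': "simple_rep R g'" and A: "A \<in> sigma_sets S R"
  shows "char (distr P borel (\<lambda>\<omega>. simple_integral_on L A g \<omega> - simple_integral_on L A g' \<omega>)) \<theta>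
    = exp (\<integral>s. indicator A s *\<^sub>R k (\<theta> * (simple_value g s - simple_value g' s)) s \<partial>l)"
proof -
  define n m where "n = length g" and "m = length g'"
  define U U' where "U = (\<Union>j<n. snd (g ! j))" and "U' = (\<Union>i<m. snd (g' ! i))"
  define a where "a j = (if j < n then snd (g ! j) else U' - U)" for j
  define b where "b i = (if i < m then snd (g' ! i) else U - U')" for i
  define x where "x j = (if j < n then fst (g ! j) else 0)" for j
  define y where "y i = (if i < m then fst (g' ! i) else 0)" for i
  have UR: "U \<in> R" "U' \<in> R" using g g' by (auto simp: U_def U'_def n_def m_def simple_rep_def)
  have aR: "a j \<in> R" for j using g UR by (auto simp: a_def n_def simple_rep_def)
  have bR: "b j \<in> R" for j using g' UR by (auto simp: b_def m_def simple_rep_def)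
  have ad: "a i \<inter> a j = {}" if ij: "i \<noteq> j" "i \<le> n" "j \<le> n" for i j
  proof -
    have dis: "snd (g ! i) \<inter> snd (g ! j) = {}" if "i < n" "j < n"
      using g g' that \<open>i \<noteq> j\<close> unfolding simple_rep_def n_def m_def by (intro disjoint_family_onD) auto
    have sub: "snd (g ! i) \<subseteq> U" if "i < n" for i using that by (auto simp: U_def U'_def)
    consider "i < n" "j < n" | "i < n" "\<not> j < n" | "\<not> i < n" "j < n" using ij by linarith
    then show ?thesis
    proof cases
      case 1
      then show ?thesis using dis by (simp add: a_def)
    next
      case 2
      then show ?thesis using sub[of i] by (simp add: a_def) blast
    next
      case 3
      then show ?thesis using sub[of j] by (simp add: a_def) blast
    qed
  qed
  have bd: "b i \<inter> b j = {}" if ij: "i \<noteq> j" "i \<le> m" "j \<le> m" for i j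
  proof -
    have dis: "snd (g' ! i) \<inter> snd (g' ! j) = {}" if "i < m" "j < m"
      using g g' that \<open>i \<noteq> j\<close> unfolding simple_rep_def n_def m_def by (intro disjoint_family_onD) auto
    have sub: "snd (g' ! i) \<subseteq> U'" if "i < m" for i using that by (auto simp: U_def U'_def)
    consider "i < m" "j < m" | "i < m" "\<not> j < m" | "\<not> i < m" "j < m" using ij by linarith
    then show ?thesis
    proof cases
      case 1
      then show ?thesis using dis by (simp add: b_def)
    next
      case 2
      then show ?thesis using sub[of i] by (simp add: b_def) blast
    next
      case 3
      then show ?thesis using sub[of j] by (simp add: b_def) blast
    qed
  qed
  have Ua: "(\<Union>j\<le>n. a j) = U \<union> U'" unfolding a_def U_def by (auto split: if_splits)
  have Ub: "(\<Union>i\<le>m. b i) = U \<union> U'" unfolding b_def U'_def by (auto split: if_splits)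
  have sub: "a j \<subseteq> U \<union> U'" "b i \<subseteq> U \<union> U'" if "j \<le> n" "i \<le> m" for i j using Ua Ub that by blast+
  define C where "C ji = A \<inter> (a (fst ji) \<inter> b (snd ji))" for ji
  define c where "c ji = x (fst ji) - y (snd ji)" for ji
  define I where "I = {..n} \<times> {..m}"
  have I: "finite I" by (simp add: I_def)
  have CR: "C ji \<in> R" for ji unfolding C_def using aR bR A by (intro sigma_sets_Int Int)
  have Cd: "disjoint_family_on C I"
    unfolding disjoint_family_on_def
  proof (intro ballI impI)
    fix p q assume pq: "p \<in> I" "q \<in> I" "p \<noteq> q"
    then have "fst p \<noteq> fst q \<or> snd p \<noteq> snd q" by (auto simp: prod_eq_iff)
    then show "C p \<inter> C q = {}"
      using ad[of "fst p" "fst q"] bd[of "snd p" "snd q"] pq unfolding C_def I_def by auto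
  qed
  have suma: "(\<Sum>j<n. fst (g ! j) * f (snd (g ! j))) = (\<Sum>j\<le>n. x j * f (a j))" for f :: "'s set \<Rightarrow> real"
    unfolding lessThan_Suc_atMost[symmetric] by (simp add: x_def a_def)
  have sumb: "(\<Sum>i<m. fst (g' ! i) * f (snd (g' ! i))) = (\<Sum>i\<le>m. y i * f (b i))" for f :: "'s set \<Rightarrow> real"
    unfolding lessThan_Suc_atMost[symmetric] by (simp add: y_def b_def)
  have h: "indicator A s * (simple_value g s - simple_value g' s) = (\<Sum>ji\<in>I. c ji * indicator (C ji) s)" for s
  proof -
    have ia: "indicator (a j) s = (\<Sum>i\<le>m. indicator (a j \<inter> b i) s :: real)" if "j \<le> n" for j
    proof -
      have "(\<Sum>i\<le>m. indicator (a j \<inter> b i) s :: real) = indicator (\<Union>i\<le>m. a j \<inter> b i) s"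
        using bd by (intro indicator_UN_disjoint[symmetric]) (auto simp: disjoint_family_on_def)
      also have "(\<Union>i\<le>m. a j \<inter> b i) = a j" using Ub sub(1)[OF that] by blast
      finally show ?thesis by simp
    qed
    have ib: "indicator (b i) s = (\<Sum>j\<le>n. indicator (a j \<inter> b i) s :: real)" if "i \<le> m" for i
    proof -
      have "(\<Sum>j\<le>n. indicator (a j \<inter> b i) s :: real) = indicator (\<Union>j\<le>n. a j \<inter> b i) s"
        using ad by (intro indicator_UN_disjoint[symmetric]) (auto simp: disjoint_family_on_def)
      also have "(\<Union>j\<le>n. a j \<inter> b i) = b i" using Ua sub(2)[OF _ that] by blast
      finally show ?thesis by simp
    qed
    have "simple_value g s = (\<Sum>j\<le>n. \<Sum>i\<le>m. x j * indicator (a j \<inter> b i) s)"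
      unfolding simple_value_def n_def[symmetric] suma[of "\<lambda>B. indicator B s"]
      by (intro sum.cong refl) (simp add: ia sum_distrib_left)
    moreover have "simple_value g' s = (\<Sum>i\<le>m. \<Sum>j\<le>n. y i * indicator (a j \<inter> b i) s)"
      unfolding simple_value_def m_def[symmetric] sumb[of "\<lambda>B. indicator B s"]
      by (intro sum.cong refl) (simp add: ib sum_distrib_left)
    moreover have "\<dots> = (\<Sum>j\<le>n. \<Sum>i\<le>m. y i * indicator (a j \<inter> b i) s)" by (rule sum.swap)
    ultimately have eq: "simple_value g s - simple_value g' s = (\<Sum>j\<le>n. \<Sum>i\<le>m. (x j - y i) * indicator (a j \<inter> b i) s)"
      by (simp add: sum_subtractf left_diff_distrib)
    show ?thesis
      unfolding eq I_def sum.cartesian_product' c_def C_def fst_conv snd_conv sum_distrib_left indicator_inter_arith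
      by (simp only: mult_ac)
  qed
  \<comment> \<open>Additivity of L over the partition holds only almost surely; there are finitely
    many cells, so the exceptional sets can be united.\<close>
  have "AE \<omega> in P. \<forall>j\<in>{..n}. L (A \<inter> a j) \<omega> = (\<Sum>i\<le>m. L (C (j, i)) \<omega>)"
  proof (rule AE_finite_allI)
    fix j assume j: "j \<in> {..n}"
    have "AE \<omega> in P. L (\<Union>i\<in>{..m}. C (j, i)) \<omega> = (\<Sum>i\<le>m. L (C (j, i)) \<omega>)"
      using CR bd unfolding disjoint_family_on_def C_def by (intro finite_additive_AE) (auto simp: disjoint_family_on_def, blast)
    moreover have "(\<Union>i\<in>{..m}. C (j, i)) = A \<inter> a j" using Ub sub(1)[of j] j unfolding C_def by fastforce
    ultimately show "AE \<omega> in P. L (A \<inter> a j) \<omega> = (\<Sum>i\<le>m. L (C (j, i)) \<omega>)" by simp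
  qed simp
  moreover have "AE \<omega> in P. \<forall>i\<in>{..m}. L (A \<inter> b i) \<omega> = (\<Sum>j\<le>n. L (C (j, i)) \<omega>)"
  proof (rule AE_finite_allI)
    fix i assume i: "i \<in> {..m}"
    have "AE \<omega> in P. L (\<Union>j\<in>{..n}. C (j, i)) \<omega> = (\<Sum>j\<le>n. L (C (j, i)) \<omega>)"
      using CR ad unfolding disjoint_family_on_def C_def by (intro finite_additive_AE) (auto simp: disjoint_family_on_def, blast)
    moreover have "(\<Union>j\<in>{..n}. C (j, i)) = A \<inter> b i" using Ua sub(2)[of 0 i] i unfolding C_def by fastforce
    ultimately show "AE \<omega> in P. L (A \<inter> b i) \<omega> = (\<Sum>j\<le>n. L (C (j, i)) \<omega>)" by simp
  qed simp
  ultimately have AE: "AE \<omega> in P. simple_integral_on L A g \<omega> - simple_integral_on L A g' \<omega> = (\<Sum>ji\<in>I. c ji * L (C ji) \<omega>)"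
  proof eventually_elim
    fix \<omega> assume 1: "\<forall>j\<in>{..n}. L (A \<inter> a j) \<omega> = (\<Sum>i\<le>m. L (C (j, i)) \<omega>)"
      and 2: "\<forall>i\<in>{..m}. L (A \<inter> b i) \<omega> = (\<Sum>j\<le>n. L (C (j, i)) \<omega>)"
    have "simple_integral_on L A g \<omega> = (\<Sum>j\<le>n. \<Sum>i\<le>m. x j * L (C (j, i)) \<omega>)"
      unfolding simple_integral_on_def n_def[symmetric] suma[of "\<lambda>B. L (A \<inter> B) \<omega>"]
      using 1 by (intro sum.cong refl) (simp add: sum_distrib_left)
    moreover have "simple_integral_on L A g' \<omega> = (\<Sum>i\<le>m. \<Sum>j\<le>n. y i * L (C (j, i)) \<omega>)"
      unfolding simple_integral_on_def m_def[symmetric] sumb[of "\<lambda>B. L (A \<inter> B) \<omega>"]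
      using 2 by (intro sum.cong refl) (simp add: sum_distrib_left)
    moreover have "\<dots> = (\<Sum>j\<le>n. \<Sum>i\<le>m. y i * L (C (j, i)) \<omega>)" by (rule sum.swap)
    ultimately show "simple_integral_on L A g \<omega> - simple_integral_on L A g' \<omega> = (\<Sum>ji\<in>I. c ji * L (C ji) \<omega>)"
      by (simp add: I_def sum.cartesian_product' c_def sum_subtractf left_diff_distrib)
  qed
  have [measurable]: "simple_integral_on L A g \<in> borel_measurable P" "simple_integral_on L A g' \<in> borel_measurable P"
    "\<And>ji. L (C ji) \<in> borel_measurable P"
    using simple_integral_measurable[OF g A] simple_integral_measurable[OF g' A] CR measurable_L by auto
  have "char (distr P borel (\<lambda>\<omega>. simple_integral_on L A g \<omega> - simple_integral_on L A g' \<omega>)) \<theta>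
    = (CLINT \<omega>|P. iexp (\<theta> * (simple_integral_on L A g \<omega> - simple_integral_on L A g' \<omega>)))"
    unfolding char_def by (rule integral_distr) auto
  also have "\<dots> = (CLINT \<omega>|P. iexp (\<theta> * (\<Sum>ji\<in>I. c ji * L (C ji) \<omega>)))"
  proof (rule integral_cong_AE)
    show "AE \<omega> in P. iexp (\<theta> * (simple_integral_on L A g \<omega> - simple_integral_on L A g' \<omega>)) = iexp (\<theta> * (\<Sum>ji\<in>I. c ji * L (C ji) \<omega>))"
      using AE by eventually_elim simp
  qed measurable
  also have "\<dots> = char (distr P borel (\<lambda>\<omega>. \<Sum>ji\<in>I. c ji * L (C ji) \<omega>)) \<theta>"
    unfolding char_def by (rule integral_distr[symmetric]) auto
  also have "\<dots> = exp (\<integral>s. k (\<theta> * (indicator A s * (simple_value g s - simple_value g' s))) s \<partial>l)"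
    by (rule char_step(2)[OF I Cd CR h])
  also have "(\<integral>s. k (\<theta> * (indicator A s * (simple_value g s - simple_value g' s))) s \<partial>l)
      = (\<integral>s. indicator A s *\<^sub>R k (\<theta> * (simple_value g s - simple_value g' s)) s \<partial>l)"
    by (intro Bochner_Integration.integral_cong refl k_indicator) (simp add: space_l)
  finally show ?thesis .
qed

end

section \<open>Characteristic exponents\<close>

definition levy_exp :: "('s \<Rightarrow> real) \<Rightarrow> ('s \<Rightarrow> real) \<Rightarrow> ('s \<Rightarrow> real measure) \<Rightarrow> real \<Rightarrow> 's \<Rightarrow> complex" where
  "levy_exp \<alpha> \<beta> K u s = \<i> * of_real (u * \<alpha> s) - of_real (u\<^sup>2 / 2 * \<beta> s) + (\<integral>x. lk u x \<partial>K s)"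

text \<open>The function U of the theorem for a kernel of genuine Levy measures: the location
  parameter after scaling by u.\<close>

definition drift :: "('s \<Rightarrow> real) \<Rightarrow> ('s \<Rightarrow> real measure) \<Rightarrow> real \<Rightarrow> 's \<Rightarrow> real" where
  "drift \<alpha> K u s = u * \<alpha> s + (\<integral>x. \<tau> (x * u) - u * \<tau> x \<partial>K s)"

definition trunc2 :: "('s \<Rightarrow> real measure) \<Rightarrow> real \<Rightarrow> 's \<Rightarrow> real" where
  "trunc2 K u s = (\<integral>x. min 1 ((x * u)\<^sup>2) \<partial>K s)"

text \<open>Its integrability along f is the integrability criterion for an infinitely divisible
  random measure: drift, Gaussian part and truncated second moment. The absolute value of \<beta>
  appears because the densities used later are nonnegative only almost everywhere.\<close>

definition majorant :: "('s \<Rightarrow> real) \<Rightarrow> ('s \<Rightarrow> real) \<Rightarrow> ('s \<Rightarrow> real measure) \<Rightarrow> real \<Rightarrow> 's \<Rightarrow> real" where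
  "majorant \<alpha> \<beta> K u s = \<bar>drift \<alpha> K u s\<bar> + u\<^sup>2 * \<bar>\<beta> s\<bar> + trunc2 K u s"

lemma min_one_square_dilation: "min 1 ((x * u)\<^sup>2) \<le> (1 + u\<^sup>2) * min 1 ((x::real)\<^sup>2)"
  using min_one_mult_le[of "u\<^sup>2" "x\<^sup>2"] by (simp add: power_mult_distrib mult.commute)

lemma trunc2_nonneg: "0 \<le> trunc2 K u s"
  by (simp add: trunc2_def)

lemma levy_exp_0: "levy_exp \<alpha> \<beta> K 0 s = 0"
  by (simp add: levy_exp_def)

lemma majorant_0: "majorant \<alpha> \<beta> K 0 s = 0"
  by (simp add: majorant_def drift_def trunc2_def)

lemma drift_1: "drift \<alpha> K 1 s = \<alpha> s"
  by (simp add: drift_def)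

section \<open>Bounds and continuity of the exponent at a fixed point s\<close>

context
  fixes K :: "'s \<Rightarrow> real measure" and s :: 's
  assumes M: "levy_measure (K s)"
begin

lemma integrable_lk: "integrable (K s) (\<lambda>x. lk u x)"
  by (rule levy_measure_integrable[OF M _ norm_lk_le]) measurable

lemma integrable_min: "integrable (K s) (\<lambda>x. min 1 ((x * u)\<^sup>2))"
  by (rule levy_measure_integrable[OF M, where C="1 + u\<^sup>2"]) (use min_one_square_dilation in auto)

lemma integrable_tau: "integrable (K s) (\<lambda>x. \<tau> (x * u) - u * \<tau> x)"
  by (rule levy_measure_integrable[OF M, where C="(1 + \<bar>u\<bar>) * (1 + u\<^sup>2)"]) (use tau_dilation_le in auto)

lemma lk_dilated_le: "cmod (lk \<theta> (x * u)) \<le> (2 + \<bar>\<theta>\<bar> + \<theta>\<^sup>2) * (1 + u\<^sup>2) * min 1 (x\<^sup>2)"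
  unfolding mult.assoc using norm_lk_le[of \<theta> "x * u"]
  by (rule order_trans) (intro mult_left_mono min_one_square_dilation, simp)

lemma integrable_lk_dilated: "integrable (K s) (\<lambda>x. lk \<theta> (x * u))"
  by (rule levy_measure_integrable[OF M _ lk_dilated_le]) measurable

lemma norm_integral_lk_le: "cmod (\<integral>x. lk \<theta> (x * u) \<partial>K s) \<le> (2 + \<bar>\<theta>\<bar> + \<theta>\<^sup>2) * trunc2 K u s"
proof -
  have "cmod (\<integral>x. lk \<theta> (x * u) \<partial>K s) \<le> (\<integral>x. (2 + \<bar>\<theta>\<bar> + \<theta>\<^sup>2) * min 1 ((x * u)\<^sup>2) \<partial>K s)"
    using integrable_min by (intro norm_integral_le integrable_lk_dilated norm_lk_le) simp
  then show ?thesis using integrable_min by (simp add: trunc2_def)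
qed

text \<open>As a function of \<theta>, the exponent at \<theta> u is that of the variable scaled by
  u, with all compensation collected in \<open>drift\<close>. Written this way, the size of u enters
  only through the three terms of \<open>majorant\<close>.\<close>

lemma levy_exp_mult:
  "levy_exp \<alpha> \<beta> K (\<theta> * u) s = \<i> * of_real (\<theta> * drift \<alpha> K u s) - of_real (\<theta>\<^sup>2 / 2 * (u\<^sup>2 * \<beta> s)) + (\<integral>x. lk \<theta> (x * u) \<partial>K s)"
proof -
  have "(\<integral>x. lk (\<theta> * u) x \<partial>K s) = (\<integral>x. lk \<theta> (x * u) + \<i> * of_real \<theta> * of_real (\<tau> (x * u) - u * \<tau> x) \<partial>K s)"
    by (simp add: lk_dilation)
  also have "\<dots> = (\<integral>x. lk \<theta> (x * u) \<partial>K s) + (\<integral>x. \<i> * of_real \<theta> * of_real (\<tau> (x * u) - u * \<tau> x) \<partial>K s)"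
    using integrable_tau integrable_lk_dilated
    by (intro Bochner_Integration.integral_add integrable_mult_right integrable_of_real)
  also have "(\<integral>x. \<i> * of_real \<theta> * of_real (\<tau> (x * u) - u * \<tau> x) \<partial>K s) = \<i> * of_real \<theta> * of_real (\<integral>x. \<tau> (x * u) - u * \<tau> x \<partial>K s)"
    by (simp only: integral_mult_right_zero integral_complex_of_real)
  finally show ?thesis
    by (simp add: levy_exp_def drift_def power_mult_distrib algebra_simps)
qed

lemma levy_exp_le: "cmod (levy_exp \<alpha> \<beta> K (\<theta> * u) s) \<le> (2 + \<bar>\<theta>\<bar> + \<theta>\<^sup>2) * majorant \<alpha> \<beta> K u s"
proof -
  have "cmod (levy_exp \<alpha> \<beta> K (\<theta> * u) s) \<le> cmod (\<i> * of_real (\<theta> * drift \<alpha> K u s)) + cmod (of_real (\<theta>\<^sup>2 / 2 * (u\<^sup>2 * \<beta> s)))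
      + cmod (\<integral>x. lk \<theta> (x * u) \<partial>K s)"
    unfolding levy_exp_mult by (intro order_trans[OF norm_triangle_ineq] add_right_mono norm_triangle_ineq4)
  also have "\<dots> \<le> \<bar>\<theta>\<bar> * \<bar>drift \<alpha> K u s\<bar> + \<theta>\<^sup>2 / 2 * (u\<^sup>2 * \<bar>\<beta> s\<bar>) + (2 + \<bar>\<theta>\<bar> + \<theta>\<^sup>2) * trunc2 K u s"
    by (intro add_mono norm_integral_lk_le) (simp_all add: norm_mult abs_mult del: of_real_mult)
  also have "\<dots> \<le> (2 + \<bar>\<theta>\<bar> + \<theta>\<^sup>2) * \<bar>drift \<alpha> K u s\<bar> + (2 + \<bar>\<theta>\<bar> + \<theta>\<^sup>2) * (u\<^sup>2 * \<bar>\<beta> s\<bar>) + (2 + \<bar>\<theta>\<bar> + \<theta>\<^sup>2) * trunc2 K u s"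
    by (intro add_mono mult_right_mono) (auto intro: add_increasing simp: trunc2_nonneg)
  finally show ?thesis by (simp add: majorant_def algebra_simps)
qed

text \<open>The drift is not homogeneous in u. The defect for a factor c is the truncation
  correction of c applied to the scaled jumps x u, hence is controlled by \<open>trunc2\<close> at
  u.\<close>

lemma drift_dilation_le: "\<bar>drift \<alpha> K (c * u) s\<bar> \<le> \<bar>c\<bar> * \<bar>drift \<alpha> K u s\<bar> + (1 + \<bar>c\<bar>) * (1 + c\<^sup>2) * trunc2 K u s"
proof -
  have i: "integrable (K s) (\<lambda>x. \<tau> ((x * u) * c) - c * \<tau> (x * u))"
  proof (rule levy_measure_integrable[OF M, where C="(1 + \<bar>c\<bar>) * (1 + c\<^sup>2) * (1 + u\<^sup>2)"])
    fix x
    have "\<bar>\<tau> ((x * u) * c) - c * \<tau> (x * u)\<bar> \<le> (1 + \<bar>c\<bar>) * (1 + c\<^sup>2) * min 1 ((x * u)\<^sup>2)" by (rule tau_dilation_le)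
    also have "\<dots> \<le> (1 + \<bar>c\<bar>) * (1 + c\<^sup>2) * ((1 + u\<^sup>2) * min 1 (x\<^sup>2))"
      by (intro mult_left_mono min_one_square_dilation) simp
    finally show "norm (\<tau> ((x * u) * c) - c * \<tau> (x * u)) \<le> (1 + \<bar>c\<bar>) * (1 + c\<^sup>2) * (1 + u\<^sup>2) * min 1 (x\<^sup>2)" by (simp add: mult.assoc)
  qed measurable
  have "(\<integral>x. \<tau> (x * (c * u)) - c * u * \<tau> x \<partial>K s) = (\<integral>x. (\<tau> ((x * u) * c) - c * \<tau> (x * u)) + c * (\<tau> (x * u) - u * \<tau> x) \<partial>K s)"
    by (intro Bochner_Integration.integral_cong refl) (simp add: algebra_simps)
  also have "\<dots> = (\<integral>x. \<tau> ((x * u) * c) - c * \<tau> (x * u) \<partial>K s) + c * (\<integral>x. \<tau> (x * u) - u * \<tau> x \<partial>K s)"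
    using i integrable_tau by (subst Bochner_Integration.integral_add) (auto simp del: Bochner_Integration.integral_diff)
  finally have eq: "drift \<alpha> K (c * u) s = c * drift \<alpha> K u s + (\<integral>x. \<tau> ((x * u) * c) - c * \<tau> (x * u) \<partial>K s)"
    by (simp add: drift_def algebra_simps)
  have "\<bar>\<integral>x. \<tau> ((x * u) * c) - c * \<tau> (x * u) \<partial>K s\<bar> \<le> (\<integral>x. (1 + \<bar>c\<bar>) * (1 + c\<^sup>2) * min 1 ((x * u)\<^sup>2) \<partial>K s)"
    using norm_integral_le[OF i, of "\<lambda>x. (1 + \<bar>c\<bar>) * (1 + c\<^sup>2) * min 1 ((x * u)\<^sup>2)"] integrable_min tau_dilation_le by simp
  also have "\<dots> = (1 + \<bar>c\<bar>) * (1 + c\<^sup>2) * trunc2 K u s" using integrable_min by (simp add: trunc2_def)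
  finally show ?thesis
    unfolding eq by (intro order_trans[OF abs_triangle_ineq] add_mono) (simp_all add: abs_mult)
qed

lemma trunc2_dilation_le: "trunc2 K (c * u) s \<le> (1 + c\<^sup>2) * trunc2 K u s"
proof -
  have "trunc2 K (c * u) s \<le> (\<integral>x. (1 + c\<^sup>2) * min 1 ((x * u)\<^sup>2) \<partial>K s)"
    unfolding trunc2_def
  proof (intro integral_mono integrable_min integrable_mult_right)
    show "min 1 ((x * (c * u))\<^sup>2) \<le> (1 + c\<^sup>2) * min 1 ((x * u)\<^sup>2)" for x
      using min_one_square_dilation[of "x * u" c] by (simp add: mult_ac)
  qed
  then show ?thesis using integrable_min by (simp add: trunc2_def)
qed

lemma majorant_nonneg: "0 \<le> majorant \<alpha> \<beta> K u s"
  by (simp add: majorant_def trunc2_nonneg)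

text \<open>Allows domination by the majorant at \<open>f s\<close> for approximations that are
  merely bounded by a multiple of \<open>\<bar>f s\<bar>\<close>. The drift by itself has no such
  monotonicity; the other terms compensate for it.\<close>

lemma majorant_dilation_le:
  assumes "\<bar>w\<bar> \<le> \<kappa> * \<bar>u\<bar>" "0 \<le> \<kappa>"
  shows "majorant \<alpha> \<beta> K w s \<le> 2 * (1 + \<kappa>) * (1 + \<kappa>\<^sup>2) * majorant \<alpha> \<beta> K u s"
proof -
  obtain c where w: "w = c * u" and c: "\<bar>c\<bar> \<le> \<kappa>"
  proof (cases "u = 0")
    case True
    then show ?thesis using assms that[of 0] by simp
  next
    case False
    then show ?thesis using assms that[of "w / u"] by (simp add: abs_divide field_simps)
  qed
  have c2: "c\<^sup>2 \<le> \<kappa>\<^sup>2" using c assms(2) by (simp add: abs_le_square_iff[symmetric])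
  \<comment> \<open>The factor 2 is due to the truncated moment, which occurs twice: once in the
    bound of the drift and once as its own term.\<close>
  define D where "D = 2 * (1 + \<kappa>) * (1 + \<kappa>\<^sup>2)"
  have A: "(1 + \<bar>c\<bar>) * (1 + c\<^sup>2) \<le> (1 + \<kappa>) * (1 + \<kappa>\<^sup>2)" using c c2 assms(2) by (intro mult_mono) auto
  have k3: "0 \<le> \<kappa> * \<kappa>\<^sup>2" using assms(2) by simp
  have D_eq: "D = 2 + 2 * \<kappa> + 2 * \<kappa>\<^sup>2 + 2 * (\<kappa> * \<kappa>\<^sup>2)" by (simp add: D_def algebra_simps)
  have B: "1 + c\<^sup>2 \<le> (1 + \<kappa>) * (1 + \<kappa>\<^sup>2)" using D_eq c2 k3 assms(2) unfolding D_def by linarith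
  have C: "\<bar>c\<bar> \<le> D" "c\<^sup>2 \<le> D"
    unfolding D_eq using c c2 k3 assms(2) zero_le_power2[of \<kappa>] by linarith+
  have "majorant \<alpha> \<beta> K w s \<le> (\<bar>c\<bar> * \<bar>drift \<alpha> K u s\<bar> + (1 + \<bar>c\<bar>) * (1 + c\<^sup>2) * trunc2 K u s) + c\<^sup>2 * (u\<^sup>2 * \<bar>\<beta> s\<bar>) + (1 + c\<^sup>2) * trunc2 K u s"
    unfolding majorant_def w using drift_dilation_le[of \<alpha> c u] trunc2_dilation_le[of c u]
    by (intro add_mono) (auto simp: power_mult_distrib mult.assoc)
  also have "\<dots> \<le> (D * \<bar>drift \<alpha> K u s\<bar> + (1 + \<kappa>) * (1 + \<kappa>\<^sup>2) * trunc2 K u s) + D * (u\<^sup>2 * \<bar>\<beta> s\<bar>) + (1 + \<kappa>) * (1 + \<kappa>\<^sup>2) * trunc2 K u s"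
    using A B C trunc2_nonneg by (intro add_mono mult_right_mono) auto
  also have "\<dots> = D * majorant \<alpha> \<beta> K u s" by (simp add: majorant_def D_def algebra_simps)
  finally show ?thesis by (simp add: D_def)
qed

lemma majorant_eq_0_imp: "majorant \<alpha> \<beta> K 1 s = 0 \<Longrightarrow> majorant \<alpha> \<beta> K u s = 0"
  using majorant_dilation_le[of u "\<bar>u\<bar>" 1 \<alpha> \<beta>] majorant_nonneg[of \<alpha> \<beta> u] by simp

context
  fixes w :: "nat \<Rightarrow> real" and u :: real
  assumes w: "w \<longlonglongrightarrow> u"
begin

lemma bounded_dilations: "\<exists>b\<ge>0. \<forall>i. \<bar>w i\<bar> \<le> b"
proof -
  have "Bseq w" using w by (intro convergent_imp_Bseq convergentI)
  then show ?thesis by (auto simp: Bseq_def intro: less_imp_le)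
qed

lemma levy_exp_tendsto: "(\<lambda>i. levy_exp \<alpha> \<beta> K (w i) s) \<longlonglongrightarrow> levy_exp \<alpha> \<beta> K u s"
proof -
  obtain b where b: "0 \<le> b" "\<And>i. \<bar>w i\<bar> \<le> b" using bounded_dilations by auto
  have b2: "(w i)\<^sup>2 \<le> b\<^sup>2" for i using b by (simp add: abs_le_square_iff[symmetric])
  have "(\<lambda>i. \<integral>x. lk (w i) x \<partial>K s) \<longlonglongrightarrow> (\<integral>x. lk u x \<partial>K s)"
  proof (rule integral_dominated_convergence[where w="\<lambda>x. (2 + b + b\<^sup>2) * min 1 (x\<^sup>2)"])
    show "integrable (K s) (\<lambda>x. (2 + b + b\<^sup>2) * min 1 (x\<^sup>2))" using integrable_min[of 1] by simp
    show "AE x in K s. (\<lambda>i. lk (w i) x) \<longlonglongrightarrow> lk u x"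
      by (intro AE_I2 continuous_on_tendsto_compose[OF continuous_lk w]) auto
    show "AE x in K s. norm (lk (w i) x) \<le> (2 + b + b\<^sup>2) * min 1 (x\<^sup>2)" for i
      using b b2 by (intro AE_I2 order_trans[OF norm_lk_le] mult_right_mono add_mono) auto
  qed (use integrable_lk in auto)
  then show ?thesis unfolding levy_exp_def by (intro tendsto_intros w) simp_all
qed

lemma drift_tendsto: "(\<lambda>i. drift \<alpha> K (w i) s) \<longlonglongrightarrow> drift \<alpha> K u s"
proof -
  obtain b where b: "0 \<le> b" "\<And>i. \<bar>w i\<bar> \<le> b" using bounded_dilations by auto
  have b2: "(w i)\<^sup>2 \<le> b\<^sup>2" for i using b by (simp add: abs_le_square_iff[symmetric])
  have "(\<lambda>i. \<integral>x. \<tau> (x * w i) - w i * \<tau> x \<partial>K s) \<longlonglongrightarrow> (\<integral>x. \<tau> (x * u) - u * \<tau> x \<partial>K s)"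
  proof (rule integral_dominated_convergence[where w="\<lambda>x. (1 + b) * (1 + b\<^sup>2) * min 1 (x\<^sup>2)"])
    show "integrable (K s) (\<lambda>x. (1 + b) * (1 + b\<^sup>2) * min 1 (x\<^sup>2))" using integrable_min[of 1] by simp
    show "AE x in K s. (\<lambda>i. \<tau> (x * w i) - w i * \<tau> x) \<longlonglongrightarrow> \<tau> (x * u) - u * \<tau> x"
      by (intro AE_I2 tendsto_intros continuous_on_tendsto_compose[OF continuous_tau] w) auto
    show "AE x in K s. norm (\<tau> (x * w i) - w i * \<tau> x) \<le> (1 + b) * (1 + b\<^sup>2) * min 1 (x\<^sup>2)" for i
      using b b2 by (intro AE_I2) (auto intro!: order_trans[OF tau_dilation_le] mult_right_mono mult_mono)
  qed (use integrable_tau in auto)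
  then show ?thesis unfolding drift_def by (intro tendsto_intros w)
qed

lemma trunc2_tendsto: "(\<lambda>i. trunc2 K (w i) s) \<longlonglongrightarrow> trunc2 K u s"
proof -
  obtain b where b: "0 \<le> b" "\<And>i. \<bar>w i\<bar> \<le> b" using bounded_dilations by auto
  have b2: "(w i)\<^sup>2 \<le> b\<^sup>2" for i using b by (simp add: abs_le_square_iff[symmetric])
  show ?thesis
    unfolding trunc2_def
  proof (rule integral_dominated_convergence[where w="\<lambda>x. (1 + b\<^sup>2) * min 1 (x\<^sup>2)"])
    show "integrable (K s) (\<lambda>x. (1 + b\<^sup>2) * min 1 (x\<^sup>2))" using integrable_min[of 1] by simp
    show "AE x in K s. (\<lambda>i. min 1 ((x * w i)\<^sup>2)) \<longlonglongrightarrow> min 1 ((x * u)\<^sup>2)"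
      by (intro AE_I2 tendsto_intros w)
    show "AE x in K s. norm (min 1 ((x * w i)\<^sup>2)) \<le> (1 + b\<^sup>2) * min 1 (x\<^sup>2)" for i
      using b2[of i] min_one_square_dilation[of _ "w i"] 
      by (intro AE_I2) (auto intro!: order_trans[OF min_one_square_dilation] mult_right_mono)
  qed (use integrable_min in auto)
qed

end

end

text \<open>For z \<le> 2 the third-order expansion of sine gains \<open>z\<^sup>2 / 6\<close> and
  its remainder costs at most \<open>z\<^sup>2 / 12\<close>, which leaves 1/12. For z > 2 the
  quotient is at most 1/2, so there is ample room.\<close>

lemma sinc_le:
  fixes z :: real
  assumes "0 < z"
  shows "min 1 (z\<^sup>2) / 12 \<le> 1 - sin z / z"
proof (cases "z \<le> 2")
  case True
  have "cmod (iexp z - (\<Sum>k\<le>3. (\<i> * z)^k / fact k)) \<le> \<bar>z\<bar>^4 / fact 4"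
    using iexp_approx1[of z 3] by (simp add: eval_nat_numeral)
  moreover have "Im (iexp z - (\<Sum>k\<le>3. (\<i> * z)^k / fact k)) = sin z - (z - z^3 / 6)"
    by (simp add: eval_nat_numeral Im_divide Re_divide fact_numeral Im_exp)
  ultimately have "\<bar>sin z - (z - z^3 / 6)\<bar> \<le> z^4 / 24"
    using abs_Im_le_cmod[of "iexp z - (\<Sum>k\<le>3. (\<i> * z)^k / fact k)"] assms by (simp add: fact_numeral)
  then have "sin z - (z - z^3 / 6) \<le> z^4 / 24" by (rule abs_le_D1)
  moreover have "z^4 = z^3 * z" by (simp add: power_numeral_reduce)
  ultimately have "sin z \<le> z - z^3 / 6 + z^3 * z / 24" by simp
  also have "\<dots> \<le> z - z^3 / 6 + z^3 * 2 / 24" using True assms by (intro add_left_mono divide_right_mono mult_left_mono) auto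
  finally have "sin z / z \<le> (z - z^3 / 12) / z" using assms by (intro divide_right_mono) auto
  also have "\<dots> = 1 - z\<^sup>2 / 12" using assms by (simp add: field_simps power_numeral_reduce power2_eq_square)
  finally show ?thesis using min.cobounded2[of 1 "z\<^sup>2"] by linarith
next
  case False
  have "sin z / z \<le> 1 / 2" using False by (intro frac_le) auto
  then show ?thesis using min.cobounded1[of 1 "z\<^sup>2"] by linarith
qed

text \<open>For a single \<theta> the function 1 - cos vanishes at arbitrarily large arguments;
  averaging over an interval removes these zeros and leaves a multiple of one minus a sinc, which
  dominates the truncated square.\<close>

lemma nn_integral_one_minus_cos:
  assumes "0 < \<delta>" 
  shows "ennreal (\<delta> / 12 * min 1 ((\<delta> * y)\<^sup>2)) \<le> (\<integral>\<^sup>+\<theta>. ennreal (1 - cos (\<theta> * y)) * indicator {0..\<delta>} \<theta> \<partial>lborel)"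
proof (cases "y = 0")
  case False
  have "(\<integral>\<^sup>+\<theta>. ennreal (1 - cos (\<theta> * y)) * indicator {0..\<delta>} \<theta> \<partial>lborel) = ennreal ((\<delta> - sin (\<delta> * y) / y) - (0 - sin (0 * y) / y))"
    using assms False by (intro nn_integral_FTC_Icc) (auto intro!: derivative_eq_intros)
  moreover have "\<delta> / 12 * min 1 ((\<delta> * y)\<^sup>2) \<le> \<delta> - sin (\<delta> * y) / y"
  proof -
    have "sin (\<delta> * y) / y = sin (\<delta> * \<bar>y\<bar>) / \<bar>y\<bar>" by (simp add: abs_if)
    also have "\<dots> = \<delta> * (sin (\<delta> * \<bar>y\<bar>) / (\<delta> * \<bar>y\<bar>))" using assms by simp
    also have "\<dots> \<le> \<delta> * (1 - min 1 ((\<delta> * \<bar>y\<bar>)\<^sup>2) / 12)"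
      using assms False sinc_le[of "\<delta> * \<bar>y\<bar>"] by (intro mult_left_mono) auto
    also have "\<dots> = \<delta> - \<delta> / 12 * min 1 ((\<delta> * y)\<^sup>2)" by (simp add: algebra_simps power_mult_distrib)
    finally show ?thesis by simp
  qed
  ultimately show ?thesis by (simp add: ennreal_leI)
qed simp

section \<open>Images of kernels under scaling\<close>

text \<open>The image of \<open>K s\<close> under multiplication by \<open>w s\<close>, with the
  mass at 0 erased: where \<open>w s = 0\<close> the whole, possibly infinite, mass would be sent to
  0.\<close>

definition pushed :: "('s \<Rightarrow> real measure) \<Rightarrow> ('s \<Rightarrow> real) \<Rightarrow> 's \<Rightarrow> real measure" where
  "pushed K w s = density (distr (K s) borel (\<lambda>x. w s * x)) (\<lambda>y. ennreal (indicator (- {0}) y))"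

context levy_kernel_on
begin

lemma ennreal_trunc2:
  assumes s: "s \<in> space l"
  shows "ennreal (trunc2 K u s) = (\<integral>\<^sup>+x. ennreal (min 1 ((x * u)\<^sup>2)) \<partial>K s)"
  unfolding trunc2_def by (rule nn_integral_eq_integral[symmetric, OF integrable_min[where K=K, OF levy[OF s]]]) simp

lemma nn_pushed:
  assumes s: "s \<in> space l" and h[measurable]: "h \<in> borel_measurable borel" and h0: "h 0 = 0"
  shows "(\<integral>\<^sup>+y. h y \<partial>pushed K w s) = (\<integral>\<^sup>+x. h (w s * x) \<partial>K s)"
proof -
  have [measurable]: "(\<lambda>x. w s * x) \<in> measurable (K s) borel" using s by (intro measurable_kernelI) auto
  have "(\<integral>\<^sup>+y. h y \<partial>pushed K w s) = (\<integral>\<^sup>+x. ennreal (indicator (- {0}) (w s * x)) * h (w s * x) \<partial>K s)"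
    by (simp add: pushed_def nn_integral_density nn_integral_distr)
  also have "\<dots> = (\<integral>\<^sup>+x. h (w s * x) \<partial>K s)"
    using h0 by (intro nn_integral_cong) (auto split: split_indicator)
  finally show ?thesis .
qed

lemma emeasure_pushed:
  assumes s: "s \<in> space l" and B[measurable]: "B \<in> sets borel"
  shows "emeasure (pushed K w s) B = (\<integral>\<^sup>+x. indicator (B - {0}) (w s * x) \<partial>K s)"
proof -
  have [measurable]: "(\<lambda>x. w s * x) \<in> measurable (K s) borel" using s by (intro measurable_kernelI) auto
  have "emeasure (pushed K w s) B = (\<integral>\<^sup>+x. ennreal (indicator (- {0}) (w s * x)) * indicator B (w s * x) \<partial>K s)"
    by (simp add: pushed_def emeasure_density nn_integral_distr)
  also have "\<dots> = (\<integral>\<^sup>+x. indicator (B - {0}) (w s * x) \<partial>K s)"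
    by (intro nn_integral_cong) (auto split: split_indicator)
  finally show ?thesis .
qed

lemma integral_pushed:
  fixes g :: "real \<Rightarrow> complex"
  assumes s: "s \<in> space l" and g[measurable]: "g \<in> borel_measurable borel" and g0: "g 0 = 0"
  shows "(\<integral>y. g y \<partial>pushed K w s) = (\<integral>x. g (w s * x) \<partial>K s)"
proof -
  have [measurable]: "(\<lambda>x. w s * x) \<in> measurable (K s) borel" using s by (intro measurable_kernelI) auto
  have "(\<integral>y. g y \<partial>pushed K w s) = (\<integral>x. indicator (- {0}) (w s * x) *\<^sub>R g (w s * x) \<partial>K s)"
    unfolding pushed_def by (subst integral_density) (auto simp: integral_distr)
  also have "\<dots> = (\<integral>x. g (w s * x) \<partial>K s)"
    using g0 by (intro Bochner_Integration.integral_cong) (auto split: split_indicator)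
  finally show ?thesis .
qed

lemma levy_pushed:
  assumes s: "s \<in> space l"
  shows "levy_measure (pushed K w s)"
  unfolding levy_measure_def
proof (intro conjI)
  show "emeasure (pushed K w s) {0} = 0" using emeasure_pushed[OF s, of "{0}" w] by simp
  have "(\<integral>\<^sup>+y. ennreal (min 1 (y\<^sup>2)) \<partial>pushed K w s) = ennreal (trunc2 K (w s) s)"
    by (subst nn_pushed[OF s]) (auto simp: ennreal_trunc2[OF s] mult.commute)
  then show "(\<integral>\<^sup>+y. ennreal (min 1 (y\<^sup>2)) \<partial>pushed K w s) < \<infinity>" by simp
qed (simp add: pushed_def)

lemma mixture_pushed:
  assumes w[measurable]: "w \<in> borel_measurable l"
  shows "mixture l borel (mix l borel (pushed K w)) (pushed K w)"
proof (rule mixture_mix)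
  fix B :: "real set" assume [measurable]: "B \<in> sets borel"
  have [measurable]: "B - {0} \<in> sets borel" by measurable
  have "(\<lambda>s. \<integral>\<^sup>+x. indicator (B - {0}) (w s * x) \<partial>K s) \<in> borel_measurable l"
    by (rule nn_joint) measurable
  then show "(\<lambda>s. emeasure (pushed K w s) B) \<in> borel_measurable l"
    by (rule measurable_cong[THEN iffD1, rotated]) (simp add: emeasure_pushed)
qed (simp add: pushed_def)

lemma nn_mix_pushed:
  assumes w: "w \<in> borel_measurable l" and h: "h \<in> borel_measurable borel" "h 0 = 0"
  shows "(\<integral>\<^sup>+y. h y \<partial>mix l borel (pushed K w)) = (\<integral>\<^sup>+s. (\<integral>\<^sup>+x. h (w s * x) \<partial>K s) \<partial>l)"
  using mixture.nn[OF mixture_pushed[OF w] h(1)] nn_pushed[OF _ h] by (simp cong: nn_integral_cong)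

lemma emeasure_mix_pushed:
  assumes w: "w \<in> borel_measurable l" and B: "B \<in> sets borel"
  shows "emeasure (mix l borel (pushed K w)) B = (\<integral>\<^sup>+s. (\<integral>\<^sup>+x. indicator (B - {0}) (w s * x) \<partial>K s) \<partial>l)"
  using mixture.emeasure_N[OF mixture_pushed[OF w] B] emeasure_pushed[OF _ B] by (simp cong: nn_integral_cong)

lemma levy_mix_pushed:
  assumes w: "w \<in> borel_measurable l" and i: "integrable l (\<lambda>s. trunc2 K (w s) s)"
  shows "levy_measure (mix l borel (pushed K w))"
  unfolding levy_measure_def
proof (intro conjI)
  show "emeasure (mix l borel (pushed K w)) {0} = 0" using emeasure_mix_pushed[OF w, of "{0}"] by simp
  have "(\<integral>\<^sup>+y. ennreal (min 1 (y\<^sup>2)) \<partial>mix l borel (pushed K w)) = (\<integral>\<^sup>+s. ennreal (trunc2 K (w s) s) \<partial>l)"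
    by (subst nn_mix_pushed[OF w]) (auto simp: ennreal_trunc2 mult.commute intro!: nn_integral_cong)
  also have "\<dots> < \<infinity>" using i by (subst nn_integral_eq_integral) (auto simp: trunc2_nonneg)
  finally show "(\<integral>\<^sup>+y. ennreal (min 1 (y\<^sup>2)) \<partial>mix l borel (pushed K w)) < \<infinity>" .
qed simp

text \<open>The double integral over s and x is first collected into one Levy measure N on the line.
  Being \<sigma>-finite, N admits an exchange with the average over \<theta>, and the averaged 1 -
  cos dominates the truncated square.\<close>

lemma truncated_moment_bound:
  assumes w: "w \<in> borel_measurable l" and i: "integrable l (\<lambda>s. trunc2 K (w s) s)"
    and \<delta>: "0 < \<delta>" and c: "0 \<le> c"
    and le: "\<And>\<theta>. \<theta> \<in> {0..\<delta>} \<Longrightarrow> (\<integral>\<^sup>+s. (\<integral>\<^sup>+x. ennreal (1 - cos (\<theta> * (x * w s))) \<partial>K s) \<partial>l) \<le> ennreal c"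
  shows "(\<integral>s. trunc2 K (w s) s \<partial>l) \<le> (1 + (1 / \<delta>)\<^sup>2) * 12 * c"
proof -
  define N where "N = mix l borel (pushed K w)"
  have N: "levy_measure N" unfolding N_def by (rule levy_mix_pushed[OF w i])
  note [simp, measurable_cong] = sets_levy_measure[OF N]
  interpret N: sigma_finite_measure N by (rule levy_measure_sigma_finite[OF N])
  interpret pair_sigma_finite lborel N ..
  \<comment> \<open>The first factor rescales from \<delta> y back to y, and 12 / \<delta> inverts
    the constant of \<open>nn_integral_one_minus_cos\<close>. The length \<delta> of the interval
    reappears on the other side and cancels.\<close>
  define C where "C = (1 + (1 / \<delta>)\<^sup>2) * (12 / \<delta>)"
  have C: "0 \<le> C" using \<delta> by (simp add: C_def)
  have "ennreal (\<integral>s. trunc2 K (w s) s \<partial>l) = (\<integral>\<^sup>+s. ennreal (trunc2 K (w s) s) \<partial>l)"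
    by (rule nn_integral_eq_integral[symmetric, OF i]) (simp add: trunc2_nonneg)
  also have "\<dots> = (\<integral>\<^sup>+y. ennreal (min 1 (y\<^sup>2)) \<partial>N)"
    unfolding N_def by (subst nn_mix_pushed[OF w]) (auto simp: ennreal_trunc2 mult.commute intro!: nn_integral_cong)
  also have "\<dots> \<le> (\<integral>\<^sup>+y. ennreal C * (\<integral>\<^sup>+\<theta>. ennreal (1 - cos (\<theta> * y)) * indicator {0..\<delta>} \<theta> \<partial>lborel) \<partial>N)"
  proof (rule nn_integral_mono)
    fix y :: real
    have "min 1 (y\<^sup>2) \<le> (1 + (1 / \<delta>)\<^sup>2) * min 1 ((\<delta> * y)\<^sup>2)"
      using min_one_square_dilation[of "\<delta> * y" "1 / \<delta>"] \<delta> by simp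
    also have "\<dots> = C * (\<delta> / 12 * min 1 ((\<delta> * y)\<^sup>2))" using \<delta> by (simp add: C_def)
    finally have "ennreal (min 1 (y\<^sup>2)) \<le> ennreal C * ennreal (\<delta> / 12 * min 1 ((\<delta> * y)\<^sup>2))"
      using C \<delta> by (subst ennreal_mult[symmetric]) (auto intro!: ennreal_leI)
    also have "\<dots> \<le> ennreal C * (\<integral>\<^sup>+\<theta>. ennreal (1 - cos (\<theta> * y)) * indicator {0..\<delta>} \<theta> \<partial>lborel)"
      by (intro mult_left_mono nn_integral_one_minus_cos \<delta>) simp
    finally show "ennreal (min 1 (y\<^sup>2)) \<le> ennreal C * (\<integral>\<^sup>+\<theta>. ennreal (1 - cos (\<theta> * y)) * indicator {0..\<delta>} \<theta> \<partial>lborel)" .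
  qed
  also have "\<dots> = ennreal C * (\<integral>\<^sup>+y. (\<integral>\<^sup>+\<theta>. ennreal (1 - cos (\<theta> * y)) * indicator {0..\<delta>} \<theta> \<partial>lborel) \<partial>N)"
    by (rule nn_integral_cmult) measurable
  also have "(\<integral>\<^sup>+y. (\<integral>\<^sup>+\<theta>. ennreal (1 - cos (\<theta> * y)) * indicator {0..\<delta>} \<theta> \<partial>lborel) \<partial>N)
     = (\<integral>\<^sup>+\<theta>. (\<integral>\<^sup>+y. ennreal (1 - cos (\<theta> * y)) * indicator {0..\<delta>} \<theta> \<partial>N) \<partial>lborel)"
    by (rule Fubini') measurable
  also have "\<dots> \<le> (\<integral>\<^sup>+\<theta>. ennreal c * indicator {0..\<delta>} \<theta> \<partial>lborel)"
  proof (rule nn_integral_mono)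
    fix \<theta> :: real
    show "(\<integral>\<^sup>+y. ennreal (1 - cos (\<theta> * y)) * indicator {0..\<delta>} \<theta> \<partial>N) \<le> ennreal c * indicator {0..\<delta>} \<theta>"
    proof (cases "\<theta> \<in> {0..\<delta>}")
      case True
      have "(\<integral>\<^sup>+y. ennreal (1 - cos (\<theta> * y)) \<partial>N) = (\<integral>\<^sup>+s. (\<integral>\<^sup>+x. ennreal (1 - cos (\<theta> * (x * w s))) \<partial>K s) \<partial>l)"
        unfolding N_def by (subst nn_mix_pushed[OF w]) (auto simp: mult.commute)
      then show ?thesis using le[OF True] True by simp
    qed simp
  qed
  also have "\<dots> = ennreal (c * \<delta>)"
    using c \<delta> by (simp add: nn_integral_cmult_indicator ennreal_mult)
  finally have "ennreal (\<integral>s. trunc2 K (w s) s \<partial>l) \<le> ennreal C * ennreal (c * \<delta>)"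
    by (simp add: mult_left_mono)
  then have "(\<integral>s. trunc2 K (w s) s \<partial>l) \<le> C * (c * \<delta>)"
    using C c \<delta> by (simp add: ennreal_mult[symmetric] ennreal_le_iff)
  also have "\<dots> = (1 + (1 / \<delta>)\<^sup>2) * 12 * c" using \<delta> by (simp add: C_def)
  finally show ?thesis .
qed

end

section \<open>Integrability with respect to an infinitely divisible random measure\<close>

text \<open>Local characteristics of one infinitely divisible random measure as densities with
  respect to l. At u = 1 the majorant is |\<alpha>| + |\<beta>| plus the truncated moment, so the
  last assumption is their integrability over members of R.\<close>

locale levy_chars = levy_kernel_on l K for l :: "'s measure" and K +
  fixes \<alpha> \<beta> :: "'s \<Rightarrow> real" and R :: "'s set set"
  assumes measurable_\<alpha>[measurable]: "\<alpha> \<in> borel_measurable l" and measurable_\<beta>[measurable]: "\<beta> \<in> borel_measurable l"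
    and R_sets: "R \<subseteq> sets l"
    and locally_integrable: "\<And>A. A \<in> R \<Longrightarrow> integrable l (\<lambda>s. indicator A s * majorant \<alpha> \<beta> K 1 s)"
begin

context
  fixes w :: "'s \<Rightarrow> real"
  assumes w[measurable]: "w \<in> borel_measurable l"
begin

lemma measurable_drift [measurable]: "(\<lambda>s. drift \<alpha> K (w s) s) \<in> borel_measurable l"
proof -
  have "(\<lambda>s. \<integral>x. \<tau> (x * w s) - w s * \<tau> x \<partial>K s) \<in> borel_measurable l"
    using integrable_tau[where K=K, OF levy] by (intro real_joint) auto
  then show ?thesis unfolding drift_def by measurable
qed

lemma measurable_trunc2 [measurable]: "(\<lambda>s. trunc2 K (w s) s) \<in> borel_measurable l"
  unfolding trunc2_def using integrable_min[where K=K, OF levy] by (intro real_joint) auto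

lemma measurable_majorant [measurable]: "(\<lambda>s. majorant \<alpha> \<beta> K (w s) s) \<in> borel_measurable l"
  unfolding majorant_def by measurable

lemma measurable_levy_exp [measurable]: "(\<lambda>s. levy_exp \<alpha> \<beta> K (w s) s) \<in> borel_measurable l"
proof -
  have "(\<lambda>p. (w (fst p), snd p)) \<in> measurable (l \<Otimes>\<^sub>M borel) (borel \<Otimes>\<^sub>M borel)" by measurable
  from measurable_compose[OF this borel_measurable_lk]
  have "(\<lambda>s. \<integral>x. lk (w s) x \<partial>K s) \<in> borel_measurable l"
    using integrable_lk[where K=K, OF levy] by (intro complex_joint) (auto simp: split_beta)
  then show ?thesis unfolding levy_exp_def by measurable
qed

context
  assumes maj: "integrable l (\<lambda>s. majorant \<alpha> \<beta> K (w s) s)"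
begin

lemma integrable_drift: "integrable l (\<lambda>s. drift \<alpha> K (w s) s)"
  using maj by (rule Bochner_Integration.integrable_bound) (auto simp: majorant_def trunc2_nonneg)

lemma integrable_gauss: "integrable l (\<lambda>s. (w s)\<^sup>2 * \<beta> s)"
  using maj by (rule Bochner_Integration.integrable_bound) (auto simp: majorant_def trunc2_nonneg abs_mult)

lemma integrable_trunc2: "integrable l (\<lambda>s. trunc2 K (w s) s)"
  using maj by (rule Bochner_Integration.integrable_bound) (auto simp: majorant_def trunc2_nonneg)

lemma integrable_levy_exp: "integrable l (\<lambda>s. levy_exp \<alpha> \<beta> K (\<theta> * w s) s)"
proof (rule Bochner_Integration.integrable_bound)
  show "integrable l (\<lambda>s. (2 + \<bar>\<theta>\<bar> + \<theta>\<^sup>2) * majorant \<alpha> \<beta> K (w s) s)" using maj by simp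
  have "(\<lambda>p. (\<theta> * w (fst p), snd p)) \<in> measurable (l \<Otimes>\<^sub>M borel) (borel \<Otimes>\<^sub>M borel)" by measurable
  from measurable_compose[OF this borel_measurable_lk]
  have "(\<lambda>s. \<integral>x. lk (\<theta> * w s) x \<partial>K s) \<in> borel_measurable l"
    using integrable_lk[where K=K, OF levy] by (intro complex_joint) (auto simp: split_beta)
  then show "(\<lambda>s. levy_exp \<alpha> \<beta> K (\<theta> * w s) s) \<in> borel_measurable l" unfolding levy_exp_def by measurable
  show "AE s in l. norm (levy_exp \<alpha> \<beta> K (\<theta> * w s) s) \<le> norm ((2 + \<bar>\<theta>\<bar> + \<theta>\<^sup>2) * majorant \<alpha> \<beta> K (w s) s)"
    using majorant_nonneg[where K=K, OF levy] levy_exp_le[where K=K, OF levy] by (intro AE_I2) (simp add: abs_mult)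
qed

end

end

lemma integrable_levy_exp_on:
  assumes "A \<in> R"
  shows "integrable l (\<lambda>s. indicator A s *\<^sub>R levy_exp \<alpha> \<beta> K \<theta> s)"
proof (rule Bochner_Integration.integrable_bound)
  show "integrable l (\<lambda>s. (2 + \<bar>\<theta>\<bar> + \<theta>\<^sup>2) * (indicator A s * majorant \<alpha> \<beta> K 1 s))"
    using locally_integrable[OF assms] by simp
  have [measurable]: "A \<in> sets l" using assms R_sets by auto
  show "(\<lambda>s. indicator A s *\<^sub>R levy_exp \<alpha> \<beta> K \<theta> s) \<in> borel_measurable l"
    using measurable_levy_exp[of "\<lambda>_. \<theta>"] by measurable
  show "AE s in l. norm (indicator A s *\<^sub>R levy_exp \<alpha> \<beta> K \<theta> s) \<le> norm ((2 + \<bar>\<theta>\<bar> + \<theta>\<^sup>2) * (indicator A s * majorant \<alpha> \<beta> K 1 s))"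
    using majorant_nonneg[where K=K, OF levy] levy_exp_le[where K=K, OF levy, of _ \<alpha> \<beta> \<theta> 1]
    by (intro AE_I2) (auto simp: abs_mult split: split_indicator)
qed

lemma measurable_simple_value:
  assumes "simple_rep R g"
  shows "simple_value g \<in> borel_measurable l"
proof -
  have [measurable]: "snd (g ! j) \<in> sets l" if "j < length g" for j
    using assms that R_sets by (auto simp: simple_rep_def)
  have [measurable]: "(\<lambda>s. fst (g ! j) * indicator (snd (g ! j)) s) \<in> borel_measurable l" if "j < length g" for j
    using that by measurable
  show ?thesis unfolding simple_value_def[abs_def] by (rule borel_measurable_sum) auto
qed

lemma integrable_majorant_simple:
  assumes g: "simple_rep R g"
  shows "integrable l (\<lambda>s. majorant \<alpha> \<beta> K (simple_value g s) s)"
proof (rule Bochner_Integration.integrable_bound)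
  define D where "D j = 2 * (1 + \<bar>fst (g ! j)\<bar>) * (1 + \<bar>fst (g ! j)\<bar>\<^sup>2)" for j
  have D: "0 \<le> D j" for j by (simp add: D_def)
  show "integrable l (\<lambda>s. \<Sum>j<length g. D j * (indicator (snd (g ! j)) s * majorant \<alpha> \<beta> K 1 s))"
    using g locally_integrable by (intro Bochner_Integration.integrable_sum integrable_mult_right) (auto simp: simple_rep_def)
  show "(\<lambda>s. majorant \<alpha> \<beta> K (simple_value g s) s) \<in> borel_measurable l"
    by (rule measurable_majorant[OF measurable_simple_value[OF g]])
  show "AE s in l. norm (majorant \<alpha> \<beta> K (simple_value g s) s) \<le> norm (\<Sum>j<length g. D j * (indicator (snd (g ! j)) s * majorant \<alpha> \<beta> K 1 s))"
  proof (rule AE_I2)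
    fix s assume s: "s \<in> space l"
    have nn: "0 \<le> D j * (indicator (snd (g ! j)) s * majorant \<alpha> \<beta> K 1 s)" for j
      using D majorant_nonneg[where K=K, OF levy[OF s]] by simp
    have "majorant \<alpha> \<beta> K (simple_value g s) s \<le> (\<Sum>j<length g. D j * (indicator (snd (g ! j)) s * majorant \<alpha> \<beta> K 1 s))"
    proof (cases "\<exists>j<length g. s \<in> snd (g ! j)")
      case True
      then obtain j where j: "j < length g" "s \<in> snd (g ! j)" by blast
      have o: "s \<notin> snd (g ! i)" if "i < length g" "i \<noteq> j" for i
      proof -
        have "snd (g ! i) \<inter> snd (g ! j) = {}"
          using g that j unfolding simple_rep_def by (intro disjoint_family_onD) auto
        then show ?thesis using j by auto
      qed
      have "simple_value g s = (\<Sum>i<length g. if i = j then fst (g ! j) else 0)"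
        unfolding simple_value_def using j o by (intro sum.cong) auto
      then have v: "simple_value g s = fst (g ! j)" using j by simp
      have "majorant \<alpha> \<beta> K (fst (g ! j)) s \<le> D j * majorant \<alpha> \<beta> K 1 s"
        unfolding D_def by (rule majorant_dilation_le[where K=K, OF levy[OF s]]) auto
      also have "\<dots> = D j * (indicator (snd (g ! j)) s * majorant \<alpha> \<beta> K 1 s)" using j by simp
      also have "\<dots> \<le> (\<Sum>j<length g. D j * (indicator (snd (g ! j)) s * majorant \<alpha> \<beta> K 1 s))"
        using j nn by (intro member_le_sum) auto
      finally show ?thesis by (simp add: v)
    next
      case False
      then have "simple_value g s = 0" by (auto simp: simple_value_def)
      then show ?thesis using nn by (simp add: majorant_0 sum_nonneg)
    qed
    then show "norm (majorant \<alpha> \<beta> K (simple_value g s) s) \<le> norm (\<Sum>j<length g. D j * (indicator (snd (g ! j)) s * majorant \<alpha> \<beta> K 1 s))"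
      using majorant_nonneg[where K=K, OF levy[OF s], of \<alpha> \<beta> "simple_value g s"] by simp
  qed
qed

end

text \<open>The limit characteristic function is within 1/4 of 1 near 0 by continuity, and the
  approximating ones are eventually within 1/4 of it uniformly there.\<close>

lemma (in prob_space) Re_char_ge_half:
  assumes X: "\<And>n. X n \<in> borel_measurable M" and lim: "tendsto_in_prob M X Y"
  shows "\<exists>\<delta>>0. \<exists>N. \<forall>n\<ge>N. \<forall>\<theta>. \<bar>\<theta>\<bar> \<le> \<delta> \<longrightarrow> 1 / 2 \<le> Re (char (distr M borel (X n)) \<theta>)"
proof -
  have Y: "Y \<in> borel_measurable M" using lim by (simp add: tendsto_in_prob_def)
  interpret D: real_distribution "distr M borel Y" using Y by (rule real_distribution_distr)
  obtain d where d: "0 < d" "\<And>\<theta>. dist \<theta> 0 < d \<Longrightarrow> dist (char (distr M borel Y) \<theta>) (char (distr M borel Y) 0) < 1 / 4"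
    using D.isCont_char[of 0] unfolding continuous_at_eps_delta by (metis zero_less_divide_1_iff zero_less_numeral)
  have "\<forall>\<^sub>F n in sequentially. \<forall>\<theta>. \<bar>\<theta>\<bar> \<le> d / 2 \<longrightarrow> cmod (char (distr M borel (X n)) \<theta> - char (distr M borel Y) \<theta>) \<le> 1 / 4"
    using d(1) by (intro tendsto_in_prob_char_uniform[OF X lim]) auto
  then obtain N where N: "\<And>n \<theta>. N \<le> n \<Longrightarrow> \<bar>\<theta>\<bar> \<le> d / 2 \<Longrightarrow> cmod (char (distr M borel (X n)) \<theta> - char (distr M borel Y) \<theta>) \<le> 1 / 4"
    by (auto simp: eventually_sequentially)
  have "1 / 2 \<le> Re (char (distr M borel (X n)) \<theta>)" if n: "N \<le> n" and \<theta>: "\<bar>\<theta>\<bar> \<le> d / 2" for n \<theta>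
  proof -
    have "cmod (char (distr M borel Y) \<theta> - 1) < 1 / 4"
      using d(2)[of \<theta>] d(1) \<theta> by (simp add: D.char_zero dist_norm)
    then have "cmod (char (distr M borel (X n)) \<theta> - 1) \<le> 1 / 2"
      using N[OF n \<theta>] norm_triangle_ineq[of "char (distr M borel (X n)) \<theta> - char (distr M borel Y) \<theta>" "char (distr M borel Y) \<theta> - 1"] by simp
    then show ?thesis
      using abs_Re_le_cmod[of "char (distr M borel (X n)) \<theta> - 1"] by simp
  qed
  then show ?thesis using d(1) by (intro exI[of _ "d / 2"]) auto
qed

text \<open>To be applied to the argument of a characteristic function with positive real part.\<close>

lemma abs_less_pi_half_of_cos_pos:
  fixes h :: "real \<Rightarrow> real"
  assumes c: "continuous_on {0..\<delta>} h" and \<delta>: "0 \<le> \<delta>" and h0: "h 0 = 0" and pos: "\<And>\<theta>. \<theta> \<in> {0..\<delta>} \<Longrightarrow> 0 < cos (h \<theta>)"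
  shows "\<bar>h \<delta>\<bar> < pi / 2"
proof (rule ccontr)
  assume "\<not> ?thesis"
  then consider "pi / 2 \<le> h \<delta>" | "h \<delta> \<le> - (pi / 2)" by linarith
  then obtain \<theta> where "\<theta> \<in> {0..\<delta>}" "h \<theta> = pi / 2 \<or> h \<theta> = - (pi / 2)"
  proof cases
    case 1
    then obtain x where "0 \<le> x" "x \<le> \<delta>" "h x = pi / 2" using IVT'[of h 0 "pi / 2" \<delta>] c \<delta> h0 by auto
    then show ?thesis using that by auto
  next
    case 2
    then obtain x where "0 \<le> x" "x \<le> \<delta>" "h x = - (pi / 2)" using IVT2'[of h \<delta> "- (pi / 2)" 0] c \<delta> h0 by auto
    then show ?thesis using that by auto
  qed
  moreover from this(2) have "cos (h \<theta>) = 0" by (metis cos_minus cos_pi_half)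
  ultimately show False using pos[of \<theta>] by simp
qed

lemma Bseq_of_bounded_tail:
  fixes x :: "nat \<Rightarrow> real"
  assumes "\<And>n. N \<le> n \<Longrightarrow> \<bar>x n\<bar> \<le> c"
  shows "Bseq x"
proof (rule BfunI)
  show "eventually (\<lambda>n. norm (x n) \<le> c) sequentially"
    using assms by (intro eventually_sequentiallyI[of N]) simp
qed

lemma Re_lk: "Re (lk \<theta> y) = - (1 - cos (\<theta> * y))"
  by (simp add: lk_def Re_exp)

context levy_chars
begin

lemma measurable_levy_exp_scaled: "u \<in> borel_measurable l \<Longrightarrow> (\<lambda>s. levy_exp \<alpha> \<beta> K (\<theta> * u s) s) \<in> borel_measurable l"
  using measurable_levy_exp[of "\<lambda>s. \<theta> * u s"] by simp

text \<open>Tightness of the approximating integrals first bounds the symmetric part of the exponents,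
  averaging \<open>1 - cos\<close> over small arguments; the drifts over each set are then bounded because
  the argument of the characteristic functions stays in the principal range.\<close>

lemma integrable_majorant_of_convergence:
  assumes E: "exponent_measure P S R L l (levy_exp \<alpha> \<beta> K)" and \<beta>: "AE s in l. 0 \<le> \<beta> s"
    and f[measurable]: "f \<in> borel_measurable l" and g: "\<And>n. simple_rep R (g n)"
    and conv: "\<And>A. A \<in> sets l \<Longrightarrow> \<exists>Y. tendsto_in_prob P (\<lambda>n. simple_integral_on L A (g n)) Y"
    and lim: "AE s in l. (\<lambda>n. simple_value (g n) s) \<longlonglongrightarrow> f s \<or> majorant \<alpha> \<beta> K 1 s = 0"
  shows "integrable l (\<lambda>s. majorant \<alpha> \<beta> K (f s) s)"
proof -
  interpret E: exponent_measure P S R L l "levy_exp \<alpha> \<beta> K" by fact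
  define v where "v n = simple_value (g n)" for n
  have v[measurable]: "v n \<in> borel_measurable l" for n unfolding v_def by (rule measurable_simple_value[OF g])
  have maj: "integrable l (\<lambda>s. majorant \<alpha> \<beta> K (v n s) s)" for n unfolding v_def by (rule integrable_majorant_simple[OF g])
  have int_exp: "integrable l (\<lambda>s. levy_exp \<alpha> \<beta> K (\<theta> * v n s) s)" for n \<theta> by (rule integrable_levy_exp[OF v maj])
  have int_drift: "integrable l (\<lambda>s. drift \<alpha> K (v n s) s)" for n by (rule integrable_drift[OF v maj])
  have int_gauss: "integrable l (\<lambda>s. (v n s)\<^sup>2 * \<beta> s)" for n by (rule integrable_gauss[OF v maj])
  have int_trunc: "integrable l (\<lambda>s. trunc2 K (v n s) s)" for n by (rule integrable_trunc2[OF v maj])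
  \<comment> \<open>Where the majorant at 1 vanishes, all characteristics vanish at every u, so the
    three limits below hold there even if the simple functions do not converge.\<close>
  have zero: "drift \<alpha> K u s = 0" "\<beta> s = 0" "trunc2 K u s = 0" if "s \<in> space l" "majorant \<alpha> \<beta> K 1 s = 0" for s u
    using majorant_eq_0_imp[where K=K, OF levy[OF that(1)] that(2), of u] that(2) trunc2_nonneg[of K u s] trunc2_nonneg[of K 1 s]
    by (auto simp: majorant_def add_nonneg_eq_0_iff)
  have lim_drift: "AE s in l. (\<lambda>n. drift \<alpha> K (v n s) s) \<longlonglongrightarrow> drift \<alpha> K (f s) s"
    using lim AE_space
  proof eventually_elim
    fix s assume "(\<lambda>n. simple_value (g n) s) \<longlonglongrightarrow> f s \<or> majorant \<alpha> \<beta> K 1 s = 0" and s: "s \<in> space l"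
    then consider "(\<lambda>n. v n s) \<longlonglongrightarrow> f s" | "majorant \<alpha> \<beta> K 1 s = 0" by (auto simp: v_def)
    then show "(\<lambda>n. drift \<alpha> K (v n s) s) \<longlonglongrightarrow> drift \<alpha> K (f s) s"
    proof cases
      case 1
      then show ?thesis by (rule drift_tendsto[where K=K, OF levy[OF s]])
    next
      case 2
      then show ?thesis by (simp add: zero[OF s 2])
    qed
  qed
  have lim_trunc: "AE s in l. (\<lambda>n. trunc2 K (v n s) s) \<longlonglongrightarrow> trunc2 K (f s) s"
    using lim AE_space
  proof eventually_elim
    fix s assume "(\<lambda>n. simple_value (g n) s) \<longlonglongrightarrow> f s \<or> majorant \<alpha> \<beta> K 1 s = 0" and s: "s \<in> space l"
    then consider "(\<lambda>n. v n s) \<longlonglongrightarrow> f s" | "majorant \<alpha> \<beta> K 1 s = 0" by (auto simp: v_def)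
    then show "(\<lambda>n. trunc2 K (v n s) s) \<longlonglongrightarrow> trunc2 K (f s) s"
    proof cases
      case 1
      then show ?thesis by (rule trunc2_tendsto[where K=K, OF levy[OF s]])
    next
      case 2
      then show ?thesis by (simp add: zero[OF s 2])
    qed
  qed
  have lim_gauss: "AE s in l. (\<lambda>n. (v n s)\<^sup>2 * \<beta> s) \<longlonglongrightarrow> (f s)\<^sup>2 * \<beta> s"
    using lim AE_space
  proof eventually_elim
    fix s assume "(\<lambda>n. simple_value (g n) s) \<longlonglongrightarrow> f s \<or> majorant \<alpha> \<beta> K 1 s = 0" and s: "s \<in> space l"
    then consider "(\<lambda>n. v n s) \<longlonglongrightarrow> f s" | "majorant \<alpha> \<beta> K 1 s = 0" by (auto simp: v_def)
    then show "(\<lambda>n. (v n s)\<^sup>2 * \<beta> s) \<longlonglongrightarrow> (f s)\<^sup>2 * \<beta> s"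
    proof cases
      case 1
      then show ?thesis by (intro tendsto_intros)
    next
      case 2
      then show ?thesis by (simp add: zero[OF s 2])
    qed
  qed
  have char: "char (distr P borel (simple_integral_on L A (g n))) \<theta> = exp (\<integral>s. indicator A s *\<^sub>R levy_exp \<alpha> \<beta> K (\<theta> * v n s) s \<partial>l)"
    if "A \<in> sets l" for A n \<theta>
    unfolding v_def using that by (intro E.char_simple_integral(2) g) (simp add: E.sets_l_eq)
  have half: "\<exists>\<delta>>0. \<exists>N. \<forall>n\<ge>N. \<forall>\<theta>. \<bar>\<theta>\<bar> \<le> \<delta> \<longrightarrow> 1 / 2 \<le> Re (exp (\<integral>s. indicator A s *\<^sub>R levy_exp \<alpha> \<beta> K (\<theta> * v n s) s \<partial>l))"
    if A: "A \<in> sets l" for A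
  proof -
    obtain Y where Y: "tendsto_in_prob P (\<lambda>n. simple_integral_on L A (g n)) Y" using conv[OF A] by blast
    have "simple_integral_on L A (g n) \<in> borel_measurable P" for n
      using A by (intro E.simple_integral_measurable g) (simp add: E.sets_l_eq)
    from E.Re_char_ge_half[OF this Y] show ?thesis by (simp add: char[OF A])
  qed
  obtain \<delta> N where \<delta>: "0 < \<delta>"
    and N: "\<And>n \<theta>. N \<le> n \<Longrightarrow> \<bar>\<theta>\<bar> \<le> \<delta> \<Longrightarrow> 1 / 2 \<le> Re (exp (\<integral>s. indicator (space l) s *\<^sub>R levy_exp \<alpha> \<beta> K (\<theta> * v n s) s \<partial>l))"
    using half[OF sets.top] by blast
  \<comment> \<open>The jump part of minus the real part of the exponent.\<close>
  define c where "c n \<theta> s = (\<integral>x. 1 - cos (\<theta> * (x * v n s)) \<partial>K s)" for n \<theta> s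
  have c_nonneg: "0 \<le> c n \<theta> s" for n \<theta> s unfolding c_def by (rule Bochner_Integration.integral_nonneg) simp
  have int_cos: "integrable (K s) (\<lambda>x. 1 - cos (\<theta> * (x * u)))" if "s \<in> space l" for s \<theta> u
    using Bochner_Integration.integrable_minus[OF integrable_Re[OF integrable_lk_dilated[where K=K, OF levy[OF that], of \<theta> u]]]
    unfolding Re_lk minus_minus .
  have Re_c: "Re (levy_exp \<alpha> \<beta> K (\<theta> * v n s) s) = - (\<theta>\<^sup>2 / 2 * ((v n s)\<^sup>2 * \<beta> s)) - c n \<theta> s" if s: "s \<in> space l" for n \<theta> s
  proof -
    have "Re (\<integral>x. lk \<theta> (x * v n s) \<partial>K s) = (\<integral>x. Re (lk \<theta> (x * v n s)) \<partial>K s)"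
      by (rule integral_Re[symmetric, OF integrable_lk_dilated[where K=K, OF levy[OF s]]])
    also have "\<dots> = - c n \<theta> s" unfolding c_def Re_lk by (rule Bochner_Integration.integral_minus)
    finally show ?thesis unfolding levy_exp_mult[where K=K, OF levy[OF s]] by simp
  qed
  have int_c: "integrable l (c n \<theta>)" for n \<theta>
  proof -
    have eq: "c n \<theta> s = - Re (levy_exp \<alpha> \<beta> K (\<theta> * v n s) s) - \<theta>\<^sup>2 / 2 * ((v n s)\<^sup>2 * \<beta> s)" if "s \<in> space l" for s
      using Re_c[OF that, of \<theta> n] by simp
    show ?thesis
      by (rule Bochner_Integration.integrable_cong[OF refl eq, THEN iffD2])
         (use int_exp int_gauss in \<open>auto intro!: Bochner_Integration.integrable_diff integrable_minus integrable_Re integrable_mult_right\<close>)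
  qed
  \<comment> \<open>The real part of \<open>exp \<kappa>\<close> is at most its modulus, which is
    the exponential of \<open>Re \<kappa>\<close>. So the lower bound 1/2 becomes
    \<open>- Re \<kappa> \<le> ln 2\<close> without any choice of logarithm.\<close>
  have bound: "\<theta>\<^sup>2 / 2 * (\<integral>s. (v n s)\<^sup>2 * \<beta> s \<partial>l) + (\<integral>s. c n \<theta> s \<partial>l) \<le> ln 2" if "N \<le> n" "\<bar>\<theta>\<bar> \<le> \<delta>" for n \<theta>
  proof -
    define \<kappa> where "\<kappa> = (\<integral>s. levy_exp \<alpha> \<beta> K (\<theta> * v n s) s \<partial>l)"
    have "(\<integral>s. indicator (space l) s *\<^sub>R levy_exp \<alpha> \<beta> K (\<theta> * v n s) s \<partial>l) = \<kappa>"
      unfolding \<kappa>_def by (intro Bochner_Integration.integral_cong) auto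
    then have "1 / 2 \<le> Re (exp \<kappa>)" using N[OF that] by simp
    also have "\<dots> \<le> exp (Re \<kappa>)" using complex_Re_le_cmod[of "exp \<kappa>"] by simp
    finally have "exp (- ln 2) \<le> exp (Re \<kappa>)" by (simp add: exp_minus)
    then have "- Re \<kappa> \<le> ln 2" by simp
    moreover have "Re \<kappa> = (\<integral>s. Re (levy_exp \<alpha> \<beta> K (\<theta> * v n s) s) \<partial>l)"
      unfolding \<kappa>_def by (rule integral_Re[symmetric, OF int_exp])
    moreover have "\<dots> = (\<integral>s. - (\<theta>\<^sup>2 / 2 * ((v n s)\<^sup>2 * \<beta> s)) - c n \<theta> s \<partial>l)"
      by (intro Bochner_Integration.integral_cong refl Re_c)
    moreover have "\<dots> = - (\<theta>\<^sup>2 / 2 * (\<integral>s. (v n s)\<^sup>2 * \<beta> s \<partial>l)) - (\<integral>s. c n \<theta> s \<partial>l)"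
      using int_gauss int_c by (subst Bochner_Integration.integral_diff) (auto intro!: integrable_minus integrable_mult_right)
    ultimately show ?thesis by simp
  qed
  have gauss_nonneg: "0 \<le> (\<integral>s. (v n s)\<^sup>2 * \<beta> s \<partial>l)" for n
    using \<beta> by (intro integral_nonneg_AE) (auto elim!: eventually_mono)
  have gauss_bound: "(\<integral>s. (v n s)\<^sup>2 * \<beta> s \<partial>l) \<le> 2 / \<delta>\<^sup>2 * ln 2" if n: "N \<le> n" for n
  proof -
    have "\<delta>\<^sup>2 / 2 * (\<integral>s. (v n s)\<^sup>2 * \<beta> s \<partial>l) \<le> ln 2"
    proof -
      have "0 \<le> (\<integral>s. c n \<delta> s \<partial>l)" by (intro Bochner_Integration.integral_nonneg c_nonneg)
      then show ?thesis using bound[OF n, of \<delta>] \<delta> by linarith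
    qed
    then show ?thesis using \<delta> by (simp add: field_simps)
  qed
  \<comment> \<open>The constant of \<open>truncated_moment_bound\<close>, with \<open>ln 2\<close>
    as the bound on the integrals of 1 - cos.\<close>
  define C where "C = (1 + (1 / \<delta>)\<^sup>2) * 12 * ln 2"
  have trunc_bound: "(\<integral>s. trunc2 K (v n s) s \<partial>l) \<le> C" if n: "N \<le> n" for n
    unfolding C_def
  proof (rule truncated_moment_bound[OF v int_trunc \<delta>])
    fix \<theta> assume "\<theta> \<in> {0..\<delta>}"
    then have \<theta>: "\<bar>\<theta>\<bar> \<le> \<delta>" by auto
    have "(\<integral>\<^sup>+s. (\<integral>\<^sup>+x. ennreal (1 - cos (\<theta> * (x * v n s))) \<partial>K s) \<partial>l) = (\<integral>\<^sup>+s. ennreal (c n \<theta> s) \<partial>l)"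
      unfolding c_def by (intro nn_integral_cong nn_integral_eq_integral int_cos) auto
    also have "\<dots> = ennreal (\<integral>s. c n \<theta> s \<partial>l)"
      using c_nonneg by (intro nn_integral_eq_integral int_c) auto
    also have "\<dots> \<le> ennreal (ln 2)"
      using bound[OF n \<theta>] mult_nonneg_nonneg[OF _ gauss_nonneg, of "\<theta>\<^sup>2 / 2" n] by (intro ennreal_leI) auto
    finally show "(\<integral>\<^sup>+s. (\<integral>\<^sup>+x. ennreal (1 - cos (\<theta> * (x * v n s))) \<partial>K s) \<partial>l) \<le> ennreal (ln 2)" .
  qed simp
  have bdd_drift: "Bseq (\<lambda>n. \<integral>s. indicator A s * drift \<alpha> K (v n s) s \<partial>l)" if A[measurable]: "A \<in> sets l" for A
  proof -
    obtain \<delta>' N' where \<delta>': "0 < \<delta>'"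
      and N': "\<And>n \<theta>. N' \<le> n \<Longrightarrow> \<bar>\<theta>\<bar> \<le> \<delta>' \<Longrightarrow> 1 / 2 \<le> Re (exp (\<integral>s. indicator A s *\<^sub>R levy_exp \<alpha> \<beta> K (\<theta> * v n s) s \<partial>l))"
      using half[OF A] by blast
    define D where "D = 2 + \<bar>\<delta>'\<bar> + \<delta>'\<^sup>2"
    have D: "0 \<le> D" by (simp add: D_def)
    \<comment> \<open>At \<theta> = \<delta>' the imaginary part of the exponent is \<delta>' times
      the drift integral plus a jump term. The whole is below pi/2 in modulus, and the jump term is
      at most D C by the bound on the truncated moments.\<close>
    have "\<bar>\<integral>s. indicator A s * drift \<alpha> K (v n s) s \<partial>l\<bar> \<le> (pi / 2 + D * C) / \<delta>'" if n: "max N N' \<le> n" for n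
    proof -
      define \<kappa> where "\<kappa> \<theta> = (\<integral>s. indicator A s *\<^sub>R levy_exp \<alpha> \<beta> K (\<theta> * v n s) s \<partial>l)" for \<theta>
      have int_\<kappa>: "integrable l (\<lambda>s. indicator A s *\<^sub>R levy_exp \<alpha> \<beta> K (\<theta> * v n s) s)" for \<theta>
        by (rule integrable_mult_indicator[OF A int_exp])
      \<comment> \<open>Positivity of the cosine fixes the argument only modulo full turns; the
        continuous path from \<theta> = 0, where the exponent is 0, keeps it in the principal
        range.\<close>
      have cont: "continuous_on {0..\<delta>'} \<kappa>"
        unfolding continuous_on_sequentially o_def
      proof (intro allI ballI impI)
        fix \<theta> :: "nat \<Rightarrow> real" and t assume "t \<in> {0..\<delta>'}" and \<theta>: "(\<forall>i. \<theta> i \<in> {0..\<delta>'}) \<and> \<theta> \<longlonglongrightarrow> t"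
        show "(\<lambda>i. \<kappa> (\<theta> i)) \<longlonglongrightarrow> \<kappa> t"
          unfolding \<kappa>_def
        proof (rule integral_dominated_convergence[where w="\<lambda>s. D * majorant \<alpha> \<beta> K (v n s) s"])
          show "integrable l (\<lambda>s. D * majorant \<alpha> \<beta> K (v n s) s)" using maj by simp
          show "AE s in l. (\<lambda>i. indicator A s *\<^sub>R levy_exp \<alpha> \<beta> K (\<theta> i * v n s) s) \<longlonglongrightarrow> indicator A s *\<^sub>R levy_exp \<alpha> \<beta> K (t * v n s) s"
            using \<theta> by (intro AE_I2 tendsto_scaleR tendsto_const levy_exp_tendsto[where K=K, OF levy] tendsto_mult) auto
          show "AE s in l. norm (indicator A s *\<^sub>R levy_exp \<alpha> \<beta> K (\<theta> i * v n s) s) \<le> D * majorant \<alpha> \<beta> K (v n s) s" for i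
          proof (rule AE_I2)
            fix s assume s: "s \<in> space l"
            have "norm (levy_exp \<alpha> \<beta> K (\<theta> i * v n s) s) \<le> (2 + \<bar>\<theta> i\<bar> + (\<theta> i)\<^sup>2) * majorant \<alpha> \<beta> K (v n s) s"
              by (rule levy_exp_le[where K=K, OF levy[OF s]])
            also have "\<dots> \<le> D * majorant \<alpha> \<beta> K (v n s) s"
            proof -
              have "0 \<le> \<theta> i" "\<theta> i \<le> \<delta>'" using \<theta> by auto
              then have "\<bar>\<theta> i\<bar> \<le> \<bar>\<delta>'\<bar>" "(\<theta> i)\<^sup>2 \<le> \<delta>'\<^sup>2" by (auto intro: power_mono)
              then show ?thesis unfolding D_def
                by (intro mult_right_mono majorant_nonneg[where K=K, OF levy[OF s]]) auto
            qed
            finally show "norm (indicator A s *\<^sub>R levy_exp \<alpha> \<beta> K (\<theta> i * v n s) s) \<le> D * majorant \<alpha> \<beta> K (v n s) s"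
              using D majorant_nonneg[where K=K, OF levy[OF s]] by (auto split: split_indicator)
          qed
        qed (use int_\<kappa> in auto)
      qed
      have \<kappa>_lt: "\<bar>Im (\<kappa> \<delta>')\<bar> < pi / 2"
      proof (rule abs_less_pi_half_of_cos_pos[of \<delta>' "\<lambda>\<theta>. Im (\<kappa> \<theta>)"])
        show "continuous_on {0..\<delta>'} (\<lambda>\<theta>. Im (\<kappa> \<theta>))" by (intro continuous_on_Im cont)
        show "Im (\<kappa> 0) = 0" by (simp add: \<kappa>_def levy_exp_0)
        fix \<theta> assume "\<theta> \<in> {0..\<delta>'}"
        then have "1 / 2 \<le> Re (exp (\<kappa> \<theta>))" using N'[of n \<theta>] n unfolding \<kappa>_def by auto
        then have "0 < exp (Re (\<kappa> \<theta>)) * cos (Im (\<kappa> \<theta>))" by (simp add: Re_exp)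
        then show "0 < cos (Im (\<kappa> \<theta>))" by (simp add: zero_less_mult_iff)
      qed (use \<delta>' in simp)
      define e where "e s = Im (\<integral>x. lk \<delta>' (x * v n s) \<partial>K s)" for s
      have Im_e: "Im (levy_exp \<alpha> \<beta> K (\<delta>' * v n s) s) = \<delta>' * drift \<alpha> K (v n s) s + e s" if s: "s \<in> space l" for s
        unfolding levy_exp_mult[where K=K, OF levy[OF s]] e_def by simp
      have int_e: "integrable l e"
      proof -
        have eq: "e s = Im (levy_exp \<alpha> \<beta> K (\<delta>' * v n s) s) - \<delta>' * drift \<alpha> K (v n s) s" if "s \<in> space l" for s
          using Im_e[OF that] by simp
        show ?thesis
          by (rule Bochner_Integration.integrable_cong[OF refl eq, THEN iffD2])
             (use int_exp int_drift in \<open>auto intro!: Bochner_Integration.integrable_diff integrable_Im integrable_mult_right\<close>)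
      qed
      have int_Ae: "integrable l (\<lambda>s. indicator A s * e s)" and int_Ad: "integrable l (\<lambda>s. indicator A s * drift \<alpha> K (v n s) s)"
        using integrable_mult_indicator[OF A int_e] integrable_mult_indicator[OF A int_drift] by auto
      have "Im (\<kappa> \<delta>') = (\<integral>s. Im (indicator A s *\<^sub>R levy_exp \<alpha> \<beta> K (\<delta>' * v n s) s) \<partial>l)"
        unfolding \<kappa>_def by (rule integral_Im[symmetric, OF int_\<kappa>])
      also have "\<dots> = (\<integral>s. \<delta>' * (indicator A s * drift \<alpha> K (v n s) s) + indicator A s * e s \<partial>l)"
        by (intro Bochner_Integration.integral_cong refl) (simp add: Im_e algebra_simps)
      also have "\<dots> = \<delta>' * (\<integral>s. indicator A s * drift \<alpha> K (v n s) s \<partial>l) + (\<integral>s. indicator A s * e s \<partial>l)"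
        using int_Ae int_Ad by simp
      finally have "Im (\<kappa> \<delta>') = \<delta>' * (\<integral>s. indicator A s * drift \<alpha> K (v n s) s \<partial>l) + (\<integral>s. indicator A s * e s \<partial>l)" .
      moreover have "\<bar>\<integral>s. indicator A s * e s \<partial>l\<bar> \<le> D * C"
      proof -
        have "norm (\<integral>s. indicator A s * e s \<partial>l) \<le> (\<integral>s. D * trunc2 K (v n s) s \<partial>l)"
        proof (rule norm_integral_le[OF int_Ae])
          fix s assume s: "s \<in> space l"
          have "\<bar>e s\<bar> \<le> D * trunc2 K (v n s) s"
            unfolding e_def D_def
            by (rule order_trans[OF abs_Im_le_cmod norm_integral_lk_le[where K=K, OF levy[OF s]]])
          then show "norm (indicator A s * e s) \<le> D * trunc2 K (v n s) s"
            using D trunc2_nonneg by (auto split: split_indicator)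
        qed (use int_trunc in simp)
        also have "\<dots> \<le> D * C" using trunc_bound[of n] n D by (simp add: mult_left_mono)
        finally show ?thesis by simp
      qed
      ultimately have "\<bar>\<delta>' * (\<integral>s. indicator A s * drift \<alpha> K (v n s) s \<partial>l)\<bar> \<le> pi / 2 + D * C" using \<kappa>_lt by linarith
      then show ?thesis using \<delta>' by (simp add: abs_mult field_simps)
    qed
    then show ?thesis by (rule Bseq_of_bounded_tail)
  qed
  have "integrable l (\<lambda>s. drift \<alpha> K (f s) s)"
    by (rule integrable_of_Bseq_AE_limit[OF int_drift lim_drift _ setwise_bounded_imp_Bseq[OF int_drift lim_drift bdd_drift]]) measurable
  moreover have "integrable l (\<lambda>s. (f s)\<^sup>2 * \<beta> s)"
  proof (rule integrable_of_Bseq_AE_limit[OF int_gauss lim_gauss])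
    have "(\<integral>s. \<bar>(v n s)\<^sup>2 * \<beta> s\<bar> \<partial>l) = (\<integral>s. (v n s)\<^sup>2 * \<beta> s \<partial>l)" for n
      by (rule integral_cong_AE) (use \<beta> in \<open>auto elim!: eventually_mono\<close>)
    then show "Bseq (\<lambda>n. \<integral>s. \<bar>(v n s)\<^sup>2 * \<beta> s\<bar> \<partial>l)"
      using gauss_bound gauss_nonneg by (intro Bseq_of_bounded_tail[of N _ "2 / \<delta>\<^sup>2 * ln 2"]) simp
  qed measurable
  moreover have "integrable l (\<lambda>s. trunc2 K (f s) s)"
  proof (rule integrable_of_Bseq_AE_limit[OF int_trunc lim_trunc])
    show "Bseq (\<lambda>n. \<integral>s. \<bar>trunc2 K (v n s) s\<bar> \<partial>l)"
      using trunc_bound by (intro Bseq_of_bounded_tail[of N _ C]) (simp add: trunc2_nonneg)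
  qed measurable
  ultimately have "integrable l (\<lambda>s. \<bar>drift \<alpha> K (f s) s\<bar> + \<bar>(f s)\<^sup>2 * \<beta> s\<bar> + trunc2 K (f s) s)"
    by (intro Bochner_Integration.integrable_add integrable_abs)
  then show ?thesis by (simp add: majorant_def abs_mult)
qed

end

section \<open>Integrability with respect to a quasi-infinitely divisible random measure\<close>

text \<open>The level sets of a general simple function lie only in the generated \<sigma>-algebra;
  cutting them with \<open>T n\<close> brings them into R. The factor 2 comes from the metric
  approximation of f, and cutting does not enlarge the values.\<close>

lemma (in delta_ring_on) ex_simple_approximation:
  assumes l: "sets l = sigma_sets S R" and f: "f \<in> borel_measurable l"
    and T: "range T \<subseteq> R" "incseq T" "(\<Union>n. T n) = S"
  shows "\<exists>g. (\<forall>n. simple_rep R (g n)) \<and> (\<forall>s\<in>S. (\<lambda>n. simple_value (g n) s) \<longlonglongrightarrow> f s) \<and>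
    (\<forall>n. \<forall>s\<in>S. \<bar>simple_value (g n) s\<bar> \<le> 2 * \<bar>f s :: real\<bar>)"
proof -
  have sp: "space l = S" using l sets.sets_into_space[of _ l] sets.top[of l] sigma_sets_top[of S R] sigma_sets_into_sp[OF space_closed] by blast
  obtain F where F: "\<And>i. simple_function l (F i)" "\<And>x. x \<in> space l \<Longrightarrow> (\<lambda>i. F i x) \<longlonglongrightarrow> f x"
    "\<And>i x. x \<in> space l \<Longrightarrow> dist (F i x) 0 \<le> 2 * dist (f x) 0"
    using borel_measurable_implies_sequence_metric[OF f, of 0] by blast
  have "\<exists>xs. set xs = F n ` S \<and> distinct xs" for n
    using F(1)[of n] by (intro finite_distinct_list) (simp add: simple_function_def sp)
  then obtain xs where xs: "\<And>n. set (xs n) = F n ` S" "\<And>n. distinct (xs n)" by metis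
  define A where "A n y = {s \<in> T n. F n s = y}" for n y
  define g where "g n = map (\<lambda>y. (y, A n y)) (xs n)" for n
  have T_R: "T n \<in> R" for n using T(1) by auto
  have TS: "T n \<subseteq> S" for n using T(3) by auto
  have A_R: "A n y \<in> R" for n y
  proof -
    have "F n -` {y} \<inter> space l \<in> sets l" using F(1) by (rule simple_functionD(2))
    then have "(F n -` {y} \<inter> space l) \<inter> T n \<in> R" using T_R by (intro sigma_sets_Int) (simp_all add: l)
    also have "(F n -` {y} \<inter> space l) \<inter> T n = A n y" using TS by (auto simp: A_def sp)
    finally show ?thesis .
  qed
  have g_val: "simple_value (g n) s = F n s * indicator (T n) s" if s: "s \<in> S" for n s
  proof -
    have "simple_value (g n) s = (\<Sum>j<length (xs n). xs n ! j * indicator (A n (xs n ! j)) s)"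
      unfolding simple_value_def g_def by (intro sum.cong) auto
    also have "\<dots> = (\<Sum>y\<in>F n ` S. y * indicator (A n y) s)"
      using sum.reindex_bij_betw[OF bij_betw_nth[OF xs(2) refl refl], of "\<lambda>y. y * indicator (A n y) s" n] by (simp add: xs(1))
    also have "\<dots> = (\<Sum>y\<in>F n ` S. if y = F n s then F n s * indicator (T n) s else 0)"
      by (intro sum.cong) (auto simp: A_def split: split_indicator)
    also have "\<dots> = F n s * indicator (T n) s"
    proof -
      have "finite (F n ` S)" unfolding xs(1)[symmetric] by simp
      then show ?thesis using s by (simp add: sum.delta)
    qed
    finally show ?thesis .
  qed
  show ?thesis
  proof (intro exI[of _ g] conjI allI ballI)
    show "simple_rep R (g n)" for n
      unfolding simple_rep_def
    proof (intro conjI allI impI)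
      show "disjoint_family_on (\<lambda>j. snd (g n ! j)) {..<length (g n)}"
        unfolding disjoint_family_on_def using xs(2)[of n] by (auto simp: g_def A_def nth_eq_iff_index_eq)
      show "snd (g n ! j) \<in> R" if "j < length (g n)" for j using that A_R by (simp add: g_def)
    qed
    fix s assume s: "s \<in> S"
    then obtain m where m: "s \<in> T m" using T(3) by auto
    have "s \<in> T n" if "m \<le> n" for n using m incseqD[OF T(2) that] by auto
    then have "eventually (\<lambda>n. simple_value (g n) s = F n s) sequentially"
      using s by (intro eventually_sequentiallyI[of m]) (simp add: g_val)
    moreover have "(\<lambda>n. F n s) \<longlonglongrightarrow> f s" using F(2) s by (simp add: sp)
    ultimately show "(\<lambda>n. simple_value (g n) s) \<longlonglongrightarrow> f s" by (simp add: tendsto_cong)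
    show "\<bar>simple_value (g n) s\<bar> \<le> 2 * \<bar>f s\<bar>" for n
      using F(3)[of s n] s by (auto simp: g_val sp split: split_indicator)
  qed
qed

text \<open>The exponent of L is the difference of two exponents of Levy type, and f is controlled
  by both majorants. How these bounds were obtained from \<Lambda>G and \<Lambda>M is immaterial
  from here on.\<close>

locale difference_measure =
  G: levy_chars l KG \<alpha>G \<beta>G R + M: levy_chars l KM \<alpha>M \<beta>M R +
  exponent_measure P S R L l "\<lambda>u s. levy_exp \<alpha>G \<beta>G KG u s - levy_exp \<alpha>M \<beta>M KM u s"
  for l :: "'s measure" and KG \<alpha>G \<beta>G KM \<alpha>M \<beta>M and P :: "'w measure" and S R L +
  fixes f :: "'s \<Rightarrow> real"
  assumes f [measurable]: "f \<in> borel_measurable l"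
    and majG: "integrable l (\<lambda>s. majorant \<alpha>G \<beta>G KG (f s) s)" and majM: "integrable l (\<lambda>s. majorant \<alpha>M \<beta>M KM (f s) s)"
begin

abbreviation "\<psi> u s \<equiv> levy_exp \<alpha>G \<beta>G KG u s - levy_exp \<alpha>M \<beta>M KM u s"

lemma \<psi>_tendsto: "s \<in> space l \<Longrightarrow> w \<longlonglongrightarrow> u \<Longrightarrow> (\<lambda>i. \<psi> (w i) s) \<longlonglongrightarrow> \<psi> u s"
  by (intro tendsto_diff levy_exp_tendsto[where K=KG, OF G.levy] levy_exp_tendsto[where K=KM, OF M.levy])

lemma integrable_\<psi>: "integrable l (\<lambda>s. \<psi> (\<theta> * f s) s)"
  by (intro Bochner_Integration.integrable_diff G.integrable_levy_exp[OF f majG] M.integrable_levy_exp[OF f majM])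

text \<open>Differences of two approximations, each at most 2 |f|, are at most 4 |f|. The constant
  170 is \<open>2 * (1 + 4) * (1 + 4\<^sup>2)\<close> from
  \<open>majorant_dilation_le\<close>.\<close>

lemma \<psi>_dilated_le:
  assumes s: "s \<in> space l" and w: "\<bar>w\<bar> \<le> 4 * \<bar>f s\<bar>"
  shows "cmod (\<psi> (\<theta> * w) s) \<le> (2 + \<bar>\<theta>\<bar> + \<theta>\<^sup>2) * 170 * (majorant \<alpha>G \<beta>G KG (f s) s + majorant \<alpha>M \<beta>M KM (f s) s)"
proof -
  have "cmod (\<psi> (\<theta> * w) s) \<le> cmod (levy_exp \<alpha>G \<beta>G KG (\<theta> * w) s) + cmod (levy_exp \<alpha>M \<beta>M KM (\<theta> * w) s)"
    by (rule norm_triangle_ineq4)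
  also have "\<dots> \<le> (2 + \<bar>\<theta>\<bar> + \<theta>\<^sup>2) * majorant \<alpha>G \<beta>G KG w s + (2 + \<bar>\<theta>\<bar> + \<theta>\<^sup>2) * majorant \<alpha>M \<beta>M KM w s"
    by (intro add_mono levy_exp_le[where K=KG, OF G.levy[OF s]] levy_exp_le[where K=KM, OF M.levy[OF s]])
  also have "\<dots> \<le> (2 + \<bar>\<theta>\<bar> + \<theta>\<^sup>2) * (170 * majorant \<alpha>G \<beta>G KG (f s) s) + (2 + \<bar>\<theta>\<bar> + \<theta>\<^sup>2) * (170 * majorant \<alpha>M \<beta>M KM (f s) s)"
    using majorant_dilation_le[where K=KG, OF G.levy[OF s] w, of \<alpha>G \<beta>G] majorant_dilation_le[where K=KM, OF M.levy[OF s] w, of \<alpha>M \<beta>M]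
    by (intro add_mono mult_left_mono) auto
  finally show ?thesis by (simp add: algebra_simps)
qed

lemma random_integrable:
  assumes T: "range T \<subseteq> R" "incseq T" "(\<Union>n. T n) = S"
  shows "random_integrable P S R l L f"
proof -
  let ?b = "\<lambda>\<theta> s. (2 + \<bar>\<theta>\<bar> + \<theta>\<^sup>2) * 170 * (majorant \<alpha>G \<beta>G KG (f s) s + majorant \<alpha>M \<beta>M KM (f s) s)"
  obtain g where g: "\<And>n. simple_rep R (g n)" "\<And>s. s \<in> S \<Longrightarrow> (\<lambda>n. simple_value (g n) s) \<longlonglongrightarrow> f s"
    "\<And>n s. s \<in> S \<Longrightarrow> \<bar>simple_value (g n) s\<bar> \<le> 2 * \<bar>f s\<bar>"
    using ex_simple_approximation[OF sets_l_eq f T] by blast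
  have "\<exists>Y. tendsto_in_prob P (\<lambda>n. simple_integral_on L A (g n)) Y" if A: "A \<in> sigma_sets S R" for A
  proof (rule Cauchy_in_prob_imp_tendsto)
    have X[measurable]: "simple_integral_on L A (g n) \<in> borel_measurable P" for n by (rule simple_integral_measurable[OF g(1) A])
    then show "simple_integral_on L A (g n) \<in> borel_measurable P" for n .
    fix e d :: real assume e: "0 < e" and d: "0 < d"
    show "\<exists>N. \<forall>m\<ge>N. \<forall>n\<ge>N. measure P {\<omega> \<in> space P. \<bar>simple_integral_on L A (g m) \<omega> - simple_integral_on L A (g n) \<omega>\<bar> > e} < d"
    proof (rule ccontr)
      assume nc: "\<not> ?thesis"
      define q where "q m n = measure P {\<omega> \<in> space P. \<bar>simple_integral_on L A (g m) \<omega> - simple_integral_on L A (g n) \<omega>\<bar> > e}" for m n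
      have "\<forall>N. \<exists>m n. N \<le> m \<and> N \<le> n \<and> d \<le> q m n"
        using nc unfolding q_def[symmetric] by (auto simp: not_less)
      \<comment> \<open>If the Cauchy property fails, there are index sequences tending to infinity
        along which the integrals stay apart with probability at least d. The differences w of the
        simple functions tend to 0 under the domination, so the characteristic functions of the
        differences of the integrals tend to 1, a contradiction.\<close>
      then obtain m n where mn: "\<And>N. N \<le> m N" "\<And>N. N \<le> n N" and "\<And>N. d \<le> q (m N) (n N)" by metis
      then have big: "\<And>N. d \<le> measure P {\<omega> \<in> space P. \<bar>simple_integral_on L A (g (m N)) \<omega> - simple_integral_on L A (g (n N)) \<omega>\<bar> > e}"
        by (simp add: q_def)
      have mn_lim: "filterlim m at_top sequentially" "filterlim n at_top sequentially"
        using mn by (auto intro: filterlim_at_top_mono[OF filterlim_ident])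
      define w where "w N s = simple_value (g (m N)) s - simple_value (g (n N)) s" for N s
      have w_lim: "(\<lambda>N. w N s) \<longlonglongrightarrow> 0" if "s \<in> S" for s
        using tendsto_diff[OF filterlim_compose[OF g(2)[OF that] mn_lim(1)] filterlim_compose[OF g(2)[OF that] mn_lim(2)]]
        by (simp add: w_def)
      have w_le: "\<bar>w N s\<bar> \<le> 4 * \<bar>f s\<bar>" if "s \<in> S" for N s
        using g(3)[OF that, of "m N"] g(3)[OF that, of "n N"] unfolding w_def by linarith
      have w_meas[measurable]: "w N \<in> borel_measurable l" for N
        unfolding w_def[abs_def] using G.measurable_simple_value[OF g(1)] by (intro borel_measurable_diff) auto
      have A_l[measurable]: "A \<in> sets l" using A by (simp add: sets_l_eq)
      have "(\<lambda>N. char (distr P borel (\<lambda>\<omega>. simple_integral_on L A (g (m N)) \<omega> - simple_integral_on L A (g (n N)) \<omega>)) \<theta>) \<longlonglongrightarrow> 1" for \<theta>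
      proof -
        have "(\<lambda>N. \<integral>s. indicator A s *\<^sub>R \<psi> (\<theta> * w N s) s \<partial>l) \<longlonglongrightarrow> (\<integral>s. 0 \<partial>l)"
        proof (rule integral_dominated_convergence[where w="\<lambda>s. ?b \<theta> s"])
          show "integrable l (\<lambda>s. ?b \<theta> s)"
            using majG majM by simp
          show "AE s in l. (\<lambda>N. indicator A s *\<^sub>R \<psi> (\<theta> * w N s) s) \<longlonglongrightarrow> 0"
          proof (rule AE_I2)
            fix s assume s: "s \<in> space l"
            then have "(\<lambda>N. \<psi> (\<theta> * w N s) s) \<longlonglongrightarrow> \<psi> (\<theta> * 0) s"
              by (intro \<psi>_tendsto tendsto_mult tendsto_const w_lim) (auto simp: space_l)
            then have "(\<lambda>N. indicator A s *\<^sub>R \<psi> (\<theta> * w N s) s) \<longlonglongrightarrow> indicator A s *\<^sub>R \<psi> (\<theta> * 0) s"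
              by (intro tendsto_scaleR tendsto_const)
            then show "(\<lambda>N. indicator A s *\<^sub>R \<psi> (\<theta> * w N s) s) \<longlonglongrightarrow> 0" by (simp add: levy_exp_0)
          qed
          show "AE s in l. norm (indicator A s *\<^sub>R \<psi> (\<theta> * w N s) s) \<le> ?b \<theta> s" for N
          proof (rule AE_I2)
            fix s assume s: "s \<in> space l"
            then show "norm (indicator A s *\<^sub>R \<psi> (\<theta> * w N s) s) \<le> ?b \<theta> s"
              using \<psi>_dilated_le[OF s w_le, of \<theta> N] norm_ge_zero[of "\<psi> (\<theta> * w N s) s"]
              by (auto simp: space_l split: split_indicator simp del: norm_ge_zero)
          qed
          show "(\<lambda>s. indicator A s *\<^sub>R \<psi> (\<theta> * w N s) s) \<in> borel_measurable l" for N
            using G.measurable_levy_exp_scaled[OF w_meas] M.measurable_levy_exp_scaled[OF w_meas] by measurable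
        qed simp
        then have "(\<lambda>N. exp (\<integral>s. indicator A s *\<^sub>R \<psi> (\<theta> * w N s) s \<partial>l)) \<longlonglongrightarrow> exp 0"
          by (intro tendsto_exp) simp
        then show ?thesis
          unfolding char_simple_integral_diff[OF g(1) g(1) A] w_def by simp
      qed
      then have "(\<lambda>N. measure P {\<omega> \<in> space P. \<bar>simple_integral_on L A (g (m N)) \<omega> - simple_integral_on L A (g (n N)) \<omega>\<bar> > e}) \<longlonglongrightarrow> 0"
        by (intro prob_gt_tendsto_0_of_char e) auto
      then have "d \<le> 0" by (rule LIMSEQ_le_const) (use big in auto)
      then show False using d by simp
    qed
  qed
  then have "approximating_sequence P S R l L f g"
    unfolding approximating_sequence_def using g by (auto simp: space_l intro!: AE_I2)
  then show ?thesis
    unfolding random_integrable_def using f by (auto simp: measurable_cong_sets[OF sets_l refl])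
qed

lemma char_random_integral:
  assumes X: "has_random_integral P S R l L f S X"
  shows "char (distr P borel X) \<theta> = exp (\<integral>s. \<psi> (\<theta> * f s) s \<partial>l)"
proof -
  obtain g where g: "approximating_sequence P S R l L f g" and gX: "tendsto_in_prob P (\<lambda>n. simple_integral_on L S (g n)) X"
    using X by (auto simp: has_random_integral_def)
  have rep: "\<And>n. simple_rep R (g n)" and lim: "AE s in l. (\<lambda>n. simple_value (g n) s) \<longlonglongrightarrow> f s"
    and conv: "\<And>A. A \<in> sigma_sets S R \<Longrightarrow> \<exists>Y. tendsto_in_prob P (\<lambda>n. simple_integral_on L A (g n)) Y"
    using g by (auto simp: approximating_sequence_def)
  have S: "S \<in> sigma_sets S R" by (rule sigma_sets_top)
  define v where "v n = simple_value (g n)" for n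
  have int_v: "integrable l (\<lambda>s. \<psi> (\<theta> * v n s) s)" for n
    using char_simple_integral(1)[OF rep S] unfolding v_def
    by (rule Bochner_Integration.integrable_cong[THEN iffD1, OF refl, rotated]) (simp add: space_l)
  \<comment> \<open>The simple functions of this sequence need not be dominated by f, so the
    integrals of d cannot be shown to vanish by domination; only their exponentials are shown to
    tend to 1.\<close>
  define d where "d n s = \<psi> (\<theta> * v n s) s - \<psi> (\<theta> * f s) s" for n s
  have int_d: "integrable l (d n)" for n unfolding d_def by (intro Bochner_Integration.integrable_diff int_v integrable_\<psi>)
  have lim_d: "AE s in l. (\<lambda>n. d n s) \<longlonglongrightarrow> 0"
    using lim AE_space
  proof eventually_elim
    fix s assume "(\<lambda>n. simple_value (g n) s) \<longlonglongrightarrow> f s" "s \<in> space l"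
    then have "(\<lambda>n. \<psi> (\<theta> * v n s) s) \<longlonglongrightarrow> \<psi> (\<theta> * f s) s"
      unfolding v_def by (intro \<psi>_tendsto tendsto_mult tendsto_const)
    from tendsto_diff[OF this tendsto_const[of "\<psi> (\<theta> * f s) s"]] show "(\<lambda>n. d n s) \<longlonglongrightarrow> 0"
      unfolding d_def by (simp only: diff_self)
  qed
  have exp_d: "exp (\<integral>s. indicator A s *\<^sub>R d n s \<partial>l)
      = char (distr P borel (simple_integral_on L A (g n))) \<theta> / exp (\<integral>s. indicator A s *\<^sub>R \<psi> (\<theta> * f s) s \<partial>l)"
    if A: "A \<in> sets l" for A n
  proof -
    have "(\<integral>s. indicator A s *\<^sub>R d n s \<partial>l) = (\<integral>s. indicator A s *\<^sub>R \<psi> (\<theta> * v n s) s - indicator A s *\<^sub>R \<psi> (\<theta> * f s) s \<partial>l)"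
      unfolding d_def by (simp only: scaleR_diff_right)
    also have "\<dots> = (\<integral>s. indicator A s *\<^sub>R \<psi> (\<theta> * v n s) s \<partial>l) - (\<integral>s. indicator A s *\<^sub>R \<psi> (\<theta> * f s) s \<partial>l)"
      by (intro Bochner_Integration.integral_diff integrable_mult_indicator[OF A] int_v integrable_\<psi>)
    finally show ?thesis
      using A char_simple_integral(2)[OF rep, of A n \<theta>] unfolding v_def by (simp add: exp_diff sets_l_eq)
  qed
  have meas: "simple_integral_on L A (g n) \<in> borel_measurable P" if "A \<in> sigma_sets S R" for A n
    by (rule simple_integral_measurable[OF rep that])
  have lim_1: "(\<lambda>n. exp (\<integral>s. d n s \<partial>l)) \<longlonglongrightarrow> 1"
  proof (rule G.exp_integral_tendsto_1[OF int_d lim_d])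
    fix A assume A: "A \<in> sets l"
    then obtain Y where Y: "tendsto_in_prob P (\<lambda>n. simple_integral_on L A (g n)) Y" using conv by (auto simp: sets_l_eq)
    have "(\<lambda>n. char (distr P borel (simple_integral_on L A (g n))) \<theta>) \<longlonglongrightarrow> char (distr P borel Y) \<theta>"
      using A by (intro tendsto_in_prob_char meas Y) (simp add: sets_l_eq)
    \<comment> \<open>Setwise convergence is all the gliding hump requires: the denominator is a
      fixed nonzero exponential, and the limit of the numerator may be any number.\<close>
    from tendsto_divide[OF this tendsto_const exp_not_eq_zero]
    show "convergent (\<lambda>n. exp (\<integral>s. indicator A s *\<^sub>R d n s \<partial>l))"
      unfolding exp_d[OF A] by (rule convergentI)
  qed
  have eq: "exp (\<integral>s. d n s \<partial>l) * exp (\<integral>s. \<psi> (\<theta> * f s) s \<partial>l) = char (distr P borel (simple_integral_on L S (g n))) \<theta>" for n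
  proof -
    have "(\<integral>s. indicator S s *\<^sub>R d n s \<partial>l) = (\<integral>s. d n s \<partial>l)" "(\<integral>s. indicator S s *\<^sub>R \<psi> (\<theta> * f s) s \<partial>l) = (\<integral>s. \<psi> (\<theta> * f s) s \<partial>l)"
      by (auto intro!: Bochner_Integration.integral_cong simp: space_l)
    then show ?thesis using exp_d[of S n] S by (simp add: sets_l_eq)
  qed
  have "(\<lambda>n. char (distr P borel (simple_integral_on L S (g n))) \<theta>) \<longlonglongrightarrow> 1 * exp (\<integral>s. \<psi> (\<theta> * f s) s \<partial>l)"
    unfolding eq[symmetric] by (intro tendsto_mult tendsto_const lim_1)
  moreover have "(\<lambda>n. char (distr P borel (simple_integral_on L S (g n))) \<theta>) \<longlonglongrightarrow> char (distr P borel X) \<theta>"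
    by (rule tendsto_in_prob_char[OF meas[OF S] gX])
  ultimately show ?thesis using LIMSEQ_unique by fastforce
qed

end

lemma lk_eq: "(\<lambda>x. iexp (\<theta> * x) - 1 - \<i> * of_real \<theta> * of_real (\<tau> x)) = lk \<theta>"
  by (simp add: lk_def fun_eq_iff)

lemma trunc2_mono:
  assumes "levy_measure (K s)" "levy_measure (K' s)"
    and "\<And>h. (\<integral>\<^sup>+x. h x \<partial>K s) \<le> (\<integral>\<^sup>+x. h x \<partial>K' s)"
  shows "trunc2 K u s \<le> trunc2 K' u s"
proof -
  have "ennreal (trunc2 K u s) = (\<integral>\<^sup>+x. ennreal (min 1 ((x * u)\<^sup>2)) \<partial>K s)"
    unfolding trunc2_def by (rule nn_integral_eq_integral[symmetric, OF integrable_min[where K=K, OF assms(1)]]) simp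
  also have "\<dots> \<le> (\<integral>\<^sup>+x. ennreal (min 1 ((x * u)\<^sup>2)) \<partial>K' s)" by (rule assms(3))
  also have "\<dots> = ennreal (trunc2 K' u s)"
    unfolding trunc2_def by (rule nn_integral_eq_integral[OF integrable_min[where K=K', OF assms(2)]]) simp
  finally show ?thesis by (simp add: trunc2_nonneg)
qed

text \<open>\<Lambda>M has location -\<nu>0 and no Gaussian part, hence the densities -a and 0.
  Subtracting its exponent from that of \<Lambda>G, which has location 0, restores the location a
  and keeps the Gaussian density \<sigma>2.\<close>

locale qid_integral = difference_measure l \<rho>G "\<lambda>_. 0" \<sigma>2 \<rho>M "\<lambda>s. - a s" "\<lambda>_. 0" P S R L f
  for l :: "'s measure" and \<rho>G \<rho>M :: "'s \<Rightarrow> real measure" and a \<sigma>2 :: "'s \<Rightarrow> real" and P :: "'w measure" and S R L f +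
  fixes \<rho> :: "'s \<Rightarrow> real set \<Rightarrow> real"
  assumes levy_diff: "\<And>s. s \<in> space l \<Longrightarrow> levy_diff (\<rho> s) (\<rho>G s) (\<rho>M s)"
begin

sublocale pos: levy_kernel_on l "\<lambda>s. ql_pos (\<rho> s)"
  by (rule levy_kernel_ql(1)[OF G.levy_kernel_on_axioms M.levy_kernel_on_axioms levy_diff])

sublocale neg: levy_kernel_on l "\<lambda>s. ql_neg (\<rho> s)"
  by (rule levy_kernel_ql(2)[OF G.levy_kernel_on_axioms M.levy_kernel_on_axioms levy_diff])

lemma U_fun_eq:
  assumes s: "s \<in> space l"
  shows "U_fun a \<rho> u s = drift (\<lambda>_. 0) \<rho>G u s - drift (\<lambda>s. - a s) \<rho>M u s"
proof -
  have "ql_integral (\<rho> s) (\<lambda>x. \<tau> (x * u) - u * \<tau> x) = (\<integral>x. \<tau> (x * u) - u * \<tau> x \<partial>\<rho>G s) - (\<integral>x. \<tau> (x * u) - u * \<tau> x \<partial>\<rho>M s)"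
    by (rule ql_integral_levy_diff_real[OF levy_diff[OF s] _ tau_dilation_le]) measurable
  then show ?thesis by (simp add: U_fun_def drift_def)
qed

lemma integrable_U_fun: "integrable l (\<lambda>s. U_fun a \<rho> (f s) s)"
  by (rule Bochner_Integration.integrable_cong[OF refl U_fun_eq, THEN iffD2])
     (auto intro!: Bochner_Integration.integrable_diff G.integrable_drift[OF f majG] M.integrable_drift[OF f majM])

lemma V0_fun_eq:
  assumes s: "s \<in> space l"
  shows "V0_fun \<rho> u s = ennreal (trunc2 (\<lambda>s. ql_pos (\<rho> s)) u s) + ennreal (trunc2 (\<lambda>s. ql_neg (\<rho> s)) u s)"
  unfolding V0_fun_def power2_abs pos.ennreal_trunc2[OF s] neg.ennreal_trunc2[OF s]
  by (rule nn_integral_ql_abs[OF levy_diff[OF s]]) measurable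

lemma trunc2_ql_le:
  assumes s: "s \<in> space l"
  shows "trunc2 (\<lambda>s. ql_pos (\<rho> s)) u s \<le> trunc2 \<rho>G u s" "trunc2 (\<lambda>s. ql_neg (\<rho> s)) u s \<le> trunc2 \<rho>M u s"
  by (auto intro!: trunc2_mono pos.levy neg.levy G.levy M.levy s nn_integral_ql_le[OF levy_diff[OF s]])

lemma integrable_trunc2_ql:
  "integrable l (\<lambda>s. trunc2 (\<lambda>s. ql_pos (\<rho> s)) (f s) s)" "integrable l (\<lambda>s. trunc2 (\<lambda>s. ql_neg (\<rho> s)) (f s) s)"
proof -
  have "(\<lambda>s. trunc2 (\<lambda>s. ql_pos (\<rho> s)) (f s) s) \<in> borel_measurable l"
    unfolding trunc2_def using integrable_min[where K="\<lambda>s. ql_pos (\<rho> s)", OF pos.levy] by (intro pos.real_joint) auto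
  then show "integrable l (\<lambda>s. trunc2 (\<lambda>s. ql_pos (\<rho> s)) (f s) s)"
    using trunc2_ql_le(1) by (intro Bochner_Integration.integrable_bound[OF G.integrable_trunc2[OF f majG]] AE_I2) (auto simp: trunc2_nonneg)
  have "(\<lambda>s. trunc2 (\<lambda>s. ql_neg (\<rho> s)) (f s) s) \<in> borel_measurable l"
    unfolding trunc2_def using integrable_min[where K="\<lambda>s. ql_neg (\<rho> s)", OF neg.levy] by (intro neg.real_joint) auto
  then show "integrable l (\<lambda>s. trunc2 (\<lambda>s. ql_neg (\<rho> s)) (f s) s)"
    using trunc2_ql_le(2) by (intro Bochner_Integration.integrable_bound[OF M.integrable_trunc2[OF f majM]] AE_I2) (auto simp: trunc2_nonneg)
qed

lemma V0_fun: "(\<lambda>s. V0_fun \<rho> (f s) s) \<in> borel_measurable l" "(\<integral>\<^sup>+s. V0_fun \<rho> (f s) s \<partial>l) < \<infinity>"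
proof -
  let ?h = "\<lambda>s. ennreal (trunc2 (\<lambda>s. ql_pos (\<rho> s)) (f s) s) + ennreal (trunc2 (\<lambda>s. ql_neg (\<rho> s)) (f s) s)"
  have m: "?h \<in> borel_measurable l" using integrable_trunc2_ql by auto
  then show "(\<lambda>s. V0_fun \<rho> (f s) s) \<in> borel_measurable l"
    by (rule measurable_cong[THEN iffD1, rotated]) (simp add: V0_fun_eq)
  have "(\<integral>\<^sup>+s. V0_fun \<rho> (f s) s \<partial>l) = (\<integral>\<^sup>+s. ?h s \<partial>l)" by (intro nn_integral_cong V0_fun_eq)
  also have "\<dots> = (\<integral>\<^sup>+s. ennreal (trunc2 (\<lambda>s. ql_pos (\<rho> s)) (f s) s) \<partial>l) + (\<integral>\<^sup>+s. ennreal (trunc2 (\<lambda>s. ql_neg (\<rho> s)) (f s) s) \<partial>l)"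
    using integrable_trunc2_ql by (intro nn_integral_add) auto
  also have "\<dots> < \<infinity>"
    using nn_integral_eq_integral[OF integrable_trunc2_ql(1)] nn_integral_eq_integral[OF integrable_trunc2_ql(2)]
    by (simp add: trunc2_nonneg)
  finally show "(\<integral>\<^sup>+s. V0_fun \<rho> (f s) s \<partial>l) < \<infinity>" .
qed

text \<open>Images of the Jordan parts of \<open>\<rho> s\<close>, averaged over s. Jumps of
  opposite sign from different points s may land in the same place, so \<open>Fp\<close> and
  \<open>Fm\<close> need not be the Jordan parts of \<open>Ff\<close>; this is why \<open>Ff\<close>
  is treated through \<open>levy_diff\<close>.\<close>

definition "Fp = mix l borel (pushed (\<lambda>s. ql_pos (\<rho> s)) f)"
definition "Fm = mix l borel (pushed (\<lambda>s. ql_neg (\<rho> s)) f)"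
definition "Ff B = measure Fp B - measure Fm B"

lemma levy_Fp: "levy_measure Fp"
  unfolding Fp_def by (rule pos.levy_mix_pushed[OF f integrable_trunc2_ql(1)])

lemma levy_Fm: "levy_measure Fm"
  unfolding Fm_def by (rule neg.levy_mix_pushed[OF f integrable_trunc2_ql(2)])

lemma levy_diff_Ff: "levy_diff Ff Fp Fm"
  by (simp add: levy_diff_def levy_Fp levy_Fm Ff_def)

lemma emeasure_Fp: "B \<in> sets borel \<Longrightarrow> emeasure Fp B = Ftilde_pos l \<rho> {(s, x). s \<in> S \<and> f s * x \<in> B - {0}}"
  unfolding Fp_def pos.emeasure_mix_pushed[OF f] Ftilde_pos_def
  by (intro nn_integral_cong) (auto simp: space_l split: split_indicator)

lemma emeasure_Fm: "B \<in> sets borel \<Longrightarrow> emeasure Fm B = Ftilde_neg l \<rho> {(s, x). s \<in> S \<and> f s * x \<in> B - {0}}"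
  unfolding Fm_def neg.emeasure_mix_pushed[OF f] Ftilde_neg_def
  by (intro nn_integral_cong) (auto simp: space_l split: split_indicator)

text \<open>The representation by differences is used twice: for \<open>Ff\<close>, to integrate
  against \<open>Fp\<close> and \<open>Fm\<close>, and for each \<open>\<rho> s\<close>, to pass
  from its Jordan parts to \<rho>G and \<rho>M, in which the exponent is written.\<close>

lemma ql_integral_Ff:
  "integrable l (\<lambda>s. (\<integral>x. lk \<theta> (x * f s) \<partial>\<rho>G s) - (\<integral>x. lk \<theta> (x * f s) \<partial>\<rho>M s))"
  "ql_integral Ff (lk \<theta>) = (\<integral>s. (\<integral>x. lk \<theta> (x * f s) \<partial>\<rho>G s) - (\<integral>x. lk \<theta> (x * f s) \<partial>\<rho>M s) \<partial>l)"
proof -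
  have m: "lk \<theta> \<in> borel_measurable borel" by measurable
  have lev: "integrable N (lk \<theta>)" if "levy_measure N" for N
    by (rule levy_measure_integrable[OF that m norm_lk_le])
  note p = mixture.complex[OF pos.mixture_pushed[OF f] lev[OF levy_Fp[unfolded Fp_def]] lev[OF pos.levy_pushed]]
  note n = mixture.complex[OF neg.mixture_pushed[OF f] lev[OF levy_Fm[unfolded Fm_def]] lev[OF neg.levy_pushed]]
  have eq: "(\<integral>x. lk \<theta> x \<partial>pushed (\<lambda>s. ql_pos (\<rho> s)) f s) - (\<integral>x. lk \<theta> x \<partial>pushed (\<lambda>s. ql_neg (\<rho> s)) f s)
      = (\<integral>x. lk \<theta> (x * f s) \<partial>\<rho>G s) - (\<integral>x. lk \<theta> (x * f s) \<partial>\<rho>M s)" if s: "s \<in> space l" for s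
  proof -
    have "ql_integral (\<rho> s) (\<lambda>x. lk \<theta> (x * f s)) = (\<integral>x. lk \<theta> (x * f s) \<partial>\<rho>G s) - (\<integral>x. lk \<theta> (x * f s) \<partial>\<rho>M s)"
      by (rule ql_integral_levy_diff[OF levy_diff[OF s] _ lk_dilated_le[where K=\<rho>G, OF G.levy[OF s]]]) measurable
    then show ?thesis
      unfolding ql_integral_def by (simp add: pos.integral_pushed[OF s m] neg.integral_pushed[OF s m] mult.commute)
  qed
  have "integrable l (\<lambda>s. (\<integral>x. lk \<theta> x \<partial>pushed (\<lambda>s. ql_pos (\<rho> s)) f s) - (\<integral>x. lk \<theta> x \<partial>pushed (\<lambda>s. ql_neg (\<rho> s)) f s))"
    using p(1) n(1) by (intro Bochner_Integration.integrable_diff)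
  then show "integrable l (\<lambda>s. (\<integral>x. lk \<theta> (x * f s) \<partial>\<rho>G s) - (\<integral>x. lk \<theta> (x * f s) \<partial>\<rho>M s))"
    by (rule Bochner_Integration.integrable_cong[OF refl eq, THEN iffD1, rotated -1])
  have "ql_integral Ff (lk \<theta>) = (\<integral>x. lk \<theta> x \<partial>Fp) - (\<integral>x. lk \<theta> x \<partial>Fm)"
    by (rule ql_integral_levy_diff[OF levy_diff_Ff m norm_lk_le])
  also have "\<dots> = (\<integral>s. (\<integral>x. lk \<theta> x \<partial>pushed (\<lambda>s. ql_pos (\<rho> s)) f s) \<partial>l) - (\<integral>s. (\<integral>x. lk \<theta> x \<partial>pushed (\<lambda>s. ql_neg (\<rho> s)) f s) \<partial>l)"
    unfolding Fp_def Fm_def using p(2) n(2) by simp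
  also have "\<dots> = (\<integral>s. (\<integral>x. lk \<theta> x \<partial>pushed (\<lambda>s. ql_pos (\<rho> s)) f s) - (\<integral>x. lk \<theta> x \<partial>pushed (\<lambda>s. ql_neg (\<rho> s)) f s) \<partial>l)"
    using p(1) n(1) by (intro Bochner_Integration.integral_diff[symmetric])
  also have "\<dots> = (\<integral>s. (\<integral>x. lk \<theta> (x * f s) \<partial>\<rho>G s) - (\<integral>x. lk \<theta> (x * f s) \<partial>\<rho>M s) \<partial>l)"
    by (intro Bochner_Integration.integral_cong refl eq)
  finally show "ql_integral Ff (lk \<theta>) = (\<integral>s. (\<integral>x. lk \<theta> (x * f s) \<partial>\<rho>G s) - (\<integral>x. lk \<theta> (x * f s) \<partial>\<rho>M s) \<partial>l)" .
qed

lemma char_has_random_integral: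
  assumes X: "has_random_integral P S R l L f S X"
  shows "char (distr P borel X) \<theta> = levy_khintchine (\<integral>s. U_fun a \<rho> (f s) s \<partial>l) (\<integral>s. \<bar>f s\<bar>\<^sup>2 * \<sigma>2 s \<partial>l) Ff \<theta>"
proof -
  have eq: "\<psi> (\<theta> * f s) s = \<i> * of_real (\<theta> * U_fun a \<rho> (f s) s) - of_real (\<theta>\<^sup>2 / 2 * ((f s)\<^sup>2 * \<sigma>2 s))
      + ((\<integral>x. lk \<theta> (x * f s) \<partial>\<rho>G s) - (\<integral>x. lk \<theta> (x * f s) \<partial>\<rho>M s))" if s: "s \<in> space l" for s
    unfolding levy_exp_mult[where K=\<rho>G, OF G.levy[OF s]] levy_exp_mult[where K=\<rho>M, OF M.levy[OF s]] U_fun_eq[OF s]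
    by (simp add: algebra_simps)
  have "(\<integral>s. \<psi> (\<theta> * f s) s \<partial>l) = (\<integral>s. \<i> * of_real (\<theta> * U_fun a \<rho> (f s) s) - of_real (\<theta>\<^sup>2 / 2 * ((f s)\<^sup>2 * \<sigma>2 s))
      + ((\<integral>x. lk \<theta> (x * f s) \<partial>\<rho>G s) - (\<integral>x. lk \<theta> (x * f s) \<partial>\<rho>M s)) \<partial>l)"
    by (intro Bochner_Integration.integral_cong refl eq)
  also have "\<dots> = (\<integral>s. \<i> * of_real (\<theta> * U_fun a \<rho> (f s) s) - of_real (\<theta>\<^sup>2 / 2 * ((f s)\<^sup>2 * \<sigma>2 s)) \<partial>l)
      + (\<integral>s. (\<integral>x. lk \<theta> (x * f s) \<partial>\<rho>G s) - (\<integral>x. lk \<theta> (x * f s) \<partial>\<rho>M s) \<partial>l)"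
    using integrable_U_fun G.integrable_gauss[OF f majG]
    by (intro Bochner_Integration.integral_add Bochner_Integration.integrable_diff integrable_mult_right integrable_of_real ql_integral_Ff)
  also have "(\<integral>s. \<i> * of_real (\<theta> * U_fun a \<rho> (f s) s) - of_real (\<theta>\<^sup>2 / 2 * ((f s)\<^sup>2 * \<sigma>2 s)) \<partial>l)
     = (\<integral>s. \<i> * of_real (\<theta> * U_fun a \<rho> (f s) s) \<partial>l) - (\<integral>s. of_real (\<theta>\<^sup>2 / 2 * ((f s)\<^sup>2 * \<sigma>2 s)) \<partial>l)"
    using integrable_U_fun G.integrable_gauss[OF f majG]
    by (intro Bochner_Integration.integral_diff integrable_mult_right integrable_of_real)
  also have "\<dots> = \<i> * of_real \<theta> * of_real (\<integral>s. U_fun a \<rho> (f s) s \<partial>l) - of_real (\<theta>\<^sup>2 / 2) * of_real (\<integral>s. (f s)\<^sup>2 * \<sigma>2 s \<partial>l)"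
    by (simp only: integral_mult_right_zero integral_complex_of_real) (simp only: of_real_mult mult.assoc)
  finally show ?thesis
    unfolding char_random_integral[OF X] levy_khintchine_def lk_eq ql_integral_Ff(2) power2_abs by simp
qed

text \<open>A quasi-Levy measure requires a distribution with that triplet; the law of the
  stochastic integral of f is one.\<close>

lemma quasi_levy_measure_Ff:
  assumes "range T \<subseteq> R" "incseq T" "(\<Union>n. T n) = S"
  shows "quasi_levy_measure Ff"
proof -
  obtain g where fm: "f \<in> borel_measurable (sigma S R)" and g: "approximating_sequence P S R l L f g"
    using random_integrable[OF assms] by (auto simp: random_integrable_def)
  then obtain X where X: "tendsto_in_prob P (\<lambda>n. simple_integral_on L S (g n)) X"
    unfolding approximating_sequence_def using sigma_sets_top by blast
  then have "has_random_integral P S R l L f S X"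
    using fm g by (auto simp: has_random_integral_def)
  from char_has_random_integral[OF this] show ?thesis
    unfolding quasi_levy_measure_def qid_triplet_def
    using X quasi_levy_type_levy_diff[OF levy_diff_Ff] real_distribution_distr[of X]
    by (intro exI conjI allI) (auto simp: tendsto_in_prob_def)
qed

end

section \<open>The control measures\<close>

text \<open>Replacing the kernel by the null measure outside A turns the integral over A into a
  mixture over the whole space.\<close>

lemma (in levy_kernel_on) mixture_on:
  assumes A: "A \<in> sets l" and N: "levy_measure N"
    and eq: "\<And>B. B \<in> sets borel \<Longrightarrow> emeasure N B = (\<integral>\<^sup>+s\<in>A. emeasure (K s) B \<partial>l)"
  shows "mixture l borel N (\<lambda>s. if s \<in> A then K s else null_measure borel)"
proof
  show "sets N = sets borel" by (rule sets_levy_measure[OF N])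
  show "sets (if s \<in> A then K s else null_measure borel) = sets borel" if "s \<in> space l" for s using that by simp
  fix B :: "real set" assume B: "B \<in> sets borel"
  have eq': "emeasure (if s \<in> A then K s else null_measure borel) B = emeasure (K s) B * indicator A s" for s
    by simp
  show "(\<lambda>s. emeasure (if s \<in> A then K s else null_measure borel) B) \<in> borel_measurable l"
    unfolding eq' using A measurable_kernel[OF B] by measurable
  show "emeasure N B = (\<integral>\<^sup>+s. emeasure (if s \<in> A then K s else null_measure borel) B \<partial>l)"
    unfolding eq' by (rule eq[OF B])
qed

text \<open>The first identity gives the jump part of a control measure a density with respect to l;
  the third does the same for the jump part of an exponent.\<close>

lemma (in levy_kernel_on) integrals_on:
  assumes A: "A \<in> sets l" and N: "levy_measure N"
    and eq: "\<And>B. B \<in> sets borel \<Longrightarrow> emeasure N B = (\<integral>\<^sup>+s\<in>A. emeasure (K s) B \<partial>l)"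
  shows "(\<integral>\<^sup>+x. ennreal (min 1 (x\<^sup>2)) \<partial>N) = (\<integral>\<^sup>+s. ennreal (indicator A s * trunc2 K 1 s) \<partial>l)"
    and "integrable l (\<lambda>s. indicator A s * trunc2 K 1 s)"
    and "(\<integral>x. lk \<theta> x \<partial>N) = (\<integral>s. indicator A s *\<^sub>R (\<integral>x. lk \<theta> x \<partial>K s) \<partial>l)"
    and "integrable l (\<lambda>s. indicator A s *\<^sub>R (\<integral>x. lk \<theta> x \<partial>K s))"
proof -
  define Ns where "Ns s = (if s \<in> A then K s else null_measure borel)" for s
  interpret mixture l borel N Ns
    using mixture_on[OF assms] unfolding Ns_def .
  have "(\<integral>\<^sup>+x. ennreal (min 1 (x\<^sup>2)) \<partial>N) = (\<integral>\<^sup>+s. (\<integral>\<^sup>+x. ennreal (min 1 (x\<^sup>2)) \<partial>Ns s) \<partial>l)"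
    using nn[of "\<lambda>x. ennreal (min 1 (x\<^sup>2))"] by simp
  also have "\<dots> = (\<integral>\<^sup>+s. ennreal (indicator A s * trunc2 K 1 s) \<partial>l)"
    using nn_integral_eq_integral[OF integrable_min[where K=K and u=1, OF levy]]
    by (intro nn_integral_cong) (auto simp: Ns_def trunc2_def split: split_indicator)
  finally show *: "(\<integral>\<^sup>+x. ennreal (min 1 (x\<^sup>2)) \<partial>N) = (\<integral>\<^sup>+s. ennreal (indicator A s * trunc2 K 1 s) \<partial>l)" .
  have i1: "integrable (K s) (\<lambda>x. min 1 (x\<^sup>2))" if "s \<in> space l" for s
    using integrable_min[where K=K and u=1, OF levy[OF that]] by simp
  have "(\<lambda>s. \<integral>x. min 1 (x\<^sup>2) \<partial>K s) \<in> borel_measurable l"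
    by (rule real_joint[OF _ i1]) measurable
  then have "(\<lambda>s. trunc2 K 1 s) \<in> borel_measurable l"
    by (simp add: trunc2_def)
  then show "integrable l (\<lambda>s. indicator A s * trunc2 K 1 s)"
    using A levy_measure_msq[OF N] unfolding * by (intro integrableI_nonneg) (auto simp: trunc2_nonneg)
  have m: "lk \<theta> \<in> borel_measurable borel" by measurable
  have i: "integrable N (lk \<theta>)" by (rule levy_measure_integrable[OF N m norm_lk_le])
  have iNs: "integrable (Ns s) (lk \<theta>)" if "s \<in> space l" for s
    using integrable_lk[where K=K, OF levy[OF that]] by (auto simp: Ns_def)
  have e: "(\<integral>x. lk \<theta> x \<partial>Ns s) = indicator A s *\<^sub>R (\<integral>x. lk \<theta> x \<partial>K s)" for s by (simp add: Ns_def)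
  show "(\<integral>x. lk \<theta> x \<partial>N) = (\<integral>s. indicator A s *\<^sub>R (\<integral>x. lk \<theta> x \<partial>K s) \<partial>l)" "integrable l (\<lambda>s. indicator A s *\<^sub>R (\<integral>x. lk \<theta> x \<partial>K s))"
    using complex[OF i iNs] unfolding e by auto
qed

lemma (in levy_chars) levy_exp_on:
  assumes A: "A \<in> R" and N: "levy_measure N"
    and eq: "\<And>B. B \<in> sets borel \<Longrightarrow> emeasure N B = (\<integral>\<^sup>+s\<in>A. emeasure (K s) B \<partial>l)"
    and i: "integrable l (\<lambda>s. indicator A s * \<alpha> s)" "integrable l (\<lambda>s. indicator A s * \<beta> s)"
  shows "(\<integral>s. indicator A s *\<^sub>R levy_exp \<alpha> \<beta> K \<theta> s \<partial>l)
    = \<i> * of_real \<theta> * of_real (\<integral>s. indicator A s * \<alpha> s \<partial>l) - of_real (\<theta>\<^sup>2 / 2) * of_real (\<integral>s. indicator A s * \<beta> s \<partial>l) + (\<integral>x. lk \<theta> x \<partial>N)"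
proof -
  have Al: "A \<in> sets l" using A R_sets by auto
  note K = integrals_on[OF Al N eq]
  have "(\<integral>s. indicator A s *\<^sub>R levy_exp \<alpha> \<beta> K \<theta> s \<partial>l) = (\<integral>s. (\<i> * of_real (\<theta> * (indicator A s * \<alpha> s)) - of_real (\<theta>\<^sup>2 / 2 * (indicator A s * \<beta> s))) + indicator A s *\<^sub>R (\<integral>x. lk \<theta> x \<partial>K s) \<partial>l)"
    by (intro Bochner_Integration.integral_cong refl) (simp add: levy_exp_def split: split_indicator)
  also have "\<dots> = (\<integral>s. \<i> * of_real (\<theta> * (indicator A s * \<alpha> s)) - of_real (\<theta>\<^sup>2 / 2 * (indicator A s * \<beta> s)) \<partial>l) + (\<integral>s. indicator A s *\<^sub>R (\<integral>x. lk \<theta> x \<partial>K s) \<partial>l)"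
    using i by (intro Bochner_Integration.integral_add Bochner_Integration.integrable_diff integrable_mult_right integrable_of_real K)
  also have "(\<integral>s. \<i> * of_real (\<theta> * (indicator A s * \<alpha> s)) - of_real (\<theta>\<^sup>2 / 2 * (indicator A s * \<beta> s)) \<partial>l)
    = (\<integral>s. \<i> * of_real (\<theta> * (indicator A s * \<alpha> s)) \<partial>l) - (\<integral>s. of_real (\<theta>\<^sup>2 / 2 * (indicator A s * \<beta> s)) \<partial>l)"
    using i by (intro Bochner_Integration.integral_diff integrable_mult_right integrable_of_real)
  also have "\<dots> = \<i> * of_real \<theta> * of_real (\<integral>s. indicator A s * \<alpha> s \<partial>l) - of_real (\<theta>\<^sup>2 / 2) * of_real (\<integral>s. indicator A s * \<beta> s \<partial>l)"
    by (simp only: integral_mult_right_zero integral_complex_of_real) (simp only: of_real_mult mult.assoc)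
  also have "(\<integral>s. indicator A s *\<^sub>R (\<integral>x. lk \<theta> x \<partial>K s) \<partial>l) = (\<integral>x. lk \<theta> x \<partial>N)"
    by (rule K(3)[symmetric])
  finally show ?thesis .
qed

lemma levy_diff_null_measure: "levy_measure M \<Longrightarrow> levy_diff (measure M) M (null_measure borel)"
  by (simp add: levy_diff_def levy_measure_def measure_def)

lemma ql_integral_measure:
  assumes "levy_measure M"
  shows "ql_integral (measure M) (lk \<theta>) = (\<integral>x. lk \<theta> x \<partial>M)"
  using ql_integral_levy_diff[OF levy_diff_null_measure[OF assms] _ norm_lk_le, of \<theta>] by simp

lemma AE_of_sigma_exhaustion:
  fixes T :: "nat \<Rightarrow> 's set"
  assumes "(\<Union>n. T n) = space l" and "\<And>n. AE s in l. s \<in> T n \<longrightarrow> Q s"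
  shows "AE s in l. Q s"
proof -
  have "AE s in l. \<forall>n. s \<in> T n \<longrightarrow> Q s" unfolding AE_all_countable using assms(2) by blast
  then show ?thesis using AE_space by eventually_elim (use assms(1) in blast)
qed

lemma AE_indicator_mult_eq_0:
  fixes h :: "'s \<Rightarrow> real"
  assumes "integrable l (\<lambda>s. indicator A s * h s)" "\<And>s. s \<in> A \<Longrightarrow> 0 \<le> h s" "(\<integral>s. indicator A s * h s \<partial>l) \<le> 0"
  shows "AE s in l. s \<in> A \<longrightarrow> h s = 0"
proof -
  have n: "AE s in l. 0 \<le> indicator A s * h s" using assms(2) by (auto split: split_indicator)
  have "(\<integral>s. indicator A s * h s \<partial>l) = 0" using assms(3) integral_nonneg_AE[OF n] by simp
  then have "AE s in l. indicator A s * h s = 0" using integral_nonneg_eq_0_iff_AE[OF assms(1) n] by simp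
  then show ?thesis by eventually_elim auto
qed

lemma majorant_1: "majorant \<alpha> \<beta> K 1 s = \<bar>\<alpha> s\<bar> + \<bar>\<beta> s\<bar> + trunc2 K 1 s"
  by (simp add: majorant_def drift_1)

text \<open>Convergence almost everywhere for the smaller control measure suffices: where it fails, the
  local characteristics vanish.\<close>

lemma AE_control_measure:
  assumes D: "delta_ring_on S R" and sl: "sets l = sigma_sets S R" "space l = S" and sm: "sets m = sets l"
    and T: "range T \<subseteq> R" "(\<Union>n::nat. T n) = S"
    and null: "\<And>A. A \<in> R \<Longrightarrow> emeasure m A = 0 \<Longrightarrow> AE s in l. s \<in> A \<longrightarrow> Z s"
    and Q: "{s \<in> space l. Q s} \<in> sets l" and ae: "AE s in m. Q s"
  shows "AE s in l. Q s \<or> Z s"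
proof -
  define N where "N = {s \<in> space l. \<not> Q s}"
  have N: "N \<in> sets l"
  proof -
    have "N = space l - {s \<in> space l. Q s}" by (auto simp: N_def)
    then show ?thesis using Q by auto
  qed
  have "space m = space l" using sm by (rule sets_eq_imp_space_eq)
  then have N0: "emeasure m N = 0"
    using ae N sm unfolding N_def by (subst (asm) AE_iff_measurable[of "{s \<in> space l. \<not> Q s}"]) auto
  have "AE s in l. s \<in> N \<longrightarrow> Z s"
  proof (rule AE_of_sigma_exhaustion[where T=T])
    show "(\<Union>n. T n) = space l" using T(2) sl(2) by simp
    fix n
    \<comment> \<open>The smaller control measure is described by the characteristics only on
      members of R, so the exceptional set is cut into such pieces.\<close>
    have NT: "N \<inter> T n \<in> R" using N T(1) unfolding sl(1) by (intro delta_ring_on.sigma_sets_Int[OF D]) auto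
    have "emeasure m (N \<inter> T n) \<le> emeasure m N" using N sm by (intro emeasure_mono) auto
    then have "AE s in l. s \<in> N \<inter> T n \<longrightarrow> Z s" using N0 NT by (intro null) auto
    then show "AE s in l. s \<in> T n \<longrightarrow> (s \<in> N \<longrightarrow> Z s)" by eventually_elim auto
  qed
  then show ?thesis using AE_space by eventually_elim (auto simp: N_def)
qed

theorem theorem5p12:
  fixes S :: "'s set" and R :: "'s set set"
    and P :: "'w measure" and PG :: "'g measure" and PM :: "'m measure"
    and \<Lambda> :: "'s set \<Rightarrow> 'w \<Rightarrow> real" and \<Lambda>G :: "'s set \<Rightarrow> 'g \<Rightarrow> real" and \<Lambda>M :: "'s set \<Rightarrow> 'm \<Rightarrow> real"
    and \<nu>0 \<nu>1 :: "'s set \<Rightarrow> real"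
    and G M :: "'s set \<Rightarrow> real measure" and F :: "'s set \<Rightarrow> real set \<Rightarrow> real"
    and l lG lM :: "'s measure"
    and a \<sigma>2 :: "'s \<Rightarrow> real"
    and \<rho>G \<rho>M :: "'s \<Rightarrow> real measure" and \<rho> :: "'s \<Rightarrow> real set \<Rightarrow> real"
    and f :: "'s \<Rightarrow> real"
  assumes "S \<noteq> {}" and "delta_ring S R"
    and "\<exists>T::nat \<Rightarrow> 's set. range T \<subseteq> R \<and> incseq T \<and> (\<Union>n. T n) = S"
    and "signed_measure_on R \<nu>0" and "finite_measure_on R \<nu>1"
    and "\<And>A. A \<in> R \<Longrightarrow> levy_measure (G A)" and "\<And>A. A \<in> R \<Longrightarrow> levy_measure (M A)"
    and "\<And>B. B \<in> Borel0 \<Longrightarrow> finite_measure_on R (\<lambda>A. measure (G A) B)"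
    and "\<And>B. B \<in> Borel0 \<Longrightarrow> finite_measure_on R (\<lambda>A. measure (M A) B)"
    and "\<And>A B. A \<in> R \<Longrightarrow> B \<in> Borel0 \<Longrightarrow> F A B = measure (G A) B - measure (M A) B"
    and "qid_random_measure P R \<Lambda> \<nu>0 \<nu>1 F"
    and "id_random_measure PG R \<Lambda>G (\<lambda>A. 0) \<nu>1 G"
    and "id_random_measure PM R \<Lambda>M (\<lambda>A. - \<nu>0 A) (\<lambda>A. 0) M"
    and "measure_extension S R
           (\<lambda>A. total_variation R \<nu>0 A + ennreal (\<nu>1 A)
                + (\<integral>\<^sup>+x. ennreal (min 1 (x\<^sup>2)) \<partial>G A) + (\<integral>\<^sup>+x. ennreal (min 1 (x\<^sup>2)) \<partial>M A)) l"
    and "measure_extension S R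
           (\<lambda>A. ennreal (\<nu>1 A) + (\<integral>\<^sup>+x. ennreal (min 1 (x\<^sup>2)) \<partial>G A)) lG"
    and "measure_extension S R
           (\<lambda>A. total_variation R \<nu>0 A + (\<integral>\<^sup>+x. ennreal (min 1 (x\<^sup>2)) \<partial>M A)) lM"
    and "RN_derivative_on R l \<nu>0 a" and "RN_derivative_on R l \<nu>1 \<sigma>2"
    and "levy_kernel S R \<rho>G" and "levy_kernel S R \<rho>M"
    and "\<And>A B. A \<in> R \<Longrightarrow> B \<in> sets borel \<Longrightarrow>
           emeasure (G A) B = (\<integral>\<^sup>+s\<in>A. emeasure (\<rho>G s) B \<partial>l)"
    and "\<And>A B. A \<in> R \<Longrightarrow> B \<in> sets borel \<Longrightarrow>
           emeasure (M A) B = (\<integral>\<^sup>+s\<in>A. emeasure (\<rho>M s) B \<partial>l)"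
    and "\<And>s B. s \<in> S \<Longrightarrow> B \<in> Borel0 \<Longrightarrow> \<rho> s B = measure (\<rho>G s) B - measure (\<rho>M s) B"
    and "f \<in> borel_measurable (sigma S R)"
    and "random_integrable PG S R lG \<Lambda>G f"
    and "random_integrable PM S R lM \<Lambda>M f"
  shows "integrable l (\<lambda>s. U_fun a \<rho> (f s) s) \<and>
    integrable l (\<lambda>s. \<bar>f s\<bar>\<^sup>2 * \<sigma>2 s) \<and>
    ((\<lambda>s. V0_fun \<rho> (f s) s) \<in> borel_measurable l \<and> (\<integral>\<^sup>+s. V0_fun \<rho> (f s) s \<partial>l) < \<infinity>) \<and>
    random_integrable P S R l \<Lambda> f \<and>
    (\<exists>Fp Fm Ff.
           levy_measure Fp \<and> levy_measure Fm \<and>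
           (\<forall>B\<in>sets borel. emeasure Fp B = Ftilde_pos l \<rho> {(s, x). s \<in> S \<and> f s * x \<in> B - {0}}) \<and>
           (\<forall>B\<in>sets borel. emeasure Fm B = Ftilde_neg l \<rho> {(s, x). s \<in> S \<and> f s * x \<in> B - {0}}) \<and>
           quasi_levy_measure Ff \<and>
           (\<forall>B\<in>Borel0. Ff B = measure Fp B - measure Fm B) \<and>
           (\<forall>X. has_random_integral P S R l \<Lambda> f S X \<longrightarrow>
             (\<forall>\<theta>. (CLINT \<omega>|P. iexp (\<theta> * X \<omega>)) =
               exp (\<i> * of_real \<theta> * of_real (\<integral>s. U_fun a \<rho> (f s) s \<partial>l)
                    - of_real (\<theta>\<^sup>2 / 2) * of_real (\<integral>s. \<bar>f s\<bar>\<^sup>2 * \<sigma>2 s \<partial>l)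
                    + ql_integral Ff (\<lambda>x. iexp (\<theta> * x) - 1 - \<i> * of_real \<theta> * of_real (\<tau> x))))))"
proof -
  let ?kG = "levy_exp (\<lambda>_. 0) \<sigma>2 \<rho>G" and ?kM = "levy_exp (\<lambda>s. - a s) (\<lambda>_. 0) \<rho>M"
  let ?mG = "majorant (\<lambda>_. 0) \<sigma>2 \<rho>G" and ?mM = "majorant (\<lambda>s. - a s) (\<lambda>_. 0) \<rho>M"
  interpret D: delta_ring_on S R using assms(2) by unfold_locales
  obtain T where T: "range T \<subseteq> R" "incseq T" "(\<Union>n::nat. T n) = S" using assms(3) by blast
  have sets_l: "sets l = sets (sigma S R)" "sets lG = sets l" "sets lM = sets l" and "sigma_finite_measure l"
    and l_G: "\<And>A. A \<in> R \<Longrightarrow> emeasure lG A = ennreal (\<nu>1 A) + (\<integral>\<^sup>+x. ennreal (min 1 (x\<^sup>2)) \<partial>G A)"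
    and l_M: "\<And>A. A \<in> R \<Longrightarrow> emeasure lM A = total_variation R \<nu>0 A + (\<integral>\<^sup>+x. ennreal (min 1 (x\<^sup>2)) \<partial>M A)"
    using assms(14,15,16) by (auto simp: measure_extension_def)
  have sl: "sets l = sigma_sets S R" using sets_l(1) D.space_closed by (simp add: sets_measure_of)
  have spl: "space l = S" using sets_eq_imp_space_eq[OF sets_l(1)] D.space_closed by (simp add: space_measure_of)
  have Rl: "A \<in> R \<Longrightarrow> A \<in> sets l" for A unfolding sl by (rule sigma_sets.Basic)
  have IntR: "A \<in> sets l \<Longrightarrow> B \<in> R \<Longrightarrow> A \<inter> B \<in> R" for A B unfolding sl by (rule D.sigma_sets_Int)
  have fm[measurable]: "f \<in> borel_measurable l"
    using assms(24) by (simp add: measurable_cong_sets[OF sets_l(1) refl])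
  have a[measurable]: "a \<in> borel_measurable l" and \<sigma>[measurable]: "\<sigma>2 \<in> borel_measurable l"
    and int_a: "\<And>A. A \<in> R \<Longrightarrow> integrable l (\<lambda>s. indicator A s * a s)" "\<And>A. A \<in> R \<Longrightarrow> \<nu>0 A = (\<integral>s. indicator A s * a s \<partial>l)"
    and int_\<sigma>: "\<And>A. A \<in> R \<Longrightarrow> integrable l (\<lambda>s. indicator A s * \<sigma>2 s)" "\<And>A. A \<in> R \<Longrightarrow> \<nu>1 A = (\<integral>s. indicator A s * \<sigma>2 s \<partial>l)"
    using assms(17,18) by (auto simp: RN_derivative_on_def set_integrable_def set_lebesgue_integral_def)
  have int_a': "integrable l (\<lambda>s. indicator A s * - a s)" if "A \<in> R" for A using int_a(1)[OF that] by simp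
  have kernel: "levy_kernel_on l \<rho>G" "levy_kernel_on l \<rho>M"
    using assms(19,20) \<open>sigma_finite_measure l\<close>
    by (auto simp: levy_kernel_def spl measurable_cong_sets[OF sets_l(1) refl]
        intro!: levy_kernel_on.intro levy_kernel_on_axioms.intro)
  note onG = levy_kernel_on.integrals_on[OF kernel(1) Rl assms(6) assms(21)]
    and onM = levy_kernel_on.integrals_on[OF kernel(2) Rl assms(7) assms(22)]
  have chars: "levy_chars l \<rho>G (\<lambda>_. 0) \<sigma>2 R" "levy_chars l \<rho>M (\<lambda>s. - a s) (\<lambda>_. 0) R"
  proof -
    have "integrable l (\<lambda>s. indicator A s * ?mG 1 s)" if A: "A \<in> R" for A
    proof -
      have "integrable l (\<lambda>s. \<bar>indicator A s * \<sigma>2 s\<bar> + indicator A s * trunc2 \<rho>G 1 s)"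
        using int_\<sigma>(1)[OF A] onG(2)[OF A A A] by (intro Bochner_Integration.integrable_add integrable_abs)
      then show ?thesis by (simp add: majorant_1 abs_mult distrib_left)
    qed
    then show "levy_chars l \<rho>G (\<lambda>_. 0) \<sigma>2 R"
      using Rl by (intro levy_chars.intro kernel levy_chars_axioms.intro) auto
    have "integrable l (\<lambda>s. indicator A s * ?mM 1 s)" if A: "A \<in> R" for A
    proof -
      have "integrable l (\<lambda>s. \<bar>indicator A s * a s\<bar> + indicator A s * trunc2 \<rho>M 1 s)"
        using int_a(1)[OF A] onM(2)[OF A A A] by (intro Bochner_Integration.integrable_add integrable_abs)
      then show ?thesis by (simp add: majorant_1 abs_mult distrib_left)
    qed
    then show "levy_chars l \<rho>M (\<lambda>s. - a s) (\<lambda>_. 0) R"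
      using Rl by (intro levy_chars.intro kernel levy_chars_axioms.intro) auto
  qed
  interpret G: levy_chars l \<rho>G "\<lambda>_. 0" \<sigma>2 R by (rule chars)
  interpret M: levy_chars l \<rho>M "\<lambda>s. - a s" "\<lambda>_. 0" R by (rule chars)
  have exp_G: "(\<integral>s. indicator A s *\<^sub>R ?kG \<theta> s \<partial>l) = - of_real (\<theta>\<^sup>2 / 2) * of_real (\<nu>1 A) + (\<integral>x. lk \<theta> x \<partial>G A)"
    if A: "A \<in> R" for A \<theta>
    using G.levy_exp_on[OF A assms(6)[OF A] assms(21)[OF A] _ int_\<sigma>(1)[OF A], of \<theta>] int_\<sigma>(2)[OF A] by simp
  have exp_M: "(\<integral>s. indicator A s *\<^sub>R ?kM \<theta> s \<partial>l) = - (\<i> * of_real \<theta> * of_real (\<nu>0 A)) + (\<integral>x. lk \<theta> x \<partial>M A)"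
    if A: "A \<in> R" for A \<theta>
    using M.levy_exp_on[OF A assms(7)[OF A] assms(22)[OF A] int_a'[OF A], of \<theta>] int_a(2)[OF A] by simp
  have scat: "scattered P S R \<Lambda>" "scattered PG S R \<Lambda>G" "scattered PM S R \<Lambda>M"
    using assms(2,11,12,13)
    by (auto simp: qid_random_measure_def id_random_measure_def indep_scattered_def
        intro!: scattered.intro scattered_axioms.intro delta_ring_on.intro)
  have E_G: "exponent_measure PG S R \<Lambda>G l (?kG)"
  proof (intro exponent_measure.intro scat exponent_measure_axioms.intro sets_l)
    fix A \<theta> assume A: "A \<in> R"
    show "integrable l (\<lambda>s. indicator A s *\<^sub>R ?kG \<theta> s)" by (rule G.integrable_levy_exp_on[OF A])
    have "char (distr PG borel (\<Lambda>G A)) \<theta> = levy_khintchine 0 (\<nu>1 A) (measure (G A)) \<theta>"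
      using assms(12) A by (auto simp: id_random_measure_def id_triplet_def qid_triplet_def)
    then show "char (distr PG borel (\<Lambda>G A)) \<theta> = exp (\<integral>s. indicator A s *\<^sub>R ?kG \<theta> s \<partial>l)"
      unfolding levy_khintchine_def lk_eq ql_integral_measure[OF assms(6)[OF A]] exp_G[OF A] by simp
  qed (rule levy_exp_0)
  have E_M: "exponent_measure PM S R \<Lambda>M l (?kM)"
  proof (intro exponent_measure.intro scat exponent_measure_axioms.intro sets_l)
    fix A \<theta> assume A: "A \<in> R"
    show "integrable l (\<lambda>s. indicator A s *\<^sub>R ?kM \<theta> s)" by (rule M.integrable_levy_exp_on[OF A])
    have "char (distr PM borel (\<Lambda>M A)) \<theta> = levy_khintchine (- \<nu>0 A) 0 (measure (M A)) \<theta>"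
      using assms(13) A by (auto simp: id_random_measure_def id_triplet_def qid_triplet_def)
    then show "char (distr PM borel (\<Lambda>M A)) \<theta> = exp (\<integral>s. indicator A s *\<^sub>R ?kM \<theta> s \<partial>l)"
      unfolding levy_khintchine_def lk_eq ql_integral_measure[OF assms(7)[OF A]] exp_M[OF A] by simp
  qed (rule levy_exp_0)
  \<comment> \<open>Here the location terms combine as 0 - (-\<nu>0), and the jump integral against
    \<open>F A\<close> splits into those against \<open>G A\<close> and \<open>M A\<close>.\<close>
  have E: "exponent_measure P S R \<Lambda> l (\<lambda>u s. ?kG u s - ?kM u s)"
  proof (intro exponent_measure.intro scat exponent_measure_axioms.intro sets_l)
    fix A \<theta> assume A: "A \<in> R"
    note i = G.integrable_levy_exp_on[OF A, of \<theta>] M.integrable_levy_exp_on[OF A, of \<theta>]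
    show "integrable l (\<lambda>s. indicator A s *\<^sub>R (?kG \<theta> s - ?kM \<theta> s))"
      unfolding scaleR_diff_right by (intro Bochner_Integration.integrable_diff i)
    have eq: "(\<integral>s. indicator A s *\<^sub>R (?kG \<theta> s - ?kM \<theta> s) \<partial>l)
      = (- of_real (\<theta>\<^sup>2 / 2) * of_real (\<nu>1 A) + (\<integral>x. lk \<theta> x \<partial>G A)) - (- (\<i> * of_real \<theta> * of_real (\<nu>0 A)) + (\<integral>x. lk \<theta> x \<partial>M A))"
      unfolding scaleR_diff_right exp_G[OF A, symmetric] exp_M[OF A, symmetric] by (intro Bochner_Integration.integral_diff i)
    have "levy_diff (F A) (G A) (M A)" using assms(6,7,10) A by (auto simp: levy_diff_def)
    then have ql: "ql_integral (F A) (lk \<theta>) = (\<integral>x. lk \<theta> x \<partial>G A) - (\<integral>x. lk \<theta> x \<partial>M A)"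
      by (rule ql_integral_levy_diff[OF _ _ norm_lk_le]) measurable
    have "char (distr P borel (\<Lambda> A)) \<theta> = levy_khintchine (\<nu>0 A) (\<nu>1 A) (F A) \<theta>"
      using assms(11) A by (auto simp: qid_random_measure_def qid_triplet_def)
    then show "char (distr P borel (\<Lambda> A)) \<theta> = exp (\<integral>s. indicator A s *\<^sub>R (?kG \<theta> s - ?kM \<theta> s) \<partial>l)"
      unfolding levy_khintchine_def lk_eq ql eq by (simp add: algebra_simps)
  qed (simp add: levy_exp_0)
  \<comment> \<open>A signed density is split by its sign. This needs vanishing integrals over all
    subsets of A in R, not over A alone.\<close>
  have AE_zero: "AE s in l. s \<in> A \<longrightarrow> h s = 0"
    if A: "A \<in> R" and h[measurable]: "h \<in> borel_measurable l" and i: "\<And>B. B \<in> R \<Longrightarrow> integrable l (\<lambda>s. indicator B s * h s)"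
      and z: "\<And>B. B \<in> R \<Longrightarrow> B \<subseteq> A \<Longrightarrow> (\<integral>s. indicator B s * h s \<partial>l) = 0" for A and h :: "'s \<Rightarrow> real"
  proof -
    define Bp Bn where "Bp = {s \<in> space l. 0 \<le> h s} \<inter> A" and "Bn = {s \<in> space l. h s \<le> 0} \<inter> A"
    have B: "Bp \<in> R" "Bn \<in> R" unfolding Bp_def Bn_def by (intro IntR A; measurable)+
    have "AE s in l. s \<in> Bp \<longrightarrow> h s = 0"
      using z[OF B(1)] by (intro AE_indicator_mult_eq_0 i B) (auto simp: Bp_def)
    moreover have "AE s in l. s \<in> Bn \<longrightarrow> - h s = 0"
      using z[OF B(2)] i[OF B(2)] by (intro AE_indicator_mult_eq_0) (auto simp: Bn_def)
    ultimately show ?thesis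
      using AE_space by eventually_elim (auto simp: Bp_def Bn_def)
  qed
  \<comment> \<open>A version of the density of a nonnegative set function may be negative on a null
    set; the sign is tested on the part of \<open>T n\<close> where the density is negative.\<close>
  have \<sigma>_nonneg: "AE s in l. 0 \<le> \<sigma>2 s"
  proof (rule AE_of_sigma_exhaustion[where T=T])
    show "(\<Union>n. T n) = space l" using T(3) spl by simp
    fix n
    define B where "B = {s \<in> space l. \<sigma>2 s < 0} \<inter> T n"
    have B: "B \<in> R" unfolding B_def using T(1) by (intro IntR; measurable) auto
    have "AE s in l. s \<in> B \<longrightarrow> - \<sigma>2 s = 0"
      using int_\<sigma>[OF B] B assms(5) by (intro AE_indicator_mult_eq_0) (auto simp: B_def finite_measure_on_def)
    then show "AE s in l. s \<in> T n \<longrightarrow> 0 \<le> \<sigma>2 s"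
      using AE_space by eventually_elim (auto simp: B_def not_less)
  qed
  have trunc_zero: "AE s in l. s \<in> A \<longrightarrow> trunc2 K 1 s = 0"
    if A: "A \<in> R" and i: "integrable l (\<lambda>s. indicator A s * trunc2 K 1 s)" and z: "(\<integral>\<^sup>+s. ennreal (indicator A s * trunc2 K 1 s) \<partial>l) = 0" for A and K :: "'s \<Rightarrow> real measure"
  proof (rule AE_indicator_mult_eq_0[OF i])
    show "(\<integral>s. indicator A s * trunc2 K 1 s \<partial>l) \<le> 0"
      using z nn_integral_eq_integral[OF i] by (simp add: trunc2_nonneg)
  qed (rule trunc2_nonneg)
  have null_G: "AE s in l. s \<in> A \<longrightarrow> ?mG 1 s = 0" if A: "A \<in> R" and z: "emeasure lG A = 0" for A
  proof -
    have "\<nu>1 A = 0" "(\<integral>\<^sup>+x. ennreal (min 1 (x\<^sup>2)) \<partial>G A) = 0"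
      using z l_G[OF A] assms(5) A by (auto simp: finite_measure_on_def)
    then have "(\<integral>s. indicator A s * \<sigma>2 s \<partial>l) = 0" "AE s in l. s \<in> A \<longrightarrow> trunc2 \<rho>G 1 s = 0"
      using int_\<sigma>(2)[OF A] onG(1)[OF A A A] onG(2)[OF A A A] trunc_zero[OF A, of \<rho>G] by auto
    moreover have "AE s in l. indicator A s * \<sigma>2 s = 0"
    proof (rule integral_nonneg_eq_0_iff_AE[OF int_\<sigma>(1)[OF A], THEN iffD1])
      show "AE s in l. 0 \<le> indicator A s * \<sigma>2 s" using \<sigma>_nonneg by eventually_elim simp
    qed fact
    ultimately show ?thesis
      by eventually_elim (auto simp: majorant_1)
  qed
  have null_M: "AE s in l. s \<in> A \<longrightarrow> ?mM 1 s = 0" if A: "A \<in> R" and z: "emeasure lM A = 0" for A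
  proof -
    have tv: "total_variation R \<nu>0 A = 0" and m: "(\<integral>\<^sup>+x. ennreal (min 1 (x\<^sup>2)) \<partial>M A) = 0"
      using z l_M[OF A] by auto
    \<comment> \<open>A null set of the control measure has zero total variation, which kills \<nu>0
      on every subset; \<open>\<nu>0 A = 0\<close> alone would allow cancellation inside A.\<close>
    have "\<nu>0 B = 0" if B: "B \<in> R" "B \<subseteq> A" for B
    proof -
      have "(\<Sum>B\<in>{B}. ennreal \<bar>\<nu>0 B\<bar>) \<le> total_variation R \<nu>0 A"
        unfolding total_variation_def using B by (intro SUP_upper) auto
      then show ?thesis using tv by simp
    qed
    then have "AE s in l. s \<in> A \<longrightarrow> a s = 0"
      using int_a by (intro AE_zero A) auto
    moreover have "AE s in l. s \<in> A \<longrightarrow> trunc2 \<rho>M 1 s = 0"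
      using m onM(1)[OF A A A] onM(2)[OF A A A] by (intro trunc_zero A) auto
    ultimately show ?thesis by eventually_elim (auto simp: majorant_1)
  qed
  \<comment> \<open>Measurability of the set of convergence turns an almost-everywhere statement for
    the smaller control measure into a null set of the common \<sigma>-algebra.\<close>
  have conv_sets: "{s \<in> space l. (\<lambda>n. simple_value (g n) s) \<longlonglongrightarrow> f s} \<in> sets l" if "\<And>n. simple_rep R (g n)" for g
  proof -
    have [measurable]: "simple_value (g n) \<in> borel_measurable l" for n by (rule G.measurable_simple_value[OF that])
    show ?thesis by measurable
  qed
  have maj_G: "integrable l (\<lambda>s. ?mG (f s) s)"
  proof -
    obtain g where "approximating_sequence PG S R lG \<Lambda>G f g" using assms(25) by (auto simp: random_integrable_def)
    then have g: "\<And>n. simple_rep R (g n)" "AE s in lG. (\<lambda>n. simple_value (g n) s) \<longlonglongrightarrow> f s"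
      "\<And>A. A \<in> sets l \<Longrightarrow> \<exists>Y. tendsto_in_prob PG (\<lambda>n. simple_integral_on \<Lambda>G A (g n)) Y"
      by (auto simp: approximating_sequence_def sl)
    show ?thesis
      by (rule G.integrable_majorant_of_convergence[OF E_G \<sigma>_nonneg fm g(1,3)
          AE_control_measure[OF D.delta_ring_on_axioms sl spl sets_l(2) T(1,3) null_G conv_sets[OF g(1)] g(2)]])
  qed
  have maj_M: "integrable l (\<lambda>s. ?mM (f s) s)"
  proof -
    obtain g where "approximating_sequence PM S R lM \<Lambda>M f g" using assms(26) by (auto simp: random_integrable_def)
    then have g: "\<And>n. simple_rep R (g n)" "AE s in lM. (\<lambda>n. simple_value (g n) s) \<longlonglongrightarrow> f s"
      "\<And>A. A \<in> sets l \<Longrightarrow> \<exists>Y. tendsto_in_prob PM (\<lambda>n. simple_integral_on \<Lambda>M A (g n)) Y"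
      by (auto simp: approximating_sequence_def sl)
    show ?thesis
      by (rule M.integrable_majorant_of_convergence[OF E_M _ fm g(1,3)
          AE_control_measure[OF D.delta_ring_on_axioms sl spl sets_l(3) T(1,3) null_M conv_sets[OF g(1)] g(2)]]) simp
  qed
  have diff: "levy_diff (\<rho> s) (\<rho>G s) (\<rho>M s)" if "s \<in> space l" for s
    using assms(19,20,23) that by (auto simp: levy_diff_def levy_kernel_def spl)
  interpret Q: qid_integral l \<rho>G \<rho>M a \<sigma>2 P S R \<Lambda> f \<rho>
    by (intro qid_integral.intro difference_measure.intro chars E qid_integral_axioms.intro
        difference_measure_axioms.intro fm maj_G maj_M diff)
  have char: "(CLINT \<omega>|P. iexp (\<theta> * X \<omega>)) =
      levy_khintchine (\<integral>s. U_fun a \<rho> (f s) s \<partial>l) (\<integral>s. \<bar>f s\<bar>\<^sup>2 * \<sigma>2 s \<partial>l) Q.Ff \<theta>"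
    if X: "has_random_integral P S R l \<Lambda> f S X" for X \<theta>
  proof -
    have [measurable]: "X \<in> borel_measurable P" using X by (auto simp: has_random_integral_def tendsto_in_prob_def)
    show ?thesis
      unfolding Q.char_has_random_integral[OF X, symmetric] char_def by (simp add: integral_distr)
  qed
  have gauss: "integrable l (\<lambda>s. \<bar>f s\<bar>\<^sup>2 * \<sigma>2 s)" using G.integrable_gauss[OF fm maj_G] by simp
  show ?thesis
    by (intro conjI, rule Q.integrable_U_fun, rule gauss, rule Q.V0_fun, rule Q.V0_fun, rule Q.random_integrable[OF T],
        rule exI[of _ Q.Fp], rule exI[of _ Q.Fm], rule exI[of _ Q.Ff])
       (use Q.levy_Fp Q.levy_Fm Q.emeasure_Fp Q.emeasure_Fm Q.Ff_def Q.quasi_levy_measure_Ff[OF T]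
         char[unfolded levy_khintchine_def] in blast)
qed

end
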